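(* Let $\Omega\in\mathbb{R}$ and let $\widetilde M_1^\varepsilon$ be the rescaled, phase-compensated Fourier transform of the two-frequency second-order moment in the scintillation regime ($C\to\varepsilon C$, $r_0\to r_0/\varepsilon$, $\rho_0\to\rho_0/\varepsilon$, distance $z/\varepsilon$), as defined in the context. Then, for $z\ge0$, $$\widetilde M_1^\varepsilon\big(\tfrac z\varepsilon,\xi,\zeta\big)=K(z)\,\phi^\varepsilon_{\sqrt2\rho_0}(\xi)\,\phi^\varepsilon_{r_0/\sqrt2}(\zeta)+\phi^\varepsilon_{r_0/\sqrt2}(\zeta)\,A\big(z,\xi,\tfrac\zeta\varepsilon,\Omega\big)+R_1^\varepsilon(z,\xi,\zeta),$$ where $K(z)=(2\pi)^4\exp\big(-\frac{\omega_0^2}{4c_o^2}C(0)z\big)$, where $(z,\xi)\mapsto A(z,\xi,\zeta,\Omega)$ is the solution of $$\partial_zA=\frac{ic_o\Omega}{\omega_0^2}|\xi|^2A+\frac{\omega_0^2}{4(2\pi)^2c_o^2}\int_{\mathbb{R}^2}\hat C(k)\big[A(\xi-k)e^{\frac{ic_oz}{\omega_0}k\cdot\zeta}-A(\xi)\big]dk+\frac{\omega_0^2}{4(2\pi)^2c_o^2}K(z)\hat C(\xi)e^{\frac{ic_oz}{\omega_0}\xi\cdot\zeta}$$ starting from $A(z=0,\xi,\zeta,\Omega)=0$, and where for every $Z>0$ $$\sup_{z\in[0,Z]}\|R_1^\varepsilon(z,\cdot,\cdot)\|_{L^1(\mathbb{R}^2\times\mathbb{R}^2)}\longrightarrow0\quad\text{as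 }\varepsilon\to0.$$
   Context: Constants $c_o,\omega_0,r_0,\rho_0>0$. $C:\mathbb{R}^2\to\mathbb{R}$ is the covariance function of the medium: even, continuous, integrable, with Fourier transform $\hat C(k)=\int_{\mathbb{R}^2}C(x)e^{-ik\cdot x}dx$ nonnegative (Bochner) and in $L^1(\mathbb{R}^2)$, so $C(0)=(2\pi)^{-2}\int\hat C(k)dk$. $\phi^\varepsilon_\rho(\xi)=\frac{\rho^2}{2\pi\varepsilon^2}\exp(-\frac{\rho^2|\xi|^2}{2\varepsilon^2})$ for $\xi\in\mathbb{R}^2$. The equation for $A$ has $\zeta,\Omega$ as frozen parameters and is understood in the mild sense with values in $L^1(d\xi)$. Second-order moment. For frequencies $\omega,\tilde\omega$, the moment $$M_1(z,x,y)=\iint_{\mathbb{R}^2\times\mathbb{R}^2} e^{-\frac{|x'|^2}{r_0^2}-\frac{|y'|^2}{4\rho_0^2}}\,\mathbb{E}\big[\hat G(\omega,z,x,x'+\tfrac{y'}2)\overline{\hat G(\tilde\omega,z,y,x'-\tfrac{y'}2)}\big]dx'dy'$$ of the Green's function $\hat G$ of the Itô–Schrödinger equation $d\hat G=\frac{ic_o}{2\omega}\Delta_x\hat G\,dz+\frac{i\omega}{2c_o}\hat G\circ dB(z,x)$, $\hat G(\omega,0,x,y)=\delta(x-y)$ ($\circ$: Stratonovich; $B$ real Brownian field with $\mathbb{E}[B(z,x)B(z',x')]=\min\{z,z'\}C(x-x')$), is characterized as the solution of $$\partial_zM_1=\frac{ic_o}2\Big(\frac1\omega\Delta_x-\frac1{\tilde\omega}\Delta_y\Big)M_1+\frac1{8c_o^2}\big(2\omega\tilde\omega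 C(x-y)-(\omega^2+\tilde\omega^2)C(0)\big)M_1,\quad M_1(0,x,y)=e^{-\frac{|x+y|^2}{4r_0^2}-\frac{|x-y|^2}{4\rho_0^2}}$$ (mild sense in Fourier space, Fourier transform in $L^1$). This characterization may be taken as the definition. Scintillation regime. Let $M_1^\varepsilon(z,q,r)$ be $M_1(z,r+\frac q2,r-\frac q2)$ with $C,r_0,\rho_0$ replaced by $\varepsilon C,r_0/\varepsilon,\rho_0/\varepsilon$ and with $\omega=\omega_0+\varepsilon\Omega$, $\tilde\omega=\omega_0-\varepsilon\Omega$. Set $$\hat M_1^\varepsilon(\tfrac z\varepsilon,\xi,\zeta)=\iint M_1^\varepsilon(\tfrac z\varepsilon,q,r)e^{-iq\cdot\xi-ir\cdot\zeta}\,dr\,dq,\qquad\widetilde M_1^\varepsilon(\tfrac z\varepsilon,\xi,\zeta)=\hat M_1^\varepsilon(\tfrac z\varepsilon,\xi,\zeta)\exp\Big(\frac{ic_oz}{\omega_0\varepsilon}\xi\cdot\zeta\Big).$$ *)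

theory Defs
  imports "HOL-Analysis.Analysis"
begin

type_synonym R2 = "real ^ 2"

definition fourier :: "('a::euclidean_space \<Rightarrow> complex) \<Rightarrow> 'a \<Rightarrow> complex" where
  "fourier f k = (LINT x|lborel. f x * cis (- (k \<bullet> x)))"

text \<open>
  The moment \<open>M\<^sub>1(z,\<cdot>,\<cdot>)\<close> is known to be the inverse Fourier transform of an \<open>L\<^sup>1\<close>
  function, but it need not be absolutely integrable itself, so that the integral \<open>fourier\<close>
  (which is \<open>0\<close> for a non-integrable integrand) cannot be used for it.  Its Fourier
  transform is the \<open>L\<^sup>1\<close> function, unique up to null sets, that represents it by Fourier inversion.
  For an integrable \<open>f\<close> of this kind it agrees with \<open>fourier f\<close> almost everywhere.
\<close>

definition has_L1_fourier :: "('a::euclidean_space \<Rightarrow> complex) \<Rightarrow> ('a \<Rightarrow> complex) \<Rightarrow> bool" where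
  "has_L1_fourier f g \<longleftrightarrow> integrable lborel g \<and>
     (\<forall>x. f x = (1 / (2 * pi) ^ DIM('a)) *\<^sub>R (LINT k|lborel. g k * cis (k \<bullet> x)))"

definition L1_fourier :: "('a::euclidean_space \<Rightarrow> complex) \<Rightarrow> 'a \<Rightarrow> complex" where
  "L1_fourier f = (SOME g. has_L1_fourier f g)"

definition covariance_function :: "(R2 \<Rightarrow> real) \<Rightarrow> bool" where
  "covariance_function C \<longleftrightarrow>
     (\<forall>x. C (- x) = C x) \<and> continuous_on UNIV C \<and> integrable lborel C \<and>
     (\<forall>k. fourier (\<lambda>x. of_real (C x)) k \<in> \<real>\<^sub>\<ge>\<^sub>0) \<and>
     integrable lborel (fourier (\<lambda>x. of_real (C x)))"

abbreviation C_hat :: "(R2 \<Rightarrow> real) \<Rightarrow> R2 \<Rightarrow> complex" where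
  "C_hat C \<equiv> fourier (\<lambda>x. of_real (C x))"

definition phi :: "real \<Rightarrow> real \<Rightarrow> R2 \<Rightarrow> real" where
  "phi \<epsilon> \<rho> \<xi> = \<rho>\<^sup>2 / (2 * pi * \<epsilon>\<^sup>2) * exp (- (\<rho>\<^sup>2 * (norm \<xi>)\<^sup>2 / (2 * \<epsilon>\<^sup>2)))"

text \<open>
  The space \<open>C([0,\<infinity>); L\<^sup>1)\<close> in which mild solutions live.  Elements of \<open>L\<^sup>1\<close> are given
  by representatives, chosen jointly measurable in \<open>(z,p)\<close>, which is always possible for a
  continuous path.  Values at \<open>z < 0\<close> are irrelevant.
\<close>

definition L1_path :: "(real \<Rightarrow> 'a::euclidean_space \<Rightarrow> complex) \<Rightarrow> bool" where
  "L1_path u \<longleftrightarrow>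
     set_borel_measurable borel ({0..} \<times> UNIV) (\<lambda>(z, p). u z p) \<and>
     (\<forall>z\<ge>0. integrable lborel (u z)) \<and>
     (\<forall>z\<ge>0. ((\<lambda>s. LINT p|lborel. norm (u s p - u z p)) \<longlongrightarrow> 0) (at z within {0..}))"

definition M1_init :: "real \<Rightarrow> real \<Rightarrow> R2 \<times> R2 \<Rightarrow> real" where
  "M1_init r\<^sub>0 \<rho>\<^sub>0 = (\<lambda>(x, y).
     exp (- ((norm (x + y))\<^sup>2 / (4 * r\<^sub>0\<^sup>2)) - (norm (x - y))\<^sup>2 / (4 * \<rho>\<^sub>0\<^sup>2)))"

text \<open>
  Duhamel formula for the Fourier transform \<open>m z (p,p')\<close> of \<open>M\<^sub>1(z,x,y)\<close> in \<open>(x,y)\<close>.  The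
  operator \<open>(i c\<^sub>o/2)(\<omega>\<^sup>-\<^sup>1 \<Delta>\<^sub>x - \<omega>'\<^sup>-\<^sup>1 \<Delta>\<^sub>y)\<close> has the symbol
  \<open>-i M1_symbol\<close>, and multiplication by \<open>C(x - y)\<close> becomes
  \<open>m \<mapsto> (2\<pi>)\<^sup>-\<^sup>2 \<integral> C_hat(k) m(p - k, p' + k) dk\<close>.
\<close>

definition M1_symbol :: "real \<Rightarrow> real \<Rightarrow> real \<Rightarrow> R2 \<times> R2 \<Rightarrow> real" where
  "M1_symbol c\<^sub>o \<omega> \<omega>' = (\<lambda>(p, p'). c\<^sub>o / 2 * ((norm p)\<^sup>2 / \<omega> - (norm p')\<^sup>2 / \<omega>'))"

definition M1_interaction ::
  "(R2 \<Rightarrow> real) \<Rightarrow> real \<Rightarrow> real \<Rightarrow> real \<Rightarrow> (R2 \<times> R2 \<Rightarrow> complex) \<Rightarrow> R2 \<times> R2 \<Rightarrow> complex" where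
  "M1_interaction C c\<^sub>o \<omega> \<omega>' m = (\<lambda>(p, p').
     (1 / (8 * c\<^sub>o\<^sup>2)) *\<^sub>R
       ((2 * \<omega> * \<omega>' / (2 * pi)\<^sup>2) *\<^sub>R (LINT k|lborel. C_hat C k * m (p - k, p' + k))
        - ((\<omega>\<^sup>2 + \<omega>'\<^sup>2) * C 0) *\<^sub>R m (p, p')))"

definition M1_mild_fourier ::
  "(R2 \<Rightarrow> real) \<Rightarrow> real \<Rightarrow> real \<Rightarrow> real \<Rightarrow> real \<Rightarrow> real \<Rightarrow> (real \<Rightarrow> R2 \<times> R2 \<Rightarrow> complex) \<Rightarrow> bool" where
  "M1_mild_fourier C c\<^sub>o r\<^sub>0 \<rho>\<^sub>0 \<omega> \<omega>' m \<longleftrightarrow>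
     L1_path m \<and>
     (\<forall>z\<ge>0. AE P in lborel.
        m z P =
          cis (- (z * M1_symbol c\<^sub>o \<omega> \<omega>' P)) * fourier (\<lambda>X. of_real (M1_init r\<^sub>0 \<rho>\<^sub>0 X)) P
          + (LINT s:{0..z}|lborel.
               cis (- ((z - s) * M1_symbol c\<^sub>o \<omega> \<omega>' P)) * M1_interaction C c\<^sub>o \<omega> \<omega>' (m s) P))"

definition is_M1 ::
  "(R2 \<Rightarrow> real) \<Rightarrow> real \<Rightarrow> real \<Rightarrow> real \<Rightarrow> real \<Rightarrow> real \<Rightarrow> (real \<Rightarrow> R2 \<Rightarrow> R2 \<Rightarrow> complex) \<Rightarrow> bool" where
  "is_M1 C c\<^sub>o r\<^sub>0 \<rho>\<^sub>0 \<omega> \<omega>' M \<longleftrightarrow>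
     (\<exists>m. M1_mild_fourier C c\<^sub>o r\<^sub>0 \<rho>\<^sub>0 \<omega> \<omega>' m \<and>
          (\<forall>z\<ge>0. has_L1_fourier (\<lambda>(x, y). M z x y) (m z)))"

text \<open>\<open>is_M1\<close> determines \<open>M z x y\<close> at every \<open>(x,y)\<close> for \<open>z \<ge> 0\<close>; only the irrelevant values at
  \<open>z < 0\<close> are left to the choice operator.\<close>

definition M1 ::
  "(R2 \<Rightarrow> real) \<Rightarrow> real \<Rightarrow> real \<Rightarrow> real \<Rightarrow> real \<Rightarrow> real \<Rightarrow> real \<Rightarrow> R2 \<Rightarrow> R2 \<Rightarrow> complex" where
  "M1 C c\<^sub>o r\<^sub>0 \<rho>\<^sub>0 \<omega> \<omega>' = (SOME M. is_M1 C c\<^sub>o r\<^sub>0 \<rho>\<^sub>0 \<omega> \<omega>' M)"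

definition M1_eps ::
  "(R2 \<Rightarrow> real) \<Rightarrow> real \<Rightarrow> real \<Rightarrow> real \<Rightarrow> real \<Rightarrow> real \<Rightarrow> real \<Rightarrow> real \<Rightarrow> R2 \<Rightarrow> R2 \<Rightarrow> complex" where
  "M1_eps C c\<^sub>o r\<^sub>0 \<rho>\<^sub>0 \<omega>\<^sub>0 \<Omega> \<epsilon> z q r =
     M1 (\<lambda>x. \<epsilon> * C x) c\<^sub>o (r\<^sub>0 / \<epsilon>) (\<rho>\<^sub>0 / \<epsilon>) (\<omega>\<^sub>0 + \<epsilon> * \<Omega>) (\<omega>\<^sub>0 - \<epsilon> * \<Omega>) z
       (r + q /\<^sub>R 2) (r - q /\<^sub>R 2)"

definition M1_hat ::
  "(R2 \<Rightarrow> real) \<Rightarrow> real \<Rightarrow> real \<Rightarrow> real \<Rightarrow> real \<Rightarrow> real \<Rightarrow> real \<Rightarrow> real \<Rightarrow> R2 \<Rightarrow> R2 \<Rightarrow> complex" where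
  "M1_hat C c\<^sub>o r\<^sub>0 \<rho>\<^sub>0 \<omega>\<^sub>0 \<Omega> \<epsilon> z \<xi> \<zeta> =
     L1_fourier (\<lambda>(q, r). M1_eps C c\<^sub>o r\<^sub>0 \<rho>\<^sub>0 \<omega>\<^sub>0 \<Omega> \<epsilon> z q r) (\<xi>, \<zeta>)"

text \<open>The propagation distance is the actual one: with \<open>z/\<epsilon>\<close> in place of \<open>z\<close> the phase is
  \<open>c\<^sub>o z \<xi>\<cdot>\<zeta> / (\<omega>\<^sub>0 \<epsilon>)\<close>.\<close>

definition M1_tilde ::
  "(R2 \<Rightarrow> real) \<Rightarrow> real \<Rightarrow> real \<Rightarrow> real \<Rightarrow> real \<Rightarrow> real \<Rightarrow> real \<Rightarrow> real \<Rightarrow> R2 \<Rightarrow> R2 \<Rightarrow> complex" where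
  "M1_tilde C c\<^sub>o r\<^sub>0 \<rho>\<^sub>0 \<omega>\<^sub>0 \<Omega> \<epsilon> z \<xi> \<zeta> =
     M1_hat C c\<^sub>o r\<^sub>0 \<rho>\<^sub>0 \<omega>\<^sub>0 \<Omega> \<epsilon> z \<xi> \<zeta> * cis (c\<^sub>o * z / \<omega>\<^sub>0 * (\<xi> \<bullet> \<zeta>))"

definition K :: "(R2 \<Rightarrow> real) \<Rightarrow> real \<Rightarrow> real \<Rightarrow> real \<Rightarrow> real" where
  "K C c\<^sub>o \<omega>\<^sub>0 z = (2 * pi) ^ 4 * exp (- (\<omega>\<^sub>0\<^sup>2 / (4 * c\<^sub>o\<^sup>2) * C 0 * z))"

text \<open>
  Mild solution \<open>a z \<xi>\<close> of the equation for \<open>A(z,\<xi>,\<zeta>,\<Omega>)\<close> with \<open>\<zeta>\<close>, \<open>\<Omega>\<close> frozen: the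
  unbounded multiplication by \<open>i c\<^sub>o \<Omega> |\<xi>|\<^sup>2 / \<omega>\<^sub>0\<^sup>2\<close> generates the semigroup, the scattering term and
  the source term are integrated against it, and the initial value is \<open>0\<close>.
\<close>

definition A_rhs ::
  "(R2 \<Rightarrow> real) \<Rightarrow> real \<Rightarrow> real \<Rightarrow> R2 \<Rightarrow> real \<Rightarrow> (R2 \<Rightarrow> complex) \<Rightarrow> R2 \<Rightarrow> complex" where
  "A_rhs C c\<^sub>o \<omega>\<^sub>0 \<zeta> z a \<xi> =
     (\<omega>\<^sub>0\<^sup>2 / (4 * (2 * pi)\<^sup>2 * c\<^sub>o\<^sup>2)) *\<^sub>R
       (LINT k|lborel. C_hat C k * (a (\<xi> - k) * cis (c\<^sub>o * z / \<omega>\<^sub>0 * (k \<bullet> \<zeta>)) - a \<xi>))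
     + (\<omega>\<^sub>0\<^sup>2 / (4 * (2 * pi)\<^sup>2 * c\<^sub>o\<^sup>2) * K C c\<^sub>o \<omega>\<^sub>0 z) *\<^sub>R
       (C_hat C \<xi> * cis (c\<^sub>o * z / \<omega>\<^sub>0 * (\<xi> \<bullet> \<zeta>)))"

definition A_mild ::
  "(R2 \<Rightarrow> real) \<Rightarrow> real \<Rightarrow> real \<Rightarrow> R2 \<Rightarrow> real \<Rightarrow> (real \<Rightarrow> R2 \<Rightarrow> complex) \<Rightarrow> bool" where
  "A_mild C c\<^sub>o \<omega>\<^sub>0 \<zeta> \<Omega> a \<longleftrightarrow>
     L1_path a \<and>
     (\<forall>z\<ge>0. AE \<xi> in lborel.
        a z \<xi> = (LINT s:{0..z}|lborel.
          cis ((z - s) * (c\<^sub>o * \<Omega> / \<omega>\<^sub>0\<^sup>2 * (norm \<xi>)\<^sup>2)) * A_rhs C c\<^sub>o \<omega>\<^sub>0 \<zeta> s (a s) \<xi>))"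

end

theory Submission
  imports Defs "HOL-Probability.Characteristic_Functions"
begin

text \<open>
  In the variables \<open>\<xi> = (p - p')/2\<close>, \<open>\<zeta> = p + p'\<close> the scattering term of the moment equation is a
  convolution in \<open>\<xi>\<close> alone, so \<open>\<zeta>\<close> is a spectator, and after phase compensation and with \<open>\<zeta>\<close>
  measured in units of \<open>\<epsilon>\<close> the moment solves a linear Volterra equation in \<open>L\<^sup>1\<close> whose coefficients
  converge to those of the equation for \<open>A\<close>.  Its initial datum \<open>(2\<pi>)\<^sup>4 \<phi>(\<xi>) \<phi>(\<zeta>)\<close> concentrates at
  \<open>\<xi> = 0\<close>: the unscattered part decays like \<open>K\<close>, and one scattering off it produces the source
  \<open>C_hat(\<xi>)\<close>, because \<open>\<phi>\<close> is an approximate identity and \<open>C_hat\<close> is continuous and integrable.  Inserting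
  \<open>K \<phi> \<phi> + \<phi> A\<close> into the rescaled equation therefore leaves a residual that vanishes in \<open>L\<^sup>1\<close> by
  dominated convergence, and Gronwall's inequality turns this into the bound for the remainder.

  Solutions are built by Picard iteration.  All iterates are dominated, uniformly in \<open>z\<close>, by one
  function that is finite almost everywhere, so that no null set depends on \<open>z\<close> or \<open>\<zeta>\<close>.
\<close>

section \<open>Linear Volterra equations with a convolution kernel\<close>

text \<open>The beam \<open>\<phi>(\<xi>)\<close> tends to a point mass and has no limit in L^1; it
  therefore stays in the ansatz as an explicit term, and only what has been scattered out of it is
  collected in \<open>A\<close>. The scaling is balanced: the factor \<open>\<epsilon>\<close> of
  the covariance cancels the distance \<open>1/\<epsilon>\<close>, so the scattering and damping
  coefficients differ from their limits only by the relative amount \<open>\<epsilon>\<^sup>2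
  \<Omega>\<^sup>2 / \<omega>\<^sub>0\<^sup>2\<close>. The residual phase, however, is in general
  quadratic in \<open>(\<xi>, \<zeta>)\<close> and converges only locally uniformly, so the two
  evolutions are not close in operator norm. The comparison is one of consistency and stability:
  phases are compared on fixed integrable functions (\<open>A\<close>, and the Gaussians after
  \<open>\<xi> = \<epsilon> \<eta>\<close>), while the scattering operator is bounded on L^1
  uniformly in \<open>\<epsilon>\<close>. The moment itself is reached only through choice
  operators; existence of a mild solution and injectivity of the Fourier transform on L^1 replace
  them by a concrete path.\<close>

lemma cis_measurable [measurable]: "cis \<in> borel_measurable borel"
  by (intro borel_measurable_continuous_onI continuous_intros)

text \<open>Covers non-integrable \<open>f\<close> as well, whose Bochner integral is 0 by
  convention. Bounds can thus be run in \<open>ennreal\<close> before integrability is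
  known.\<close>

lemma norm_lint_le:
  fixes f :: "'a \<Rightarrow> 'b::{banach, second_countable_topology}"
  shows "ennreal (norm (LINT x|M. f x)) \<le> (\<integral>\<^sup>+x. ennreal (norm (f x)) \<partial>M)"
  by (cases "integrable M f") (auto simp: integral_norm_bound_ennreal not_integrable_integral_eq)

lemma norm_set_lint_le:
  fixes f :: "'a \<Rightarrow> 'b::{banach, second_countable_topology}"
  shows "ennreal (norm (LINT x:A|M. f x)) \<le> (\<integral>\<^sup>+x\<in>A. ennreal (norm (f x)) \<partial>M)"
  unfolding set_lebesgue_integral_def
  by (rule order_trans[OF norm_lint_le]) (auto intro!: nn_integral_mono split: split_indicator)

text \<open>Termwise integration of a Picard series. The single finiteness condition yields
  integrability of every term, summability almost everywhere and summability of the L^1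
  norms.\<close>

lemma sums_lint:
  fixes f :: "nat \<Rightarrow> 'a \<Rightarrow> 'b::{banach, second_countable_topology}"
  assumes [measurable]: "\<And>n. f n \<in> borel_measurable M"
    and fin: "(\<Sum>n. \<integral>\<^sup>+x. ennreal (norm (f n x)) \<partial>M) < \<infinity>"
  shows "(\<lambda>n. LINT x|M. f n x) sums (LINT x|M. (\<Sum>n. f n x))"
proof -
  have int: "integrable M (f n)" for n
  proof (rule integrableI_bounded)
    have "(\<integral>\<^sup>+x. ennreal (norm (f n x)) \<partial>M) \<le> (\<Sum>n. \<integral>\<^sup>+x. ennreal (norm (f n x)) \<partial>M)"
      using sum_le_suminf[of "\<lambda>n. \<integral>\<^sup>+x. ennreal (norm (f n x)) \<partial>M" "{n}"] by simp
    then show "(\<integral>\<^sup>+x. ennreal (norm (f n x)) \<partial>M) < \<infinity>" using fin by (rule le_less_trans)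
  qed simp
  have "(\<integral>\<^sup>+x. (\<Sum>n. ennreal (norm (f n x))) \<partial>M) < \<infinity>"
    using fin by (subst nn_integral_suminf) auto
  then have "AE x in M. (\<Sum>n. ennreal (norm (f n x))) \<noteq> \<infinity>"
    by (intro nn_integral_PInf_AE) auto
  then have ae: "AE x in M. summable (\<lambda>n. norm (f n x))"
    by eventually_elim (auto intro!: summable_suminf_not_top)
  have eq: "ennreal (LINT x|M. norm (f n x)) = (\<integral>\<^sup>+x. ennreal (norm (f n x)) \<partial>M)" for n
    by (rule nn_integral_eq_integral[symmetric]) (use int in auto)
  have "summable (\<lambda>n. LINT x|M. norm (f n x))"
    by (rule summable_suminf_not_top) (use fin in \<open>auto simp: eq\<close>)
  then show ?thesis by (rule sums_integral[OF int ae])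
qed

text \<open>Convergence along \<open>at z within S\<close> is tested on sequences, which reduces the
  claim to the sequential dominated convergence theorem; the null set of the bound may depend on
  \<open>s\<close>.\<close>

lemma lint_dominated_within:
  fixes f :: "real \<Rightarrow> 'a \<Rightarrow> 'b::{banach, second_countable_topology}"
  assumes "\<And>s. s \<in> S \<Longrightarrow> f s \<in> borel_measurable M" "f0 \<in> borel_measurable M"
    and w: "integrable M w"
    and lim: "AE x in M. ((\<lambda>s. f s x) \<longlongrightarrow> f0 x) (at z within S)"
    and bd: "\<And>s. s \<in> S \<Longrightarrow> AE x in M. norm (f s x) \<le> w x"
  shows "((\<lambda>s. LINT x|M. f s x) \<longlongrightarrow> (LINT x|M. f0 x)) (at z within S)"
  unfolding tendsto_at_iff_sequentially comp_def
proof (intro allI impI)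
  fix X :: "nat \<Rightarrow> real"
  assume X: "\<forall>i. X i \<in> S - {z}" "X \<longlonglongrightarrow> z"
  show "(\<lambda>i. LINT x|M. f (X i) x) \<longlonglongrightarrow> (LINT x|M. f0 x)"
  proof (rule integral_dominated_convergence[where w=w])
    show "AE x in M. (\<lambda>i. f (X i) x) \<longlonglongrightarrow> f0 x"
      using lim by eventually_elim (use X in \<open>auto simp: tendsto_at_iff_sequentially comp_def\<close>)
  qed (use assms X in auto)
qed

text \<open>Induction step of the Picard bound: the weight \<open>1 + s\<close> is frozen at its
  endpoint value, so that one integration only raises the power and the factorial.\<close>

lemma nn_integral_power_fact_le:
  assumes "0 \<le> (z::real)"
  shows "(\<integral>\<^sup>+s\<in>{0..z}. ennreal ((1 + s) * s ^ n / fact n) \<partial>lborel) \<le> ennreal ((1 + z) * z ^ Suc n / fact (Suc n))"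
proof -
  have "(\<integral>\<^sup>+s\<in>{0..z}. ennreal ((1 + s) * s ^ n / fact n) \<partial>lborel)
      \<le> (\<integral>\<^sup>+s. ennreal ((1 + z) * (s ^ n / fact n)) * indicator {0..z} s \<partial>lborel)"
    using assms
    by (intro nn_integral_mono) (auto split: split_indicator intro!: ennreal_leI divide_right_mono mult_right_mono)
  also have "\<dots> = ennreal ((1 + z) * (z ^ Suc n / fact (Suc n)) - (1 + z) * (0 ^ Suc n / fact (Suc n)))"
  proof (rule nn_integral_FTC_Icc[where F="\<lambda>s. (1 + z) * (s ^ Suc n / fact (Suc n))"])
    fix x :: real
    show "((\<lambda>s. (1 + z) * (s ^ Suc n / fact (Suc n))) has_real_derivative (1 + z) * (x ^ n / fact n)) (at x)"
    proof (rule DERIV_cong)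
      show "((\<lambda>s. (1 + z) * (s ^ Suc n / fact (Suc n))) has_real_derivative (1 + z) * (real (Suc n) * x ^ n / fact (Suc n))) (at x)"
        using DERIV_cmult[OF DERIV_cdivide[OF DERIV_pow[of "Suc n" x UNIV], of "fact (Suc n)"], of "1 + z"]
        by simp
      show "(1 + z) * (real (Suc n) * x ^ n / fact (Suc n)) = (1 + z) * (x ^ n / fact n)"
        by (simp add: fact_Suc del: of_nat_Suc)
    qed
  qed (use assms in auto)
  finally show ?thesis by simp
qed

text \<open>
  The equation is \<open>u z = S z + \<integral>\<^sub>0\<^sup>z cis ((z - s) th) gen s (u s) ds\<close>.  The map \<open>J\<close> embeds the convolution
  variable: \<open>k \<mapsto> (k, -k)\<close> for the moment in the variables \<open>(p, p')\<close>, and \<open>k \<mapsto> (k, 0)\<close> in the variables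
  \<open>(\<xi>, \<zeta>)\<close>.
\<close>

locale volterra =
  fixes J :: "'k::euclidean_space \<Rightarrow> 'b::euclidean_space" and H :: "real \<Rightarrow> 'b \<Rightarrow> 'k \<Rightarrow> complex"
    and g :: "'k \<Rightarrow> real" and lam :: real and th :: "'b \<Rightarrow> real"
  assumes J_measurable [measurable]: "J \<in> borel_measurable borel"
    and H_measurable: "(\<lambda>(s, P, k). H s P k) \<in> borel_measurable (borel \<Otimes>\<^sub>M borel \<Otimes>\<^sub>M borel)"
    and H_le: "norm (H s P k) \<le> g k"
    and g_integrable: "integrable lborel g"
    and lam_nonneg: "0 \<le> lam"
    and th_measurable [measurable]: "th \<in> borel_measurable borel"
begin

lemma g_nonneg: "0 \<le> g k"
  using H_le[of 0 0 k] norm_ge_zero order_trans by blast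

lemma g_measurable [measurable]: "g \<in> borel_measurable borel"
  using borel_measurable_integrable[OF g_integrable] by simp

lemma H_measurable' [measurable (raw)]:
  assumes [measurable]: "a \<in> borel_measurable M" "b \<in> borel_measurable M" "c \<in> borel_measurable M"
  shows "(\<lambda>x. H (a x) (b x) (c x)) \<in> borel_measurable M"
  using measurable_compose[OF _ H_measurable, of "\<lambda>x. (a x, b x, c x)" M] by simp

definition gen :: "real \<Rightarrow> ('b \<Rightarrow> complex) \<Rightarrow> 'b \<Rightarrow> complex" where
  "gen s f P = (LINT k|lborel. H s P k * f (P - J k)) - lam *\<^sub>R f P"

text \<open>Positive operator that dominates \<open>gen\<close> pointwise. With values in
  \<open>ennreal\<close> it can be iterated and summed without any question of convergence.\<close>

definition dom :: "('b \<Rightarrow> ennreal) \<Rightarrow> 'b \<Rightarrow> ennreal" where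
  "dom f P = (\<integral>\<^sup>+k. ennreal (g k) * f (P - J k) \<partial>lborel) + ennreal lam * f P"

text \<open>
  Majorant of the Picard series started from a source bounded by \<open>(1 + z) \<sigma>\<close>.
\<close>

definition W :: "('b \<Rightarrow> ennreal) \<Rightarrow> real \<Rightarrow> 'b \<Rightarrow> ennreal" where
  "W \<sigma> z P = (\<Sum>n. ennreal (z ^ n / fact n) * (dom ^^ n) \<sigma> P)"

lemma dom_measurable [measurable]:
  assumes [measurable]: "f \<in> borel_measurable borel"
  shows "dom f \<in> borel_measurable borel"
  unfolding dom_def[abs_def] by measurable

lemma dom_mono: "(\<And>Q. f Q \<le> h Q) \<Longrightarrow> dom f P \<le> dom h P"
  unfolding dom_def by (intro add_mono nn_integral_mono mult_left_mono) auto

lemma dom_cmult: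
  assumes [measurable]: "f \<in> borel_measurable borel"
  shows "dom (\<lambda>Q. c * f Q) P = c * dom f P"
proof -
  have "(\<integral>\<^sup>+k. ennreal (g k) * (c * f (P - J k)) \<partial>lborel) = (\<integral>\<^sup>+k. c * (ennreal (g k) * f (P - J k)) \<partial>lborel)"
    by (simp add: ac_simps)
  also have "\<dots> = c * (\<integral>\<^sup>+k. ennreal (g k) * f (P - J k) \<partial>lborel)"
    by (rule nn_integral_cmult) measurable
  finally show ?thesis by (simp add: dom_def distrib_left ac_simps)
qed

lemma dom_suminf:
  assumes [measurable]: "\<And>n. f n \<in> borel_measurable borel"
  shows "dom (\<lambda>Q. \<Sum>n. f n Q) P = (\<Sum>n. dom (f n) P)"
proof -
  have "dom (\<lambda>Q. \<Sum>n. f n Q) P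
    = (\<integral>\<^sup>+k. (\<Sum>n. ennreal (g k) * f n (P - J k)) \<partial>lborel) + (\<Sum>n. ennreal lam * f n P)"
    by (simp add: dom_def)
  also have "(\<integral>\<^sup>+k. (\<Sum>n. ennreal (g k) * f n (P - J k)) \<partial>lborel)
     = (\<Sum>n. \<integral>\<^sup>+k. ennreal (g k) * f n (P - J k) \<partial>lborel)"
    by (rule nn_integral_suminf) measurable
  also have "\<dots> + (\<Sum>n. ennreal lam * f n P) = (\<Sum>n. dom (f n) P)"
    unfolding dom_def by (rule suminf_add) auto
  finally show ?thesis .
qed

lemma dom_power_measurable [measurable]:
  assumes [measurable]: "\<sigma> \<in> borel_measurable borel"
  shows "(dom ^^ n) \<sigma> \<in> borel_measurable borel"
  by (induction n) (auto intro: dom_measurable)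

lemma W_measurable [measurable]:
  assumes [measurable]: "\<sigma> \<in> borel_measurable borel"
  shows "W \<sigma> z \<in> borel_measurable borel"
  unfolding W_def[abs_def] by measurable

lemma dom_W:
  assumes [measurable]: "\<sigma> \<in> borel_measurable borel"
  shows "dom (W \<sigma> z) P = (\<Sum>n. ennreal (z ^ n / fact n) * (dom ^^ Suc n) \<sigma> P)"
  unfolding W_def[abs_def] by (subst dom_suminf) (auto simp: dom_cmult)

lemma norm_gen_le: "ennreal (norm (gen s f P)) \<le> dom (\<lambda>Q. ennreal (norm (f Q))) P"
proof -
  have "ennreal (norm (gen s f P)) \<le> ennreal (norm (LINT k|lborel. H s P k * f (P - J k)) + lam * norm (f P))"
    unfolding gen_def using lam_nonneg
    by (intro ennreal_leI order_trans[OF norm_triangle_ineq4]) auto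
  also have "\<dots> = ennreal (norm (LINT k|lborel. H s P k * f (P - J k))) + ennreal lam * ennreal (norm (f P))"
    using lam_nonneg by (simp add: ennreal_mult)
  also have "\<dots> \<le> dom (\<lambda>Q. ennreal (norm (f Q))) P"
    unfolding dom_def
  proof (intro add_right_mono order_trans[OF norm_lint_le] nn_integral_mono)
    fix k show "ennreal (norm (H s P k * f (P - J k))) \<le> ennreal (g k) * ennreal (norm (f (P - J k)))"
      using g_nonneg by (auto simp: norm_mult ennreal_mult[symmetric] intro!: ennreal_leI mult_right_mono H_le)
  qed
  finally show ?thesis .
qed

lemma gen_measurable:
  assumes u [measurable]: "(\<lambda>(s, P). u s P) \<in> borel_measurable (borel \<Otimes>\<^sub>M borel)"
    and [measurable]: "a \<in> borel_measurable M" "b \<in> borel_measurable M"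
  shows "(\<lambda>x. gen (a x) (u (a x)) (b x)) \<in> borel_measurable M"
proof -
  have [measurable]: "(\<lambda>x. u (c x) (d x)) \<in> borel_measurable N"
    if [measurable]: "c \<in> borel_measurable N" "d \<in> borel_measurable N" for c d and N :: "'x measure"
    using measurable_compose[OF _ u, of "\<lambda>x. (c x, d x)" N] by simp
  have 1: "(\<lambda>x. u (a (fst x)) (b (fst x) - J (snd x))) \<in> borel_measurable (M \<Otimes>\<^sub>M lborel)"
    using measurable_compose[OF _ u, of "\<lambda>x. (a (fst x), b (fst x) - J (snd x))" "M \<Otimes>\<^sub>M lborel"] by simp
  have 2: "(\<lambda>x. u (a x) (b x)) \<in> borel_measurable M"
    using measurable_compose[OF _ u, of "\<lambda>x. (a x, b x)" M] by simp
  have "(\<lambda>x. LINT k|lborel. H (a x) (b x) k * u (a x) (b x - J k)) \<in> borel_measurable M"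
    by (rule lborel.borel_measurable_lebesgue_integral) (use 1 in \<open>simp add: split_beta'\<close>)
  with 2 show ?thesis unfolding gen_def by measurable
qed

lemma uncurry_measurable:
  assumes u: "(\<lambda>(s, P). u s P) \<in> borel_measurable (borel \<Otimes>\<^sub>M borel)"
    and [measurable]: "c \<in> borel_measurable N" "d \<in> borel_measurable N"
  shows "(\<lambda>x. u (c x) (d x)) \<in> borel_measurable N"
  using measurable_compose[OF _ u, of "\<lambda>x. (c x, d x)" N] by simp

lemma section_measurable:
  assumes u: "(\<lambda>(s, P). u s P) \<in> borel_measurable (borel \<Otimes>\<^sub>M borel)"
  shows "u s \<in> borel_measurable borel"
  using uncurry_measurable[OF u, of "\<lambda>_. s" borel "\<lambda>x. x"] by simp

text \<open>Duhamel integral with phase \<open>th\<close>. It serves both for a genuine source and,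
  applied to \<open>gen\<close> of the previous iterate, for the Picard step.\<close>

definition src :: "(real \<Rightarrow> 'b \<Rightarrow> complex) \<Rightarrow> real \<Rightarrow> 'b \<Rightarrow> complex" where
  "src Q z P = (LINT s:{0..z}|lborel. cis ((z - s) * th P) * Q s P)"

lemma src_measurable:
  assumes Q: "(\<lambda>(s, P). Q s P) \<in> borel_measurable (borel \<Otimes>\<^sub>M borel)"
  shows "(\<lambda>(s, P). src Q s P) \<in> borel_measurable (borel \<Otimes>\<^sub>M borel)"
proof -
  have [measurable]: "(\<lambda>x. Q (snd x) (snd (fst x))) \<in> borel_measurable ((borel \<Otimes>\<^sub>M borel) \<Otimes>\<^sub>M lborel)"
    by (rule uncurry_measurable[OF Q]) measurable
  have "(\<lambda>x. LINT s|lborel. indicator {0..fst x} s *\<^sub>R (cis ((fst x - s) * th (snd x)) * Q s (snd x)))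
      \<in> borel_measurable (borel \<Otimes>\<^sub>M borel)"
  proof (rule lborel.borel_measurable_lebesgue_integral)
    \<comment> \<open>The interval of integration depends on the point; written as a condition on
      the pair, its indicator is jointly measurable.\<close>
    have "(\<lambda>x. (if 0 \<le> snd x \<and> snd x \<le> fst (fst x) then 1 else (0::real)) *\<^sub>R (cis ((fst (fst x) - snd x) * th (snd (fst x)))
        * Q (snd x) (snd (fst x)))) \<in> borel_measurable ((borel \<Otimes>\<^sub>M borel) \<Otimes>\<^sub>M lborel)"
      by measurable
    then show "(\<lambda>(x, s). indicator {0..fst x} s *\<^sub>R (cis ((fst x - s) * th (snd x)) * Q s (snd x)))
      \<in> borel_measurable ((borel \<Otimes>\<^sub>M borel) \<Otimes>\<^sub>M lborel)"
      unfolding indicator_def of_bool_def atLeastAtMost_iff split_beta' .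
  qed
  then show ?thesis by (simp add: split_beta' set_lebesgue_integral_def src_def)
qed

primrec picard :: "(real \<Rightarrow> 'b \<Rightarrow> complex) \<Rightarrow> nat \<Rightarrow> real \<Rightarrow> 'b \<Rightarrow> complex" where
  "picard S 0 = S"
| "picard S (Suc n) = src (\<lambda>s. gen s (picard S n s))"

definition sol :: "(real \<Rightarrow> 'b \<Rightarrow> complex) \<Rightarrow> real \<Rightarrow> 'b \<Rightarrow> complex" where
  "sol S z P = (\<Sum>n. picard S n z P)"

lemma picard_measurable:
  assumes S: "(\<lambda>(s, P). S s P) \<in> borel_measurable (borel \<Otimes>\<^sub>M borel)"
  shows "(\<lambda>(s, P). picard S n s P) \<in> borel_measurable (borel \<Otimes>\<^sub>M borel)"
proof (induction n)
  case (Suc n)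
  have "(\<lambda>(s, P). gen s (picard S n s) P) \<in> borel_measurable (borel \<Otimes>\<^sub>M borel)"
    unfolding split_beta' by (rule gen_measurable[OF Suc]) measurable
  then show ?case by (simp add: src_measurable)
qed (use S in simp)

lemma sol_measurable:
  assumes S: "(\<lambda>(s, P). S s P) \<in> borel_measurable (borel \<Otimes>\<^sub>M borel)"
  shows "(\<lambda>(s, P). sol S s P) \<in> borel_measurable (borel \<Otimes>\<^sub>M borel)"
  using picard_measurable[OF S] unfolding sol_def split_beta' by measurable

lemma norm_picard_le:
  assumes [measurable]: "\<sigma> \<in> borel_measurable borel"
    and S: "\<And>z P. 0 \<le> z \<Longrightarrow> ennreal (norm (S z P)) \<le> ennreal (1 + z) * \<sigma> P" and z: "0 \<le> z"
  shows "ennreal (norm (picard S n z P)) \<le> ennreal ((1 + z) * z ^ n / fact n) * (dom ^^ n) \<sigma> P"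
  using z
proof (induction n arbitrary: z P)
  case (Suc n)
  have "ennreal (norm (picard S (Suc n) z P))
     \<le> (\<integral>\<^sup>+s\<in>{0..z}. ennreal (norm (cis ((z - s) * th P) * gen s (picard S n s) P)) \<partial>lborel)"
    unfolding picard.simps src_def by (rule norm_set_lint_le)
  also have "\<dots> \<le> (\<integral>\<^sup>+s. ennreal ((1 + s) * s ^ n / fact n) * indicator {0..z} s * (dom ^^ Suc n) \<sigma> P \<partial>lborel)"
  proof (rule nn_integral_mono)
    fix s :: real
    have "ennreal (norm (gen s (picard S n s) P)) \<le> ennreal ((1 + s) * s ^ n / fact n) * (dom ^^ Suc n) \<sigma> P" if "0 \<le> s"
    proof -
      have "ennreal (norm (gen s (picard S n s) P)) \<le> dom (\<lambda>Q. ennreal (norm (picard S n s Q))) P"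
        by (rule norm_gen_le)
      also have "\<dots> \<le> dom (\<lambda>Q. ennreal ((1 + s) * s ^ n / fact n) * (dom ^^ n) \<sigma> Q) P"
        by (intro dom_mono Suc.IH that)
      finally show ?thesis by (simp add: dom_cmult)
    qed
    then show "ennreal (norm (cis ((z - s) * th P) * gen s (picard S n s) P)) * indicator {0..z} s
       \<le> ennreal ((1 + s) * s ^ n / fact n) * indicator {0..z} s * (dom ^^ Suc n) \<sigma> P"
      by (auto simp: norm_mult split: split_indicator)
  qed
  also have "\<dots> = (\<integral>\<^sup>+s\<in>{0..z}. ennreal ((1 + s) * s ^ n / fact n) \<partial>lborel) * (dom ^^ Suc n) \<sigma> P"
    by (rule nn_integral_multc) measurable
  also have "\<dots> \<le> ennreal ((1 + z) * z ^ Suc n / fact (Suc n)) * (dom ^^ Suc n) \<sigma> P"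
    by (intro mult_right_mono nn_integral_power_fact_le Suc.prems) simp
  finally show ?case .
qed (use S in simp)

text \<open>Freezing the distance at the endpoint \<open>z\<close> gives a majorant independent of
  \<open>s\<close>; this is what makes the exceptional null set independent of the distance.\<close>

lemma norm_picard_le':
  assumes "\<sigma> \<in> borel_measurable borel"
    and S: "\<And>z P. 0 \<le> z \<Longrightarrow> ennreal (norm (S z P)) \<le> ennreal (1 + z) * \<sigma> P" and z: "0 \<le> s" "s \<le> z"
  shows "ennreal (norm (picard S n s P)) \<le> ennreal (1 + z) * (ennreal (z ^ n / fact n) * (dom ^^ n) \<sigma> P)"
proof -
  have "ennreal (norm (picard S n s P)) \<le> ennreal ((1 + s) * s ^ n / fact n) * (dom ^^ n) \<sigma> P"
    by (rule norm_picard_le) (use assms in auto)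
  also have "\<dots> \<le> ennreal ((1 + z) * (z ^ n / fact n)) * (dom ^^ n) \<sigma> P"
    using z by (intro mult_right_mono ennreal_leI) (auto intro!: divide_right_mono mult_mono power_mono)
  also have "\<dots> = ennreal (1 + z) * (ennreal (z ^ n / fact n) * (dom ^^ n) \<sigma> P)"
    using z by (subst ennreal_mult) (auto simp: ac_simps)
  finally show ?thesis .
qed

lemma picard_summable:
  assumes "\<sigma> \<in> borel_measurable borel"
    and S: "\<And>z P. 0 \<le> z \<Longrightarrow> ennreal (norm (S z P)) \<le> ennreal (1 + z) * \<sigma> P" and z: "0 \<le> s" "s \<le> z"
    and fin: "W \<sigma> z P < \<infinity>"
  shows "summable (\<lambda>n. norm (picard S n s P))"
    and "(\<Sum>n. ennreal (norm (picard S n s P))) \<le> ennreal (1 + z) * W \<sigma> z P"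
proof -
  have "(\<Sum>n. ennreal (norm (picard S n s P))) \<le> (\<Sum>n. ennreal (1 + z) * (ennreal (z ^ n / fact n) * (dom ^^ n) \<sigma> P))"
    by (intro suminf_le norm_picard_le' assms) auto
  then show *: "(\<Sum>n. ennreal (norm (picard S n s P))) \<le> ennreal (1 + z) * W \<sigma> z P"
    by (simp add: W_def)
  show "summable (\<lambda>n. norm (picard S n s P))"
    by (rule summable_suminf_not_top) (use * fin in \<open>auto simp: ennreal_mult_eq_top_iff top_unique\<close>)
qed

text \<open>Holds at every point: where the majorant is infinite the series may diverge, but then
  the right side is infinite too.\<close>

lemma norm_sol_le:
  assumes "\<sigma> \<in> borel_measurable borel"
    and S: "\<And>z P. 0 \<le> z \<Longrightarrow> ennreal (norm (S z P)) \<le> ennreal (1 + z) * \<sigma> P" and z: "0 \<le> s" "s \<le> z"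
  shows "ennreal (norm (sol S s P)) \<le> ennreal (1 + z) * W \<sigma> z P"
proof (cases "W \<sigma> z P = \<infinity>")
  case True
  then show ?thesis using z by (simp add: ennreal_mult_eq_top_iff ennreal_mult_top)
next
  case False
  then have "W \<sigma> z P < \<infinity>" by (simp add: less_top)
  note s = picard_summable[OF assms(1) S z this]
  have "ennreal (norm (sol S s P)) \<le> ennreal (\<Sum>n. norm (picard S n s P))"
    unfolding sol_def by (intro ennreal_leI summable_norm s(1))
  also have "\<dots> = (\<Sum>n. ennreal (norm (picard S n s P)))"
    by (intro suminf_ennreal2[symmetric] s(1)) simp
  also have "\<dots> \<le> ennreal (1 + z) * W \<sigma> z P" by (rule s(2))
  finally show ?thesis .
qed

end

section \<open>Bounded integrands on intervals and a Gronwall inequality in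
  \<open>ennreal\<close>\<close>

lemma nn_integral_const_Icc_less_top:
  assumes "B < (\<infinity>::ennreal)"
  shows "(\<integral>\<^sup>+s\<in>{0..z::real}. B \<partial>lborel) < \<infinity>"
  using assms by (cases "0 \<le> z") (simp_all add: nn_integral_cmult_indicator ennreal_mult_less_top emeasure_lborel_Icc_eq)

lemma set_integrable_bounded_Icc:
  fixes f :: "real \<Rightarrow> 'a::{banach, second_countable_topology}"
  assumes [measurable]: "f \<in> borel_measurable borel"
    and le: "\<And>s. 0 \<le> s \<Longrightarrow> s \<le> z \<Longrightarrow> ennreal (norm (f s)) \<le> B" and B: "B < \<infinity>"
  shows "set_integrable lborel {0..z} f"
  unfolding set_integrable_def
proof (rule integrableI_bounded)
  have "(\<integral>\<^sup>+s. ennreal (norm (indicator {0..z} s *\<^sub>R f s)) \<partial>lborel) \<le> (\<integral>\<^sup>+s. B * indicator {0..z} s \<partial>lborel)"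
    by (intro nn_integral_mono) (auto split: split_indicator intro: le)
  also have "\<dots> < \<infinity>" by (rule nn_integral_const_Icc_less_top[OF B])
  finally show "(\<integral>\<^sup>+s. ennreal (norm (indicator {0..z} s *\<^sub>R f s)) \<partial>lborel) < \<infinity>" .
qed simp

text \<open>
  With the weight \<open>exp (- 2 L z)\<close> the integral term costs at most half of the supremum.  The function
  \<open>d\<close> need not be measurable.
\<close>

lemma gronwall_ennreal:
  fixes d :: "real \<Rightarrow> ennreal"
  assumes d: "\<And>z. 0 \<le> z \<Longrightarrow> z \<le> Z \<Longrightarrow> d z \<le> e + ennreal L * (\<integral>\<^sup>+s\<in>{0..z}. d s \<partial>lborel)"
    and bd: "\<And>z. 0 \<le> z \<Longrightarrow> z \<le> Z \<Longrightarrow> d z \<le> B" and B: "B < \<infinity>" and L: "0 < L" and z: "0 \<le> z" "z \<le> Z"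
  shows "d z \<le> 2 * e * ennreal (exp (2 * L * Z))"
proof -
  define D where "D = (SUP z\<in>{0..Z}. ennreal (exp (- (2 * L * z))) * d z)"
  have D_le: "D \<le> B" unfolding D_def
  proof (rule SUP_least)
    fix z assume z: "z \<in> {0..Z}"
    have "ennreal (exp (- (2 * L * z))) * d z \<le> 1 * B"
      using z L by (intro mult_mono bd) auto
    then show "ennreal (exp (- (2 * L * z))) * d z \<le> B" by simp
  qed
  have d_le: "d s \<le> ennreal (exp (2 * L * s)) * D" if "0 \<le> s" "s \<le> Z" for s
  proof -
    have "d s = ennreal (exp (2 * L * s)) * (ennreal (exp (- (2 * L * s))) * d s)"
      by (simp add: mult.assoc[symmetric] ennreal_mult[symmetric] exp_add[symmetric])
    also have "\<dots> \<le> ennreal (exp (2 * L * s)) * D"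
      unfolding D_def using that by (intro mult_left_mono SUP_upper) auto
    finally show ?thesis .
  qed
  have "D \<le> e + ennreal (1 / 2) * D" unfolding D_def[of]
  proof (rule SUP_least)
    fix z assume z: "z \<in> {0..Z}"
    have "(\<integral>\<^sup>+s\<in>{0..z}. d s \<partial>lborel) \<le> (\<integral>\<^sup>+s. ennreal (exp (2 * L * s)) * indicator {0..z} s * D \<partial>lborel)"
      using z by (intro nn_integral_mono) (auto split: split_indicator intro: d_le)
    also have "\<dots> = (\<integral>\<^sup>+s. ennreal (exp (2 * L * s)) * indicator {0..z} s \<partial>lborel) * D"
      by (rule nn_integral_multc) measurable
    also have "(\<integral>\<^sup>+s. ennreal (exp (2 * L * s)) * indicator {0..z} s \<partial>lborel) = ennreal (exp (2 * L * z) / (2 * L) - exp (2 * L * 0) / (2 * L))"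
      using z L by (intro nn_integral_FTC_Icc[where F="\<lambda>s. exp (2 * L * s) / (2 * L)"]) (auto intro!: derivative_eq_intros)
    also have "\<dots> \<le> ennreal (exp (2 * L * z) / (2 * L))" using L by (intro ennreal_leI) auto
    finally have "(\<integral>\<^sup>+s\<in>{0..z}. d s \<partial>lborel) \<le> ennreal (exp (2 * L * z) / (2 * L)) * D"
      by (simp add: mult_right_mono)
    then have "d z \<le> e + ennreal L * (ennreal (exp (2 * L * z) / (2 * L)) * D)"
      using z by (intro order_trans[OF d] add_left_mono mult_left_mono) auto
    then have "ennreal (exp (- (2 * L * z))) * d z
       \<le> ennreal (exp (- (2 * L * z))) * e + ennreal (exp (- (2 * L * z))) * (ennreal L * (ennreal (exp (2 * L * z) / (2 * L)) * D))"
      by (metis distrib_left mult_left_mono zero_le)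
    also have "ennreal (exp (- (2 * L * z))) * (ennreal L * (ennreal (exp (2 * L * z) / (2 * L)) * D))
       = ennreal (exp (- (2 * L * z)) * (L * (exp (2 * L * z) / (2 * L)))) * D"
      using L by (simp add: mult.assoc[symmetric] ennreal_mult[symmetric])
    also have "exp (- (2 * L * z)) * (L * (exp (2 * L * z) / (2 * L))) = 1 / 2"
      using L by (simp add: exp_minus field_simps)
    also have "ennreal (exp (- (2 * L * z))) * e \<le> 1 * e"
      using z L by (intro mult_right_mono) auto
    finally show "ennreal (exp (- (2 * L * z))) * d z \<le> e + ennreal (1 / 2) * (SUP z\<in>{0..Z}. ennreal (exp (- (2 * L * z))) * d z)"
      by (simp add: D_def)
  qed
  \<comment> \<open>The a priori bound \<open>B\<close> makes \<open>D\<close> finite; only for this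
    reason can half of \<open>D\<close> be absorbed on the left.\<close>
  have D2: "D \<le> 2 * e"
  proof (cases "e = \<infinity>")
    case True then show ?thesis by simp
  next
    case False
    then obtain e' where e': "e = ennreal e'" "0 \<le> e'" by (cases e) auto
    obtain D' where D': "D = ennreal D'" "0 \<le> D'" using D_le B by (cases D) (auto simp: top_unique)
    have "ennreal D' \<le> ennreal e' + ennreal (1 / 2) * ennreal D'"
      using \<open>D \<le> e + ennreal (1 / 2) * D\<close> unfolding e'(1) D'(1) .
    also have "\<dots> = ennreal (e' + (1 / 2) * D')"
      using D'(2) e'(2) by (subst ennreal_mult[symmetric]) (auto simp del: ennreal_plus simp: ennreal_plus[symmetric])
    finally have "D' \<le> e' + D' / 2" using D'(2) e'(2) by (subst (asm) ennreal_le_iff) auto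
    then show ?thesis
      unfolding e'(1) D'(1) ennreal_numeral[symmetric] using e' by (subst ennreal_mult[symmetric]) (auto intro!: ennreal_leI)
  qed
  have "d z \<le> ennreal (exp (2 * L * z)) * D" by (rule d_le) fact+
  also have "\<dots> \<le> ennreal (exp (2 * L * Z)) * (2 * e)"
    using z L by (intro mult_mono D2 ennreal_leI) auto
  finally show ?thesis by (simp add: ac_simps)
qed

section \<open>The Picard sum as a solution, continuity in the distance, differences of
  solutions\<close>

context volterra
begin

lemma norm_gen_sol_le:
  assumes [measurable]: "\<sigma> \<in> borel_measurable borel"
    and S: "\<And>z P. 0 \<le> z \<Longrightarrow> ennreal (norm (S z P)) \<le> ennreal (1 + z) * \<sigma> P" and z: "0 \<le> s" "s \<le> z"
  shows "ennreal (norm (gen s (sol S s) P)) \<le> ennreal (1 + z) * dom (W \<sigma> z) P"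
proof -
  have "ennreal (norm (gen s (sol S s) P)) \<le> dom (\<lambda>Q. ennreal (norm (sol S s Q))) P" by (rule norm_gen_le)
  also have "\<dots> \<le> dom (\<lambda>Q. ennreal (1 + z) * W \<sigma> z Q) P"
    by (intro dom_mono norm_sol_le assms)
  finally show ?thesis by (simp add: dom_cmult)
qed

text \<open>The series is exchanged with the convolution and then with the distance integral, both
  times under the majorant \<open>dom (W \<sigma> z) P\<close>. The equation thus holds at every
  point where the two majorants are finite.\<close>

lemma sol_eq:
  assumes \<sigma> [measurable]: "\<sigma> \<in> borel_measurable borel"
    and S_meas: "(\<lambda>(s, P). S s P) \<in> borel_measurable (borel \<Otimes>\<^sub>M borel)"
    and S: "\<And>z P. 0 \<le> z \<Longrightarrow> ennreal (norm (S z P)) \<le> ennreal (1 + z) * \<sigma> P" and z: "0 \<le> z"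
    and fin: "W \<sigma> z P < \<infinity>" and fin': "dom (W \<sigma> z) P < \<infinity>"
  shows "sol S z P = S z P + (LINT s:{0..z}|lborel. cis ((z - s) * th P) * gen s (sol S s) P)"
proof -
  define a where "a n = ennreal (1 + z) * (ennreal (z ^ n / fact n) * (dom ^^ Suc n) \<sigma> P)" for n
  have "(\<Sum>n. a n) = ennreal (1 + z) * dom (W \<sigma> z) P" by (simp add: a_def dom_W)
  then have suma: "(\<Sum>n. a n) < \<infinity>" using fin' by (simp add: ennreal_mult_less_top)
  have picm: "picard S n s \<in> borel_measurable borel" for n s
    by (rule section_measurable[OF picard_measurable[OF S_meas]])
  note picm [measurable] and section_measurable[OF sol_measurable[OF S_meas], measurable]
  have gen_le: "ennreal (norm (gen s (picard S n s) P)) \<le> a n" if "0 \<le> s" "s \<le> z" for s n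
  proof -
    have "ennreal (norm (gen s (picard S n s) P)) \<le> dom (\<lambda>Q. ennreal (norm (picard S n s Q))) P"
      by (rule norm_gen_le)
    also have "\<dots> \<le> dom (\<lambda>Q. ennreal (1 + z) * (ennreal (z ^ n / fact n) * (dom ^^ n) \<sigma> Q)) P"
      by (intro dom_mono norm_picard_le' assms that)
    finally show ?thesis by (simp add: dom_cmult a_def)
  qed
  have gen_sums: "(\<lambda>n. gen s (picard S n s) P) sums gen s (sol S s) P" if s: "0 \<le> s" "s \<le> z" for s
    unfolding gen_def
  proof (intro sums_diff sums_scaleR_right)
    show "(\<lambda>n. picard S n s P) sums sol S s P"
      unfolding sol_def using picard_summable(1)[OF \<sigma> S s fin]
      by (intro summable_sums) (auto dest: summable_norm_cancel)
    let ?f = "\<lambda>n k. H s P k * picard S n s (P - J k)"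
    have "(\<integral>\<^sup>+k. ennreal (norm (?f n k)) \<partial>lborel) \<le> a n" for n
    proof -
      have "(\<integral>\<^sup>+k. ennreal (norm (?f n k)) \<partial>lborel)
        \<le> (\<integral>\<^sup>+k. ennreal (g k) * (ennreal (1 + z) * (ennreal (z ^ n / fact n) * (dom ^^ n) \<sigma> (P - J k))) \<partial>lborel)"
        using g_nonneg by (intro nn_integral_mono)
          (auto simp: norm_mult ennreal_mult intro!: mult_mono ennreal_leI H_le norm_picard_le' assms s)
      also have "\<dots> \<le> dom (\<lambda>Q. ennreal (1 + z) * (ennreal (z ^ n / fact n) * (dom ^^ n) \<sigma> Q)) P"
        by (simp add: dom_def)
      finally show ?thesis by (simp add: dom_cmult a_def)
    qed
    then have "(\<Sum>n. \<integral>\<^sup>+k. ennreal (norm (?f n k)) \<partial>lborel) \<le> (\<Sum>n. a n)" by (intro suminf_le) auto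
    also note suma
    finally have "(\<lambda>n. LINT k|lborel. ?f n k) sums (LINT k|lborel. (\<Sum>n. ?f n k))"
      by (intro sums_lint) auto
    moreover have "(LINT k|lborel. (\<Sum>n. ?f n k)) = (LINT k|lborel. H s P k * sol S s (P - J k))"
    proof (rule integral_cong_AE)
      have "(\<integral>\<^sup>+k. ennreal (g k) * W \<sigma> z (P - J k) \<partial>lborel) < \<infinity>"
        using fin' unfolding dom_def by simp
      then have "AE k in lborel. ennreal (g k) * W \<sigma> z (P - J k) \<noteq> \<infinity>"
        by (intro nn_integral_PInf_AE) auto
      then show "AE k in lborel. (\<Sum>n. ?f n k) = H s P k * sol S s (P - J k)"
      proof eventually_elim
        case (elim k)
        show ?case
        \<comment> \<open>Finiteness of \<open>g * W\<close> controls \<open>W\<close> only where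
          \<open>g\<close> is positive; where \<open>H\<close> is nonzero this is the case, and
          elsewhere both sides are 0.\<close>
        proof (cases "H s P k = 0")
          case False
          then have "0 < g k" using H_le[of s P k] by (metis less_le_trans zero_less_norm_iff)
          then have "W \<sigma> z (P - J k) < \<infinity>" using elim by (simp add: ennreal_mult_eq_top_iff less_top)
          from picard_summable(1)[OF \<sigma> S s this] show ?thesis
            unfolding sol_def by (intro suminf_mult) (auto dest: summable_norm_cancel)
        qed simp
      qed
    qed auto
    ultimately show "(\<lambda>n. LINT k|lborel. ?f n k) sums (LINT k|lborel. H s P k * sol S s (P - J k))" by simp
  qed
  let ?F = "\<lambda>n s. indicator {0..z} s *\<^sub>R (cis ((z - s) * th P) * gen s (picard S n s) P)"
  have [measurable]: "(\<lambda>s. gen s (picard S n s) P) \<in> borel_measurable borel" for n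
    by (rule gen_measurable[OF picard_measurable[OF S_meas]]) auto
  have "(\<integral>\<^sup>+s. ennreal (norm (?F n s)) \<partial>lborel) \<le> ennreal z * a n" for n
  proof -
    have "(\<integral>\<^sup>+s. ennreal (norm (?F n s)) \<partial>lborel) \<le> (\<integral>\<^sup>+s. a n * indicator {0..z} s \<partial>lborel)"
      by (intro nn_integral_mono) (auto simp: norm_mult split: split_indicator intro: gen_le)
    then show ?thesis using z by (simp add: nn_integral_cmult ac_simps)
  qed
  then have "(\<Sum>n. \<integral>\<^sup>+s. ennreal (norm (?F n s)) \<partial>lborel) \<le> (\<Sum>n. ennreal z * a n)" by (intro suminf_le) auto
  also have "\<dots> < \<infinity>" using suma by (simp add: ennreal_mult_less_top)
  finally have "(\<lambda>n. LINT s|lborel. ?F n s) sums (LINT s|lborel. (\<Sum>n. ?F n s))"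
    by (intro sums_lint) auto
  moreover have "(\<Sum>n. ?F n s) = indicator {0..z} s *\<^sub>R (cis ((z - s) * th P) * gen s (sol S s) P)" for s
    using sums_unique[OF sums_mult[OF gen_sums[of s], of "cis ((z - s) * th P)"]] by (auto split: split_indicator)
  ultimately have 1: "(\<lambda>n. picard S (Suc n) z P) sums (LINT s:{0..z}|lborel. cis ((z - s) * th P) * gen s (sol S s) P)"
    by (simp add: src_def set_lebesgue_integral_def)
  have "summable (\<lambda>n. picard S n z P)"
    using picard_summable(1)[OF \<sigma> S z order_refl fin] by (rule summable_norm_cancel)
  from suminf_split_head[OF this] sums_unique[OF 1] show ?thesis by (simp add: sol_def)
qed

text \<open>Pulling \<open>cis (z * th P)\<close> out of the Duhamel integral leaves an indefinite
  integral of a fixed integrand, which is continuous in its upper limit.\<close>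

lemma sol_continuous:
  assumes \<sigma> [measurable]: "\<sigma> \<in> borel_measurable borel"
    and S_meas: "(\<lambda>(s, P). S s P) \<in> borel_measurable (borel \<Otimes>\<^sub>M borel)"
    and S: "\<And>z P. 0 \<le> z \<Longrightarrow> ennreal (norm (S z P)) \<le> ennreal (1 + z) * \<sigma> P"
    and fin: "\<And>z. 0 \<le> z \<Longrightarrow> W \<sigma> z P < \<infinity> \<and> dom (W \<sigma> z) P < \<infinity>"
    and cont: "continuous_on {0..Z} (\<lambda>z. S z P)"
  shows "continuous_on {0..Z} (\<lambda>z. sol S z P)"
proof -
  let ?G = "\<lambda>s. cis (- (s * th P)) * gen s (sol S s) P"
  have [measurable]: "(\<lambda>s. gen s (sol S s) P) \<in> borel_measurable borel"
    by (rule gen_measurable[OF sol_measurable[OF S_meas]]) auto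
  have int: "set_integrable lborel {0..z} ?G" if "0 \<le> z" for z
    using fin[OF that]
    by (intro set_integrable_bounded_Icc[where B="ennreal (1 + z) * dom (W \<sigma> z) P"])
      (auto simp: norm_mult ennreal_mult_less_top simp del: ennreal_plus intro!: norm_gen_sol_le[OF \<sigma> S])
  have "sol S z P = S z P + cis (z * th P) * integral {0..z} ?G" if z: "0 \<le> z" for z
  proof -
    have "sol S z P = S z P + (LINT s:{0..z}|lborel. cis ((z - s) * th P) * gen s (sol S s) P)"
      using fin[OF z] by (intro sol_eq[OF \<sigma> S_meas S z]) auto
    also have "(LINT s:{0..z}|lborel. cis ((z - s) * th P) * gen s (sol S s) P) = (LINT s:{0..z}|lborel. cis (z * th P) * ?G s)"
      by (simp add: mult.assoc[symmetric] cis_mult left_diff_distrib)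
    also have "\<dots> = cis (z * th P) * (LINT s:{0..z}|lborel. ?G s)" by (rule set_integral_mult_right)
    finally show ?thesis using set_borel_integral_eq_integral(2)[OF int[OF z]] by simp
  qed
  note eq = this
  have "continuous_on {0..Z} (\<lambda>z. S z P + cis (z * th P) * integral {0..z} ?G)"
  proof (cases "0 \<le> Z")
    case True
    show ?thesis
      by (intro continuous_intros cont indefinite_integral_continuous_1 set_borel_integral_eq_integral(1)[OF int[OF True]])
  qed simp
  then show ?thesis by (rule continuous_on_eq) (simp add: eq)
qed

lemma src_set_integrable:
  assumes Q: "(\<lambda>(s, P). Q s P) \<in> borel_measurable (borel \<Otimes>\<^sub>M borel)"
    and le: "\<And>s. 0 \<le> s \<Longrightarrow> norm (Q s P) \<le> q"
  shows "set_integrable lborel {0..z} (\<lambda>s. cis ((y - s) * th P) * Q s P)"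
proof (rule set_integrable_bounded_Icc[where B="ennreal q"])
  have [measurable]: "(\<lambda>s. Q s P) \<in> borel_measurable borel" by (rule uncurry_measurable[OF Q]) auto
  show "(\<lambda>s. cis ((y - s) * th P) * Q s P) \<in> borel_measurable borel" by measurable
qed (use le in \<open>auto simp: norm_mult intro: ennreal_leI\<close>)

text \<open>The natural bound \<open>z * q\<close> is weakened to \<open>(1 + z) * q\<close>, the
  common form of sources; that form also covers the free evolution of an initial datum.\<close>

lemma norm_src_le:
  assumes le: "\<And>s. 0 \<le> s \<Longrightarrow> ennreal (norm (Q s P)) \<le> q" and z: "0 \<le> z"
  shows "ennreal (norm (src Q z P)) \<le> ennreal (1 + z) * q"
proof -
  have "ennreal (norm (src Q z P)) \<le> (\<integral>\<^sup>+s\<in>{0..z}. ennreal (norm (cis ((z - s) * th P) * Q s P)) \<partial>lborel)"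
    unfolding src_def by (rule norm_set_lint_le)
  also have "\<dots> \<le> (\<integral>\<^sup>+s. q * indicator {0..z} s \<partial>lborel)"
    by (intro nn_integral_mono) (auto simp: norm_mult le split: split_indicator)
  also have "\<dots> = ennreal z * q" using z by (simp add: nn_integral_cmult_indicator mult.commute)
  also have "\<dots> \<le> ennreal (1 + z) * q" by (intro mult_right_mono ennreal_leI) auto
  finally show ?thesis .
qed

lemma src_continuous:
  assumes Q: "(\<lambda>(s, P). Q s P) \<in> borel_measurable (borel \<Otimes>\<^sub>M borel)"
    and le: "\<And>s. 0 \<le> s \<Longrightarrow> norm (Q s P) \<le> q"
  shows "continuous_on {0..Z} (\<lambda>z. src Q z P)"
proof (cases "0 \<le> Z")
  case True
  let ?G = "\<lambda>s. cis ((0 - s) * th P) * Q s P"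
  have int: "set_integrable lborel {0..z} ?G" for z by (rule src_set_integrable[OF Q le])
  have "src Q z P = cis (z * th P) * integral {0..z} ?G" for z
  proof -
    have "src Q z P = (LINT s:{0..z}|lborel. cis (z * th P) * ?G s)"
      unfolding src_def by (simp add: mult.assoc[symmetric] cis_mult left_diff_distrib)
    also have "\<dots> = cis (z * th P) * (LINT s:{0..z}|lborel. ?G s)" by (rule set_integral_mult_right)
    finally show ?thesis using set_borel_integral_eq_integral(2)[OF int[of z]] by simp
  qed
  moreover have "continuous_on {0..Z} (\<lambda>z. cis (z * th P) * integral {0..z} ?G)"
    by (intro continuous_intros indefinite_integral_continuous_1 set_borel_integral_eq_integral(1)[OF int])
  ultimately show ?thesis by simp
qed simp

lemma dom_measurable2:
  assumes u: "(\<lambda>(s, P). u s P) \<in> borel_measurable (borel \<Otimes>\<^sub>M borel)"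
    and [measurable]: "a \<in> borel_measurable M" "b \<in> borel_measurable M"
  shows "(\<lambda>x. dom (u (a x)) (b x)) \<in> borel_measurable M"
proof -
  have 1: "(\<lambda>x. u (a (fst x)) (b (fst x) - J (snd x))) \<in> borel_measurable (M \<Otimes>\<^sub>M lborel)"
    by (rule uncurry_measurable[OF u]) measurable
  have 2: "(\<lambda>x. u (a x) (b x)) \<in> borel_measurable M"
    by (rule uncurry_measurable[OF u]) measurable
  have "(\<lambda>x. \<integral>\<^sup>+k. ennreal (g k) * u (a x) (b x - J k) \<partial>lborel) \<in> borel_measurable M"
    by (rule lborel.borel_measurable_nn_integral) (use 1 in \<open>simp add: split_beta'\<close>)
  with 2 show ?thesis unfolding dom_def by measurable
qed

lemma gen_diff:
  assumes [measurable]: "f \<in> borel_measurable borel" "h \<in> borel_measurable borel"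
    and "dom (\<lambda>Q. ennreal (norm (f Q))) P < \<infinity>" "dom (\<lambda>Q. ennreal (norm (h Q))) P < \<infinity>"
  shows "gen s (\<lambda>Q. f Q - h Q) P = gen s f P - gen s h P"
proof -
  have int: "integrable lborel (\<lambda>k. H s P k * f (P - J k))"
    if [measurable]: "f \<in> borel_measurable borel" and "dom (\<lambda>Q. ennreal (norm (f Q))) P < \<infinity>" for f :: "'b \<Rightarrow> complex"
  proof (rule integrableI_bounded)
    have "(\<integral>\<^sup>+k. ennreal (norm (H s P k * f (P - J k))) \<partial>lborel)
        \<le> (\<integral>\<^sup>+k. ennreal (g k) * ennreal (norm (f (P - J k))) \<partial>lborel)"
      using g_nonneg by (intro nn_integral_mono) (auto simp: norm_mult ennreal_mult intro!: mult_right_mono ennreal_leI H_le)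
    also have "\<dots> \<le> dom (\<lambda>Q. ennreal (norm (f Q))) P" unfolding dom_def by (rule add_increasing2) auto
    finally show "(\<integral>\<^sup>+k. ennreal (norm (H s P k * f (P - J k))) \<partial>lborel) < \<infinity>" using that(2) by (rule le_less_trans)
  qed measurable
  show ?thesis
    unfolding gen_def right_diff_distrib scaleR_diff_right
      Bochner_Integration.integral_diff[OF int[OF assms(1,3)] int[OF assms(2,4)]] by simp
qed

lemma gen_set_integrable:
  assumes u: "(\<lambda>(s, P). u s P) \<in> borel_measurable (borel \<Otimes>\<^sub>M borel)"
    and fin: "(\<integral>\<^sup>+s\<in>{0..z}. dom (\<lambda>Q. ennreal (norm (u s Q))) P \<partial>lborel) < \<infinity>"
  shows "set_integrable lborel {0..z} (\<lambda>s. cis ((z - s) * th P) * gen s (u s) P)"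
  unfolding set_integrable_def
proof (rule integrableI_bounded)
  have [measurable]: "(\<lambda>s. gen s (u s) P) \<in> borel_measurable borel"
    by (rule gen_measurable[OF u]) auto
  show "(\<lambda>s. indicator {0..z} s *\<^sub>R (cis ((z - s) * th P) * gen s (u s) P)) \<in> borel_measurable lborel"
    by measurable
  have "(\<integral>\<^sup>+s. ennreal (norm (indicator {0..z} s *\<^sub>R (cis ((z - s) * th P) * gen s (u s) P))) \<partial>lborel)
     \<le> (\<integral>\<^sup>+s\<in>{0..z}. dom (\<lambda>Q. ennreal (norm (u s Q))) P \<partial>lborel)"
    by (intro nn_integral_mono) (auto simp: norm_mult split: split_indicator intro: norm_gen_le)
  then show "(\<integral>\<^sup>+s. ennreal (norm (indicator {0..z} s *\<^sub>R (cis ((z - s) * th P) * gen s (u s) P))) \<partial>lborel) < \<infinity>"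
    using fin by (rule le_less_trans)
qed

lemma AE_dom_path_finite:
  assumes u: "(\<lambda>(s, P). u s P) \<in> borel_measurable (borel \<Otimes>\<^sub>M borel)"
    and fin: "(\<integral>\<^sup>+s\<in>{0..z::real}. dom (u s) P \<partial>lborel) < \<infinity>"
  shows "AE s in lborel. s \<in> {0..z} \<longrightarrow> dom (u s) P < \<infinity>"
proof -
  have [measurable]: "(\<lambda>s. dom (u s) P) \<in> borel_measurable borel"
    using dom_measurable2[OF u, of "\<lambda>s. s" borel "\<lambda>_. P"] by simp
  have "AE s in lborel. dom (u s) P * indicator {0..z} s \<noteq> \<infinity>"
    using fin by (intro nn_integral_PInf_AE) (simp_all add: less_top)
  then show ?thesis
  proof eventually_elim
    case (elim s)
    show ?case
    proof
      assume "s \<in> {0..z}"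
      then show "dom (u s) P < \<infinity>" using elim by (simp add: less_top)
    qed
  qed
qed

text \<open>Feeds differences of solutions into Gronwall's inequality. \<open>gen\<close> is linear
  only where both convolutions converge, that is for almost every \<open>s\<close>, and the integral
  over \<open>s\<close> does not see the rest.\<close>

lemma gen_integral_diff_le:
  assumes u: "(\<lambda>(s, P). u s P) \<in> borel_measurable (borel \<Otimes>\<^sub>M borel)"
    and v: "(\<lambda>(s, P). v s P) \<in> borel_measurable (borel \<Otimes>\<^sub>M borel)"
    and fu: "(\<integral>\<^sup>+s\<in>{0..z}. dom (\<lambda>Q. ennreal (norm (u s Q))) P \<partial>lborel) < \<infinity>"
    and fv: "(\<integral>\<^sup>+s\<in>{0..z}. dom (\<lambda>Q. ennreal (norm (v s Q))) P \<partial>lborel) < \<infinity>"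
  shows "ennreal (norm ((LINT s:{0..z}|lborel. cis ((z - s) * th P) * gen s (u s) P)
            - (LINT s:{0..z}|lborel. cis ((z - s) * th P) * gen s (v s) P)))
     \<le> (\<integral>\<^sup>+s\<in>{0..z}. dom (\<lambda>Q. ennreal (norm (u s Q - v s Q))) P \<partial>lborel)"
proof -
  have ae: "AE s in lborel. s \<in> {0..z} \<longrightarrow> dom (\<lambda>Q. ennreal (norm (u s Q))) P < \<infinity>"
    if "(\<lambda>(s, P). u s P) \<in> borel_measurable (borel \<Otimes>\<^sub>M borel)"
      and "(\<integral>\<^sup>+s\<in>{0..z}. dom (\<lambda>Q. ennreal (norm (u s Q))) P \<partial>lborel) < \<infinity>" for u :: "real \<Rightarrow> 'b \<Rightarrow> complex"
    by (rule AE_dom_path_finite) (use that in \<open>simp_all add: split_beta'\<close>)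
  have eq: "(LINT s:{0..z}|lborel. cis ((z - s) * th P) * gen s (u s) P)
            - (LINT s:{0..z}|lborel. cis ((z - s) * th P) * gen s (v s) P)
     = (LINT s:{0..z}|lborel. cis ((z - s) * th P) * gen s (u s) P - cis ((z - s) * th P) * gen s (v s) P)"
    by (rule set_integral_diff(2)[symmetric, OF gen_set_integrable[OF u fu] gen_set_integrable[OF v fv]])
  have "ennreal (norm ((LINT s:{0..z}|lborel. cis ((z - s) * th P) * gen s (u s) P)
            - (LINT s:{0..z}|lborel. cis ((z - s) * th P) * gen s (v s) P)))
     \<le> (\<integral>\<^sup>+s\<in>{0..z}. ennreal (norm (cis ((z - s) * th P) * gen s (u s) P - cis ((z - s) * th P) * gen s (v s) P)) \<partial>lborel)"
    unfolding eq by (rule norm_set_lint_le)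
  also have "\<dots> \<le> (\<integral>\<^sup>+s\<in>{0..z}. dom (\<lambda>Q. ennreal (norm (u s Q - v s Q))) P \<partial>lborel)"
  proof (rule nn_integral_mono_AE)
    show "AE s in lborel. ennreal (norm (cis ((z - s) * th P) * gen s (u s) P - cis ((z - s) * th P) * gen s (v s) P)) * indicator {0..z} s
       \<le> dom (\<lambda>Q. ennreal (norm (u s Q - v s Q))) P * indicator {0..z} s"
      using ae[OF u fu] ae[OF v fv]
    proof eventually_elim
      case (elim s)
      show ?case
      proof (cases "s \<in> {0..z}")
        case True
        have "gen s (\<lambda>Q. u s Q - v s Q) P = gen s (u s) P - gen s (v s) P"
          by (rule gen_diff[OF section_measurable[OF u] section_measurable[OF v]]) (use elim True in auto)
        then have "cis ((z - s) * th P) * gen s (u s) P - cis ((z - s) * th P) * gen s (v s) P = cis ((z - s) * th P) * gen s (\<lambda>Q. u s Q - v s Q) P"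
          by (simp add: right_diff_distrib)
        then show ?thesis using norm_gen_le[of s "\<lambda>Q. u s Q - v s Q" P]
          by (simp add: norm_mult mult_right_mono)
      qed simp
    qed
  qed
  finally show ?thesis .
qed

end

text \<open>
  Norms are taken along the slices \<open>e\<close>: the identity for joint integrability, and \<open>\<xi> \<mapsto> (\<xi>, \<zeta>)\<close> when \<open>\<zeta>\<close>
  is a frozen parameter.
\<close>

locale volterra_slice = volterra J H g lam th
  for J :: "'k::euclidean_space \<Rightarrow> 'b::euclidean_space" and H g lam th +
  fixes e :: "'c::euclidean_space \<Rightarrow> 'b"
  assumes e_measurable [measurable]: "e \<in> borel_measurable borel"
    and e_shift: "\<And>f k. f \<in> borel_measurable borel \<Longrightarrow>
       (\<integral>\<^sup>+c. f (e c - J k) \<partial>lborel) = (\<integral>\<^sup>+c. (f (e c) :: ennreal) \<partial>lborel)"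
begin

definition L :: real where "L = (LINT k|lborel. g k) + lam"

lemma L_nonneg: "0 \<le> L"
  unfolding L_def by (intro add_nonneg_nonneg Bochner_Integration.integral_nonneg lam_nonneg g_nonneg)

text \<open>Tonelli and translation invariance along the slice: a shift by \<open>J k\<close>
  preserves the integral, so the convolution contributes exactly the mass of
  \<open>g\<close>.\<close>

lemma nn_integral_dom:
  assumes [measurable]: "f \<in> borel_measurable borel"
  shows "(\<integral>\<^sup>+c. dom f (e c) \<partial>lborel) = ennreal L * (\<integral>\<^sup>+c. f (e c) \<partial>lborel)"
proof -
  have "(\<integral>\<^sup>+c. (\<integral>\<^sup>+k. ennreal (g k) * f (e c - J k) \<partial>lborel) \<partial>lborel)
     = (\<integral>\<^sup>+k. (\<integral>\<^sup>+c. ennreal (g k) * f (e c - J k) \<partial>lborel) \<partial>lborel)"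
    by (rule lborel_pair.Fubini'[symmetric]) measurable
  also have "\<dots> = (\<integral>\<^sup>+k. ennreal (g k) * (\<integral>\<^sup>+c. f (e c) \<partial>lborel) \<partial>lborel)"
    by (intro nn_integral_cong) (simp add: nn_integral_cmult e_shift)
  also have "\<dots> = (\<integral>\<^sup>+k. ennreal (g k) \<partial>lborel) * (\<integral>\<^sup>+c. f (e c) \<partial>lborel)"
    by (rule nn_integral_multc) measurable
  also have "(\<integral>\<^sup>+k. ennreal (g k) \<partial>lborel) = ennreal (LINT k|lborel. g k)"
    using g_nonneg by (intro nn_integral_eq_integral g_integrable) auto
  finally have 1: "(\<integral>\<^sup>+c. (\<integral>\<^sup>+k. ennreal (g k) * f (e c - J k) \<partial>lborel) \<partial>lborel)
     = ennreal (LINT k|lborel. g k) * (\<integral>\<^sup>+c. f (e c) \<partial>lborel)" .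
  have "(\<integral>\<^sup>+c. dom f (e c) \<partial>lborel)
     = (\<integral>\<^sup>+c. (\<integral>\<^sup>+k. ennreal (g k) * f (e c - J k) \<partial>lborel) \<partial>lborel) + (\<integral>\<^sup>+c. ennreal lam * f (e c) \<partial>lborel)"
    unfolding dom_def by (rule nn_integral_add) measurable
  also have "\<dots> = ennreal (LINT k|lborel. g k) * (\<integral>\<^sup>+c. f (e c) \<partial>lborel) + ennreal lam * (\<integral>\<^sup>+c. f (e c) \<partial>lborel)"
    unfolding 1 by (simp add: nn_integral_cmult)
  also have "\<dots> = ennreal L * (\<integral>\<^sup>+c. f (e c) \<partial>lborel)"
    unfolding L_def
    by (simp add: distrib_right[symmetric] ennreal_plus lam_nonneg Bochner_Integration.integral_nonneg g_nonneg)
  finally show ?thesis .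
qed

lemma nn_integral_dom_power:
  assumes [measurable]: "\<sigma> \<in> borel_measurable borel"
  shows "(\<integral>\<^sup>+c. (dom ^^ n) \<sigma> (e c) \<partial>lborel) = ennreal (L ^ n) * (\<integral>\<^sup>+c. \<sigma> (e c) \<partial>lborel)"
proof (induction n)
  case (Suc n)
  have "(\<integral>\<^sup>+c. (dom ^^ Suc n) \<sigma> (e c) \<partial>lborel) = ennreal L * (ennreal (L ^ n) * (\<integral>\<^sup>+c. \<sigma> (e c) \<partial>lborel))"
    using nn_integral_dom[of "(dom ^^ n) \<sigma>"] Suc by simp
  then show ?case using L_nonneg by (simp add: ennreal_mult mult.assoc)
qed simp

text \<open>The factors \<open>L ^ n * z ^ n / fact n\<close> sum to the exponential. An integrable
  \<open>\<sigma>\<close> therefore has a majorant of finite integral.\<close>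

lemma nn_integral_W:
  assumes [measurable]: "\<sigma> \<in> borel_measurable borel" and z: "0 \<le> z"
  shows "(\<integral>\<^sup>+c. W \<sigma> z (e c) \<partial>lborel) = ennreal (exp (L * z)) * (\<integral>\<^sup>+c. \<sigma> (e c) \<partial>lborel)"
proof -
  have "(\<integral>\<^sup>+c. W \<sigma> z (e c) \<partial>lborel) = (\<Sum>n. \<integral>\<^sup>+c. ennreal (z ^ n / fact n) * (dom ^^ n) \<sigma> (e c) \<partial>lborel)"
    unfolding W_def by (rule nn_integral_suminf) measurable
  also have "\<dots> = (\<Sum>n. ennreal ((L * z) ^ n / fact n) * (\<integral>\<^sup>+c. \<sigma> (e c) \<partial>lborel))"
    using z L_nonneg
    by (intro suminf_cong)
      (simp add: nn_integral_cmult nn_integral_dom_power power_mult_distrib mult.assoc[symmetric] ennreal_mult[symmetric] mult.commute)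
  also have "\<dots> = (\<Sum>n. ennreal ((L * z) ^ n / fact n)) * (\<integral>\<^sup>+c. \<sigma> (e c) \<partial>lborel)"
    by simp
  also have "(\<Sum>n. ennreal ((L * z) ^ n / fact n)) = ennreal (exp (L * z))"
    using z L_nonneg summable_exp_generic[of "L * z"]
    by (subst suminf_ennreal2) (auto simp: exp_def field_simps)
  finally show ?thesis .
qed

lemma W_mono: "0 \<le> z \<Longrightarrow> z \<le> z' \<Longrightarrow> W \<sigma> z P \<le> W \<sigma> z' P"
  unfolding W_def by (intro suminf_le mult_right_mono ennreal_leI divide_right_mono power_mono) auto

text \<open>Monotonicity in \<open>z\<close> reduces all distances to the integers; a countable
  union of null sets then gives one null set for every \<open>z\<close>.\<close>

lemma AE_W_finite:
  assumes [measurable]: "\<sigma> \<in> borel_measurable borel" and fin: "(\<integral>\<^sup>+c. \<sigma> (e c) \<partial>lborel) < \<infinity>"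
  shows "AE c in lborel. \<forall>z\<ge>0. W \<sigma> z (e c) < \<infinity> \<and> dom (W \<sigma> z) (e c) < \<infinity>"
proof -
  have "AE c in lborel. W \<sigma> (real n) (e c) \<noteq> \<infinity> \<and> dom (W \<sigma> (real n)) (e c) \<noteq> \<infinity>" for n
  proof (rule AE_conjI)
    show "AE c in lborel. W \<sigma> (real n) (e c) \<noteq> \<infinity>"
      using fin by (intro nn_integral_PInf_AE) (auto simp: nn_integral_W ennreal_mult_eq_top_iff)
    show "AE c in lborel. dom (W \<sigma> (real n)) (e c) \<noteq> \<infinity>"
      using fin by (intro nn_integral_PInf_AE) (auto simp: nn_integral_dom nn_integral_W ennreal_mult_eq_top_iff)
  qed
  then have "AE c in lborel. \<forall>n. W \<sigma> (real n) (e c) \<noteq> \<infinity> \<and> dom (W \<sigma> (real n)) (e c) \<noteq> \<infinity>"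
    by (simp add: AE_all_countable)
  then show ?thesis
  proof (eventually_elim, intro allI impI)
    fix c and z :: real assume c: "\<forall>n. W \<sigma> (real n) (e c) \<noteq> \<infinity> \<and> dom (W \<sigma> (real n)) (e c) \<noteq> \<infinity>" and z: "0 \<le> z"
    obtain n where n: "z \<le> real n" using real_arch_simple by blast
    show "W \<sigma> z (e c) < \<infinity> \<and> dom (W \<sigma> z) (e c) < \<infinity>"
      using c le_less_trans[OF W_mono[OF z n, of \<sigma> "e c"]]
        le_less_trans[OF dom_mono[OF W_mono[OF z n, of \<sigma>], where P="e c"]] by (simp add: less_top)
  qed
qed

lemma nn_integral_sol_le:
  assumes \<sigma> [measurable]: "\<sigma> \<in> borel_measurable borel"
    and S: "\<And>z P. 0 \<le> z \<Longrightarrow> ennreal (norm (S z P)) \<le> ennreal (1 + z) * \<sigma> P" and z: "0 \<le> s" "s \<le> z"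
  shows "(\<integral>\<^sup>+c. ennreal (norm (sol S s (e c))) \<partial>lborel) \<le> ennreal (1 + z) * (ennreal (exp (L * z)) * (\<integral>\<^sup>+c. \<sigma> (e c) \<partial>lborel))"
proof -
  have "(\<integral>\<^sup>+c. ennreal (norm (sol S s (e c))) \<partial>lborel) \<le> (\<integral>\<^sup>+c. ennreal (1 + z) * W \<sigma> z (e c) \<partial>lborel)"
    by (intro nn_integral_mono norm_sol_le[OF \<sigma> S z])
  also have "\<dots> = ennreal (1 + z) * (\<integral>\<^sup>+c. W \<sigma> z (e c) \<partial>lborel)"
    by (rule nn_integral_cmult) measurable
  also have "(\<integral>\<^sup>+c. W \<sigma> z (e c) \<partial>lborel) = ennreal (exp (L * z)) * (\<integral>\<^sup>+c. \<sigma> (e c) \<partial>lborel)"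
    using z by (intro nn_integral_W \<sigma>) simp
  finally show ?thesis .
qed

lemma sol_L1_path:
  assumes \<sigma> [measurable]: "\<sigma> \<in> borel_measurable borel"
    and S_meas: "(\<lambda>(s, P). S s P) \<in> borel_measurable (borel \<Otimes>\<^sub>M borel)"
    and S: "\<And>z P. 0 \<le> z \<Longrightarrow> ennreal (norm (S z P)) \<le> ennreal (1 + z) * \<sigma> P"
    and cont: "\<And>Z P. continuous_on {0..Z} (\<lambda>z. S z P)"
    and fin: "(\<integral>\<^sup>+c. \<sigma> (e c) \<partial>lborel) < \<infinity>"
  shows "L1_path (\<lambda>z c. sol S z (e c))"
  unfolding L1_path_def
proof (intro conjI allI impI)
  note m = uncurry_measurable[OF sol_measurable[OF S_meas]]
  have m1 [measurable]: "(\<lambda>c. sol S z (e c)) \<in> borel_measurable borel" for z by (rule m) auto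
  have "(\<lambda>(z, c). sol S z (e c)) \<in> borel_measurable (borel \<Otimes>\<^sub>M borel)"
    unfolding split_beta' by (rule m) auto
  then have [measurable]: "(\<lambda>(z, c). sol S z (e c)) \<in> borel_measurable borel" by (simp add: borel_prod)
  have [measurable]: "({0..} \<times> UNIV :: (real \<times> 'c) set) \<in> sets borel"
    by (intro borel_closed closed_Times) auto
  show "set_borel_measurable borel ({0..} \<times> UNIV) (\<lambda>(z, c). sol S z (e c))"
    unfolding set_borel_measurable_def by measurable
  fix z :: real assume z: "0 \<le> z"
  have int: "integrable lborel (\<lambda>c. sol S z (e c))" if "0 \<le> z" for z
  proof (rule integrableI_bounded)
    show "(\<integral>\<^sup>+c. ennreal (norm (sol S z (e c))) \<partial>lborel) < \<infinity>"
    proof (rule le_less_trans[OF nn_integral_sol_le[OF \<sigma> S that order_refl]])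
      show "ennreal (1 + z) * (ennreal (exp (L * z)) * (\<integral>\<^sup>+c. \<sigma> (e c) \<partial>lborel)) < \<infinity>"
        using fin by (auto intro!: ennreal_mult_less_top[THEN iffD2] simp del: ennreal_plus)
    qed
  qed simp
  show "integrable lborel (\<lambda>c. sol S z (e c))" by (rule int) fact
  \<comment> \<open>The majorant is taken at \<open>z + 1\<close> so that it bounds the path on a
    neighbourhood of \<open>z\<close>. The weight \<open>2 + z\<close> is
    \<open>1 + (z + 1)\<close>, and the factor 2 accounts for the two terms of the
    difference.\<close>
  define w where "w c = 2 * ((2 + z) * enn2real (W \<sigma> (z + 1) (e c)))" for c
  have Wm [measurable]: "W \<sigma> z' \<in> borel_measurable borel" for z' by measurable
  have W_int: "integrable lborel (\<lambda>c. enn2real (W \<sigma> (z + 1) (e c)))"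
  proof (rule integrableI_nonneg)
    have "(\<integral>\<^sup>+c. ennreal (enn2real (W \<sigma> (z + 1) (e c))) \<partial>lborel) \<le> (\<integral>\<^sup>+c. W \<sigma> (z + 1) (e c) \<partial>lborel)"
      by (intro nn_integral_mono) (simp add: ennreal_enn2real_if)
    also have "\<dots> < \<infinity>" using z fin by (simp add: nn_integral_W ennreal_mult_less_top)
    finally show "(\<integral>\<^sup>+c. ennreal (enn2real (W \<sigma> (z + 1) (e c))) \<partial>lborel) < \<infinity>" .
  qed simp_all
  have good: "AE c in lborel. \<forall>z\<ge>0. W \<sigma> z (e c) < \<infinity> \<and> dom (W \<sigma> z) (e c) < \<infinity>"
    by (rule AE_W_finite) fact+
  have "((\<lambda>s. LINT c|lborel. norm (sol S s (e c) - sol S z (e c))) \<longlongrightarrow> (LINT (c::'c)|lborel. 0)) (at z within {0..z+1})"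
  proof (rule lint_dominated_within[where w=w])
    show "integrable lborel w" unfolding w_def using W_int by auto
    show "AE c in lborel. ((\<lambda>s. norm (sol S s (e c) - sol S z (e c))) \<longlongrightarrow> 0) (at z within {0..z+1})"
      using good
    proof eventually_elim
      case (elim c)
      have "continuous_on {0..z+1} (\<lambda>z. sol S z (e c))"
        using elim by (intro sol_continuous[OF \<sigma> S_meas S _ cont]) auto
      then have "((\<lambda>s. sol S s (e c)) \<longlongrightarrow> sol S z (e c)) (at z within {0..z+1})"
        using z by (auto simp: continuous_on_def)
      then show ?case by (intro tendsto_norm_zero LIM_zero)
    qed
    show "AE c in lborel. norm (norm (sol S s (e c) - sol S z (e c))) \<le> w c" if "s \<in> {0..z+1}" for s
      using good
    proof eventually_elim
      case (elim c)
      have fin: "W \<sigma> (z + 1) (e c) < \<infinity>" using elim z by auto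
      have le: "norm (sol S s (e c)) \<le> (2 + z) * enn2real (W \<sigma> (z + 1) (e c))" if "0 \<le> s" "s \<le> z + 1" for s
      proof -
        have "ennreal (norm (sol S s (e c))) \<le> ennreal (1 + (z + 1)) * W \<sigma> (z + 1) (e c)"
          by (rule norm_sol_le[OF \<sigma> S that])
        also have "\<dots> = ennreal ((2 + z) * enn2real (W \<sigma> (z + 1) (e c)))"
          using fin z by (simp add: ennreal_mult add.commute del: ennreal_plus)
        finally show ?thesis using z by (subst (asm) ennreal_le_iff) auto
      qed
      show ?case
        using norm_triangle_ineq4[of "sol S s (e c)" "sol S z (e c)"] le[of s] le[of z] that z unfolding w_def by simp
    qed
  qed simp_all
  also have "at z within {0..z+1} = at z within {0..}" by (rule at_within_nhd[of _ "{..<z + 1}"]) auto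
  finally show "((\<lambda>s. LINT c|lborel. norm (sol S s (e c) - sol S z (e c))) \<longlongrightarrow> 0) (at z within {0..})" by simp
qed

lemma dom_indicator_measurable:
  assumes u: "(\<lambda>(s, P). u s P) \<in> borel_measurable (borel \<Otimes>\<^sub>M borel)"
  shows "(\<lambda>x. dom (u (snd x)) (e (fst x)) * indicator {0..z} (snd x :: real)) \<in> borel_measurable (lborel \<Otimes>\<^sub>M lborel)"
proof (rule borel_measurable_times_ennreal)
  show "(\<lambda>x. dom (u (snd x)) (e (fst x))) \<in> borel_measurable (lborel \<Otimes>\<^sub>M lborel)"
    by (rule dom_measurable2[OF u]) measurable
qed measurable

lemma nn_integral_path_dom:
  assumes u: "(\<lambda>(s, P). u s P) \<in> borel_measurable (borel \<Otimes>\<^sub>M borel)"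
  shows "(\<integral>\<^sup>+c. (\<integral>\<^sup>+s\<in>{0..z::real}. dom (u s) (e c) \<partial>lborel) \<partial>lborel)
     = ennreal L * (\<integral>\<^sup>+s\<in>{0..z::real}. (\<integral>\<^sup>+c. u s (e c) \<partial>lborel) \<partial>lborel)"
proof -
  have [measurable]: "u s \<in> borel_measurable borel" for s by (rule section_measurable[OF u])
  have "(\<lambda>x. u (fst x) (e (snd x))) \<in> borel_measurable (lborel \<Otimes>\<^sub>M lborel)"
    by (rule uncurry_measurable[OF u]) auto
  then have [measurable]: "(\<lambda>s. \<integral>\<^sup>+c. u s (e c) \<partial>lborel) \<in> borel_measurable lborel"
    by (intro lborel.borel_measurable_nn_integral) (simp add: split_beta')
  have "(\<integral>\<^sup>+c. (\<integral>\<^sup>+s\<in>{0..z::real}. dom (u s) (e c) \<partial>lborel) \<partial>lborel) = (\<integral>\<^sup>+s. (\<integral>\<^sup>+c. dom (u s) (e c) * indicator {0..z} s \<partial>lborel) \<partial>lborel)"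
    by (rule lborel_pair.Fubini'[symmetric]) (simp add: split_beta' dom_indicator_measurable[OF u])
  also have "\<dots> = (\<integral>\<^sup>+s. ennreal L * ((\<integral>\<^sup>+c. u s (e c) \<partial>lborel) * indicator {0..z} s) \<partial>lborel)"
    by (intro nn_integral_cong) (auto simp: nn_integral_multc nn_integral_dom split: split_indicator)
  also have "\<dots> = ennreal L * (\<integral>\<^sup>+s\<in>{0..z::real}. (\<integral>\<^sup>+c. u s (e c) \<partial>lborel) \<partial>lborel)"
    by (rule nn_integral_cmult) measurable
  finally show ?thesis .
qed

lemma AE_path_dom_finite:
  assumes u: "(\<lambda>(s, P). u s P) \<in> borel_measurable (borel \<Otimes>\<^sub>M borel)"
    and le: "\<And>s. 0 \<le> s \<Longrightarrow> s \<le> z \<Longrightarrow> (\<integral>\<^sup>+c. u s (e c) \<partial>lborel) \<le> B" and B: "B < \<infinity>"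
  shows "AE c in lborel. (\<integral>\<^sup>+s\<in>{0..z::real}. dom (u s) (e c) \<partial>lborel) < \<infinity>"
proof -
  have "(\<integral>\<^sup>+s\<in>{0..z::real}. (\<integral>\<^sup>+c. u s (e c) \<partial>lborel) \<partial>lborel) \<le> (\<integral>\<^sup>+s. B * indicator {0..z} s \<partial>lborel)"
    by (intro nn_integral_mono) (auto split: split_indicator intro: le)
  also have "\<dots> < \<infinity>" by (rule nn_integral_const_Icc_less_top[OF B])
  finally have fin: "(\<integral>\<^sup>+c. (\<integral>\<^sup>+s\<in>{0..z::real}. dom (u s) (e c) \<partial>lborel) \<partial>lborel) < \<infinity>"
    unfolding nn_integral_path_dom[OF u] by (simp add: ennreal_mult_less_top)
  have "(\<lambda>c. \<integral>\<^sup>+s\<in>{0..z}. dom (u s) (e c) \<partial>lborel) \<in> borel_measurable lborel"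
    by (rule lborel.borel_measurable_nn_integral) (simp add: split_beta' dom_indicator_measurable[OF u])
  from nn_integral_PInf_AE[OF this] fin show ?thesis by (simp add: less_top)
qed

text \<open>Integration over the slice turns \<open>dom\<close> into multiplication by
  \<open>L\<close> and leaves a scalar inequality. The rate \<open>L + 1\<close> replaces
  \<open>L\<close> because the scalar lemma asks for a positive rate.\<close>

lemma path_gronwall:
  assumes D: "(\<lambda>(s, P). D s P) \<in> borel_measurable (borel \<Otimes>\<^sub>M borel)"
    and le: "\<And>z. 0 \<le> z \<Longrightarrow> z \<le> Z \<Longrightarrow> AE c in lborel.
       D z (e c) \<le> E c + (\<integral>\<^sup>+s\<in>{0..z}. dom (D s) (e c) \<partial>lborel)"
    and [measurable]: "E \<in> borel_measurable borel"
    and bd: "\<And>s. 0 \<le> s \<Longrightarrow> s \<le> Z \<Longrightarrow> (\<integral>\<^sup>+c. D s (e c) \<partial>lborel) \<le> B" and B: "B < \<infinity>"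
    and z: "0 \<le> z" "z \<le> Z"
  shows "(\<integral>\<^sup>+c. D z (e c) \<partial>lborel) \<le> 2 * (\<integral>\<^sup>+c. E c \<partial>lborel) * ennreal (exp (2 * (L + 1) * Z))"
proof (rule gronwall_ennreal[OF _ bd B _ z])
  fix z assume z: "0 \<le> z" "z \<le> Z"
  have [measurable]: "(\<lambda>c. \<integral>\<^sup>+s\<in>{0..z}. dom (D s) (e c) \<partial>lborel) \<in> borel_measurable lborel"
    by (rule lborel.borel_measurable_nn_integral) (simp add: split_beta' dom_indicator_measurable[OF D])
  have "(\<integral>\<^sup>+c. D z (e c) \<partial>lborel) \<le> (\<integral>\<^sup>+c. E c + (\<integral>\<^sup>+s\<in>{0..z}. dom (D s) (e c) \<partial>lborel) \<partial>lborel)"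
    by (intro nn_integral_mono_AE le z)
  also have "\<dots> = (\<integral>\<^sup>+c. E c \<partial>lborel) + ennreal L * (\<integral>\<^sup>+s\<in>{0..z}. (\<integral>\<^sup>+c. D s (e c) \<partial>lborel) \<partial>lborel)"
    by (simp add: nn_integral_add nn_integral_path_dom[OF D])
  also have "\<dots> \<le> (\<integral>\<^sup>+c. E c \<partial>lborel) + ennreal (L + 1) * (\<integral>\<^sup>+s\<in>{0..z}. (\<integral>\<^sup>+c. D s (e c) \<partial>lborel) \<partial>lborel)"
    using L_nonneg by (intro add_left_mono mult_right_mono ennreal_leI) auto
  finally show "(\<integral>\<^sup>+c. D z (e c) \<partial>lborel) \<le> (\<integral>\<^sup>+c. E c \<partial>lborel) + ennreal (L + 1) * (\<integral>\<^sup>+s\<in>{0..z}. (\<integral>\<^sup>+c. D s (e c) \<partial>lborel) \<partial>lborel)" .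
qed (use L_nonneg in auto)

end

section \<open>Gaussians and Fourier inversion\<close>

lemma nn_integral_lborel_affine:
  fixes t :: "'a::euclidean_space"
  assumes [measurable]: "f \<in> borel_measurable borel" and c: "c \<noteq> 0"
  shows "(\<integral>\<^sup>+x. f x \<partial>lborel) = ennreal (\<bar>c\<bar> ^ DIM('a)) * (\<integral>\<^sup>+x. f (t + c *\<^sub>R x) \<partial>lborel)"
  by (subst lborel_affine[OF c, of t])
     (simp add: nn_integral_density nn_integral_distr nn_integral_cmult)

lemma lint_lborel_affine:
  fixes f :: "'a::euclidean_space \<Rightarrow> 'b::{banach, second_countable_topology}"
  assumes [measurable]: "f \<in> borel_measurable borel" and c: "c \<noteq> 0"
  shows "(LINT x|lborel. f x) = \<bar>c\<bar> ^ DIM('a) *\<^sub>R (LINT x|lborel. f (t + c *\<^sub>R x))"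
  by (subst lborel_affine[OF c, of t]) (simp add: integral_density integral_distr)

lemma nn_integral_lborel_Pair:
  fixes f :: "'a::euclidean_space \<times> 'b::euclidean_space \<Rightarrow> ennreal"
  assumes [measurable]: "f \<in> borel_measurable borel"
  shows "(\<integral>\<^sup>+x. f x \<partial>lborel) = (\<integral>\<^sup>+a. (\<integral>\<^sup>+b. f (a, b) \<partial>lborel) \<partial>lborel)"
    and "(\<integral>\<^sup>+x. f x \<partial>lborel) = (\<integral>\<^sup>+b. (\<integral>\<^sup>+a. f (a, b) \<partial>lborel) \<partial>lborel)"
proof -
  have [measurable]: "f \<in> borel_measurable (lborel \<Otimes>\<^sub>M lborel)"
    using assms by (simp add: lborel_prod)
  show 1: "(\<integral>\<^sup>+x. f x \<partial>lborel) = (\<integral>\<^sup>+a. (\<integral>\<^sup>+b. f (a, b) \<partial>lborel) \<partial>lborel)"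
    unfolding lborel_prod[symmetric] by (rule lborel.nn_integral_fst[symmetric]) measurable
  also have "\<dots> = (\<integral>\<^sup>+b. (\<integral>\<^sup>+a. f (a, b) \<partial>lborel) \<partial>lborel)"
    by (rule lborel_pair.Fubini'[symmetric]) simp
  finally show "(\<integral>\<^sup>+x. f x \<partial>lborel) = (\<integral>\<^sup>+b. (\<integral>\<^sup>+a. f (a, b) \<partial>lborel) \<partial>lborel)" .
qed

text \<open>Scaling by \<open>sqrt (2 * a)\<close> turns the Gaussian into a multiple of the
  standard normal density, whose characteristic function is known.\<close>

lemma gauss_integrable_real:
  assumes a: "0 < a"
  shows "integrable lborel (\<lambda>t::real. exp (- (a * t\<^sup>2)))"
    and "(LINT t|lborel. of_real (exp (- (a * t\<^sup>2))) * cis (- (t * \<kappa>)))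
          = complex_of_real (sqrt (pi / a) * exp (- (\<kappa>\<^sup>2 / (4 * a))))"
proof -
  define c where "c = sqrt (2 * a)"
  have c: "0 < c" "c\<^sup>2 = 2 * a" using a by (auto simp: c_def)
  have eq: "exp (- (a * t\<^sup>2)) = sqrt (2 * pi) * std_normal_density (0 + c * t)" for t
    using c by (simp add: std_normal_density_def power_mult_distrib)
  have "integrable lborel (\<lambda>t. std_normal_density (0 + c * t))"
    using c by (subst lborel_integrable_real_affine_iff) auto
  then show "integrable lborel (\<lambda>t::real. exp (- (a * t\<^sup>2)))" unfolding eq by simp
  have "complex_of_real (exp (- ((- \<kappa> / c)\<^sup>2) / 2)) = (CLINT x|std_normal_distribution. iexp (- \<kappa> / c * x))"
    using fun_cong[OF char_std_normal_distribution, of "- \<kappa> / c"] by (simp add: char_def)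
  also have "\<dots> = (LINT x|lborel. std_normal_density x *\<^sub>R iexp (- \<kappa> / c * x))"
    by (subst integral_density) auto
  also have "\<dots> = \<bar>c\<bar> *\<^sub>R (LINT x|lborel. std_normal_density (0 + c * x) *\<^sub>R iexp (- \<kappa> / c * (0 + c * x)))"
    using c by (intro lborel_integral_real_affine) simp
  also have "(\<lambda>x. std_normal_density (0 + c * x) *\<^sub>R iexp (- \<kappa> / c * (0 + c * x)))
     = (\<lambda>x. (1 / sqrt (2 * pi)) *\<^sub>R (of_real (exp (- (a * x\<^sup>2))) * cis (- (x * \<kappa>))))"
    unfolding eq using c by (auto simp: fun_eq_iff cis_conv_exp scaleR_conv_of_real ac_simps)
  also have "\<bar>c\<bar> *\<^sub>R (LINT x|lborel. \<dots> x) = (c / sqrt (2 * pi)) *\<^sub>R (LINT t|lborel. of_real (exp (- (a * t\<^sup>2))) * cis (- (t * \<kappa>)))"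
    using c by simp
  finally have "(LINT t|lborel. of_real (exp (- (a * t\<^sup>2))) * cis (- (t * \<kappa>)))
      = (sqrt (2 * pi) / c) *\<^sub>R complex_of_real (exp (- ((- \<kappa> / c)\<^sup>2) / 2))"
    using c by simp
  also have "sqrt (2 * pi) / c = sqrt (pi / a)" by (simp add: c_def real_sqrt_divide[symmetric])
  also have "- ((- \<kappa> / c)\<^sup>2) / 2 = - (\<kappa>\<^sup>2 / (4 * a))" using c by (simp add: power_divide)
  finally show "(LINT t|lborel. of_real (exp (- (a * t\<^sup>2))) * cis (- (t * \<kappa>)))
          = complex_of_real (sqrt (pi / a) * exp (- (\<kappa>\<^sup>2 / (4 * a))))"
    by (simp add: scaleR_conv_of_real)
qed

lemma norm_sq_eq_sum_Basis: "(norm (x::'a::euclidean_space))\<^sup>2 = (\<Sum>b\<in>Basis. (x \<bullet> b)\<^sup>2)"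
  unfolding power2_norm_eq_inner by (subst euclidean_inner) (simp add: power2_eq_square)

lemma cis_sum: "finite A \<Longrightarrow> cis (sum f A) = (\<Prod>a\<in>A. cis (f a))"
  by (induction A rule: finite_induct) (auto simp: cis_mult[symmetric])

lemma gauss_integrable:
  assumes a: "0 < a"
  shows "integrable lborel (\<lambda>x::'a::euclidean_space. exp (- (a * (norm x)\<^sup>2)))"
proof (rule integrableI_nonneg)
  have "(\<integral>\<^sup>+(x::'a). ennreal (exp (- (a * (norm x)\<^sup>2))) \<partial>lborel)
     = (\<integral>\<^sup>+(x::'a). (\<Prod>b\<in>Basis. ennreal (exp (- (a * (x \<bullet> b)\<^sup>2)))) \<partial>lborel)"
    by (simp add: norm_sq_eq_sum_Basis sum_distrib_left sum_negf[symmetric] exp_sum prod_ennreal del: sum_negf)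
  also have "\<dots> = (\<Prod>b\<in>(Basis::'a set). \<integral>\<^sup>+t. ennreal (exp (- (a * t\<^sup>2))) \<partial>lborel)"
    by (rule nn_integral_lborel_prod) auto
  also have "(\<integral>\<^sup>+t. ennreal (exp (- (a * t\<^sup>2))) \<partial>lborel) = ennreal (LINT t|lborel. exp (- (a * t\<^sup>2)))"
    by (rule nn_integral_eq_integral[OF gauss_integrable_real(1)[OF a]]) auto
  also have "(\<Prod>b\<in>(Basis::'a set). ennreal (LINT t|lborel. exp (- (a * t\<^sup>2)))) < \<infinity>"
    by (simp add: ennreal_power)
  finally show "(\<integral>\<^sup>+(x::'a). ennreal (exp (- (a * (norm x)\<^sup>2))) \<partial>lborel) < \<infinity>" .
qed auto

text \<open>The Gaussian and the character both factor over the coordinates, so the integral is a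
  product of one-dimensional ones.\<close>

lemma gauss_fourier:
  fixes v :: "'a::euclidean_space"
  assumes a: "0 < a"
  shows "(LINT x|lborel. of_real (exp (- (a * (norm x)\<^sup>2))) * cis (- (x \<bullet> v)))
          = complex_of_real (sqrt (pi / a) ^ DIM('a) * exp (- ((norm v)\<^sup>2 / (4 * a))))"
proof -
  interpret P: product_sigma_finite "\<lambda>_::'a. lborel :: real measure" by standard
  let ?F = "\<lambda>(b::'a) t. complex_of_real (exp (- (a * t\<^sup>2))) * cis (- (t * (v \<bullet> b)))"
  have int: "integrable lborel (?F b)" for b
    by (rule Bochner_Integration.integrable_bound[OF gauss_integrable_real(1)[OF a]]) (auto simp: norm_mult)
  have eq: "of_real (exp (- (a * (norm x)\<^sup>2))) * cis (- (x \<bullet> v)) = (\<Prod>b\<in>Basis. ?F b (x \<bullet> b))" for x :: 'a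
    by (simp add: norm_sq_eq_sum_Basis euclidean_inner[of x v] sum_distrib_left sum_negf[symmetric] exp_sum cis_sum
        prod.distrib del: sum_negf)
  have "(LINT x|lborel. of_real (exp (- (a * (norm x)\<^sup>2))) * cis (- (x \<bullet> v)))
     = (LINT f|(\<Pi>\<^sub>M b\<in>(Basis::'a set). lborel). (\<Prod>b\<in>Basis. ?F b ((\<Sum>b\<in>Basis. f b *\<^sub>R b) \<bullet> b)))"
    unfolding eq by (subst lborel_eq, subst integral_distr) auto
  also have "\<dots> = (LINT f|(\<Pi>\<^sub>M b\<in>(Basis::'a set). lborel). (\<Prod>b\<in>Basis. ?F b (f b)))"
    by (intro Bochner_Integration.integral_cong prod.cong refl) (simp add: inner_sum_left inner_Basis if_distrib cong: if_cong)
  also have "\<dots> = (\<Prod>b\<in>Basis. LINT t|lborel. ?F b t)"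
    by (rule P.product_integral_prod) (auto intro: int)
  also have "\<dots> = (\<Prod>b\<in>Basis. complex_of_real (sqrt (pi / a) * exp (- ((v \<bullet> b)\<^sup>2 / (4 * a)))))"
    by (simp only: gauss_integrable_real(2)[OF a])
  also have "\<dots> = complex_of_real (sqrt (pi / a) ^ DIM('a) * exp (- ((norm v)\<^sup>2 / (4 * a))))"
    by (simp add: prod.distrib norm_sq_eq_sum_Basis sum_divide_distrib sum_negf[symmetric] exp_sum del: sum_negf)
  finally show ?thesis .
qed

lemma gauss_integral:
  assumes a: "0 < a"
  shows "(LINT x::'a::euclidean_space|lborel. exp (- (a * (norm x)\<^sup>2))) = sqrt (pi / a) ^ DIM('a)"
proof -
  have "complex_of_real (LINT x::'a|lborel. exp (- (a * (norm x)\<^sup>2))) = complex_of_real (sqrt (pi / a) ^ DIM('a))"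
    using gauss_fourier[OF a, of "0::'a"] by (simp add: integral_complex_of_real[symmetric] del: integral_complex_of_real)
  then show ?thesis by (simp only: of_real_eq_iff)
qed

lemma integrable_pair_bound:
  fixes F :: "'a::euclidean_space \<times> 'b::euclidean_space \<Rightarrow> complex" and f :: "'a \<Rightarrow> complex" and h :: "'b \<Rightarrow> real"
  assumes [measurable]: "F \<in> borel_measurable (lborel \<Otimes>\<^sub>M lborel)"
    and f: "integrable lborel f" and h: "integrable lborel h"
    and le: "\<And>x y. norm (F (x, y)) \<le> norm (f x) * norm (h y)"
  shows "integrable (lborel \<Otimes>\<^sub>M lborel) F"
proof (rule integrableI_bounded)
  have [measurable]: "f \<in> borel_measurable borel" "h \<in> borel_measurable borel"
    using f h by auto
  have "(\<integral>\<^sup>+z. ennreal (norm (F z)) \<partial>(lborel \<Otimes>\<^sub>M lborel)) = (\<integral>\<^sup>+x. \<integral>\<^sup>+y. ennreal (norm (F (x, y))) \<partial>lborel \<partial>lborel)"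
    by (rule lborel.nn_integral_fst[symmetric]) measurable
  also have "\<dots> \<le> (\<integral>\<^sup>+x. \<integral>\<^sup>+y. ennreal (norm (f x)) * ennreal (norm (h y)) \<partial>lborel \<partial>lborel)"
    by (intro nn_integral_mono) (auto simp: ennreal_mult[symmetric] intro!: ennreal_leI le[unfolded real_norm_def])
  also have "\<dots> = (\<integral>\<^sup>+x. ennreal (norm (f x)) \<partial>lborel) * (\<integral>\<^sup>+y. ennreal (norm (h y)) \<partial>lborel)"
    by (simp add: nn_integral_cmult nn_integral_multc)
  also have "\<dots> < \<infinity>"
    using f h by (simp add: integrable_iff_bounded ennreal_mult_less_top)
  finally show "(\<integral>\<^sup>+z. ennreal (norm (F z)) \<partial>(lborel \<Otimes>\<^sub>M lborel)) < \<infinity>" .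
qed simp

text \<open>
  A function with vanishing Fourier transform is tested successively against Gaussians, bounded
  continuous functions and indicators of open sets.
\<close>

lemma fourier_zero_gauss:
  fixes f :: "'a::euclidean_space \<Rightarrow> complex"
  assumes f: "integrable lborel f" and zero: "\<And>x. (LINT k|lborel. f k * cis (k \<bullet> x)) = 0" and b: "0 < b"
  shows "(LINT k|lborel. f k * of_real (exp (- (b * (norm (k - y))\<^sup>2)))) = 0"
proof -
  \<comment> \<open>Chosen so that the Fourier transform of the Gaussian with rate \<open>a\<close>
    is a multiple of the one with rate \<open>b\<close>.\<close>
  define a where "a = 1 / (4 * b)"
  have a: "0 < a" using b by (simp add: a_def)
  have [measurable]: "f \<in> borel_measurable borel" using f by auto
  let ?F = "\<lambda>k x. f k * (of_real (exp (- (a * (norm x)\<^sup>2))) * cis (- (x \<bullet> (k - y))))"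
  have "(LINT k|lborel. LINT x|lborel. ?F k x) = (LINT x|lborel. LINT k|lborel. ?F k x)"
    by (rule lborel_pair.Fubini_integral[symmetric], rule integrable_pair_bound[OF _ f gauss_integrable[OF a]])
      (auto simp: norm_mult)
  also have "(\<lambda>x. LINT k|lborel. ?F k x) = (\<lambda>x. LINT k|lborel. (of_real (exp (- (a * (norm x)\<^sup>2))) * cis (x \<bullet> y)) * (f k * cis (k \<bullet> (- x))))"
  proof (intro ext Bochner_Integration.integral_cong refl)
    fix x k
    have "- (x \<bullet> (k - y)) = x \<bullet> y + k \<bullet> (- x)" by (simp add: inner_diff_right inner_commute)
    then have "cis (- (x \<bullet> (k - y))) = cis (x \<bullet> y) * cis (k \<bullet> (- x))" by (simp only: cis_mult)
    then show "?F k x = (of_real (exp (- (a * (norm x)\<^sup>2))) * cis (x \<bullet> y)) * (f k * cis (k \<bullet> (- x)))"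
      by (simp only: ac_simps)
  qed
  also have "\<dots> = (\<lambda>x. 0)" by (simp only: integral_mult_right_zero zero mult_zero_right)
  finally have "(LINT k|lborel. LINT x|lborel. ?F k x) = 0" by simp
  moreover have "(LINT x|lborel. ?F k x) = of_real (sqrt (pi / a) ^ DIM('a)) * (f k * of_real (exp (- (b * (norm (k - y))\<^sup>2))))" for k
    by (simp only: integral_mult_right_zero gauss_fourier[OF a]) (simp add: a_def ac_simps)
  ultimately have "of_real (sqrt (pi / a) ^ DIM('a)) * (LINT k|lborel. f k * of_real (exp (- (b * (norm (k - y))\<^sup>2)))) = 0"
    by (simp only: integral_mult_right_zero)
  then show ?thesis using a by simp
qed

text \<open>Approximate identity: in the variable scaled by the width \<open>c m\<close> the
  Gaussian is fixed, and the argument of \<open>h\<close> tends to \<open>k\<close>.\<close>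

lemma gauss_conv_tendsto:
  fixes h :: "'a::euclidean_space \<Rightarrow> real"
  assumes [measurable]: "h \<in> borel_measurable borel" and bd: "\<And>x. \<bar>h x\<bar> \<le> B" and cont: "isCont h k"
  shows "(\<lambda>m. sqrt (real (Suc m) / pi) ^ DIM('a) * (LINT y|lborel. h y * exp (- (real (Suc m) * (norm (k - y))\<^sup>2)))) \<longlonglongrightarrow> h k"
proof -
  define c where "c m = 1 / sqrt (real (Suc m))" for m
  have c: "0 < c m" "real (Suc m) * (c m)\<^sup>2 = 1" for m by (auto simp: c_def power_divide)
  have "sqrt (real (Suc m) / pi) ^ DIM('a) * (LINT y|lborel. h y * exp (- (real (Suc m) * (norm (k - y))\<^sup>2)))
     = (1 / sqrt pi) ^ DIM('a) * (LINT y|lborel. h (k + c m *\<^sub>R y) * exp (- (norm y)\<^sup>2))" for m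
  proof -
    have "(LINT y|lborel. h y * exp (- (real (Suc m) * (norm (k - y))\<^sup>2)))
       = \<bar>c m\<bar> ^ DIM('a) *\<^sub>R (LINT y|lborel. h (k + c m *\<^sub>R y) * exp (- (real (Suc m) * (norm (k - (k + c m *\<^sub>R y)))\<^sup>2)))"
      using c(1)[of m] by (intro lint_lborel_affine) auto
    also have "(\<lambda>y. h (k + c m *\<^sub>R y) * exp (- (real (Suc m) * (norm (k - (k + c m *\<^sub>R y)))\<^sup>2)))
        = (\<lambda>y. h (k + c m *\<^sub>R y) * exp (- (norm y)\<^sup>2))"
      using c(2)[of m] by (simp add: power_mult_distrib mult.assoc[symmetric] del: of_nat_Suc)
    finally show ?thesis
      by (simp add: c_def power_mult_distrib[symmetric] real_sqrt_divide mult.assoc[symmetric] del: of_nat_Suc)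
  qed
  moreover have "(\<lambda>m. (1 / sqrt pi) ^ DIM('a) * (LINT y|lborel. h (k + c m *\<^sub>R y) * exp (- (norm y)\<^sup>2)))
     \<longlonglongrightarrow> (1 / sqrt pi) ^ DIM('a) * (LINT y::'a|lborel. h k * exp (- (norm y)\<^sup>2))"
  proof (rule tendsto_mult[OF tendsto_const], rule integral_dominated_convergence[where w="\<lambda>y. B * exp (- (norm y)\<^sup>2)"])
    show "integrable lborel (\<lambda>y::'a. B * exp (- (norm y)\<^sup>2))"
      using gauss_integrable[of 1, where 'a='a] by simp
    show "AE y in lborel. norm (h (k + c m *\<^sub>R y) * exp (- (norm y)\<^sup>2)) \<le> B * exp (- (norm y)\<^sup>2)" for m
      using bd by (intro AE_I2) (simp add: abs_mult)
    show "AE y in lborel. (\<lambda>m. h (k + c m *\<^sub>R y) * exp (- (norm y)\<^sup>2)) \<longlonglongrightarrow> h k * exp (- (norm y)\<^sup>2)"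
    proof (rule AE_I2)
      fix y :: 'a
      have "c \<longlonglongrightarrow> 0" unfolding c_def
        by (rule LIMSEQ_Suc[where f="\<lambda>n. 1 / sqrt (real n)"]) (intro tendsto_divide_0[OF tendsto_const] filterlim_at_top_imp_at_infinity
            filterlim_compose[OF sqrt_at_top filterlim_real_sequentially])
      then have "(\<lambda>m. k + c m *\<^sub>R y) \<longlonglongrightarrow> k + 0 *\<^sub>R y" by (intro tendsto_intros)
      then have "(\<lambda>m. k + c m *\<^sub>R y) \<longlonglongrightarrow> k" by simp
      then have "(\<lambda>m. h (k + c m *\<^sub>R y)) \<longlonglongrightarrow> h k" by (rule isCont_tendsto_compose[OF cont])
      then show "(\<lambda>m. h (k + c m *\<^sub>R y) * exp (- (norm y)\<^sup>2)) \<longlonglongrightarrow> h k * exp (- (norm y)\<^sup>2)" by (intro tendsto_intros)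
    qed
  qed auto
  moreover have "(1 / sqrt pi) ^ DIM('a) * (LINT y::'a|lborel. h k * exp (- (norm y)\<^sup>2)) = h k"
    using gauss_integral[of 1, where 'a='a] by (simp add: power_mult_distrib[symmetric])
  ultimately show ?thesis by (simp only:)
qed

text \<open>The Gaussian averages \<open>E m\<close> of \<open>h\<close> integrate to 0 against
  \<open>f\<close> by Fubini and the Gaussian case. They stay below \<open>B\<close> and converge to
  \<open>h\<close> pointwise, so dominated convergence finishes.\<close>

lemma fourier_zero_continuous:
  fixes f :: "'a::euclidean_space \<Rightarrow> complex" and h :: "'a \<Rightarrow> real"
  assumes f: "integrable lborel f" and zero: "\<And>x. (LINT k|lborel. f k * cis (k \<bullet> x)) = 0"
    and h: "continuous_on UNIV h" and bd: "\<And>x. \<bar>h x\<bar> \<le> B"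
  shows "(LINT k|lborel. f k * of_real (h k)) = 0"
proof -
  have [measurable]: "f \<in> borel_measurable borel" "h \<in> borel_measurable borel"
    using f h by (auto intro: borel_measurable_continuous_onI)
  define E where "E m k = sqrt (real (Suc m) / pi) ^ DIM('a) * (LINT y|lborel. h y * exp (- (real (Suc m) * (norm (k - y))\<^sup>2)))" for m and k :: 'a
  have Em [measurable]: "E m \<in> borel_measurable borel" for m
  proof -
    have "(\<lambda>k. LINT y|lborel. h y * exp (- (real (Suc m) * (norm (k - y))\<^sup>2))) \<in> borel_measurable borel"
      by (rule lborel.borel_measurable_lebesgue_integral) simp
    then show ?thesis unfolding E_def[abs_def] by measurable
  qed
  have int: "integrable lborel (\<lambda>y. exp (- (real (Suc m) * (norm (k - y))\<^sup>2)))" for m and k :: 'a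
  proof -
    have "integrable lborel (\<lambda>y. exp (- (real (Suc m) * (norm (- k + y))\<^sup>2)))"
      using gauss_integrable[of "real (Suc m)", where 'a='a]
        integrable_distr_eq[of "(+) (- k)" lborel borel "\<lambda>y. exp (- (real (Suc m) * (norm y)\<^sup>2))"]
      by (simp add: lborel_distr_plus del: of_nat_Suc)
    then show ?thesis by (simp add: norm_minus_commute)
  qed
  have val: "(LINT y|lborel. exp (- (real (Suc m) * (norm (k - y))\<^sup>2))) = sqrt (pi / real (Suc m)) ^ DIM('a)" for m and k :: 'a
  proof -
    have "(LINT y|lborel. exp (- (real (Suc m) * (norm (k - y))\<^sup>2))) = (LINT y::'a|lborel. exp (- (real (Suc m) * (norm y)\<^sup>2)))"
      using lint_lborel_affine[of "\<lambda>y. exp (- (real (Suc m) * (norm (k - y))\<^sup>2))" 1 k] by simp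
    then show ?thesis by (simp add: gauss_integral del: of_nat_Suc)
  qed
  have B0: "0 \<le> B" using bd[of 0] by linarith
  have E_le: "\<bar>E m k\<bar> \<le> B" for m k
  proof -
    have "norm (LINT y|lborel. h y * exp (- (real (Suc m) * (norm (k - y))\<^sup>2))) \<le> (LINT y|lborel. B * exp (- (real (Suc m) * (norm (k - y))\<^sup>2)))"
    proof (rule Bochner_Integration.integral_norm_bound_integral)
      show "integrable lborel (\<lambda>y. h y * exp (- (real (Suc m) * (norm (k - y))\<^sup>2)))"
        using bd B0 by (intro Bochner_Integration.integrable_bound[OF integrable_mult_right[OF int[of m k], of B]]) (auto simp: abs_mult intro!: mult_right_mono)
    qed (use bd int in \<open>auto simp: abs_mult intro!: mult_right_mono\<close>)
    also have "\<dots> = B * sqrt (pi / real (Suc m)) ^ DIM('a)" by (simp add: val del: of_nat_Suc)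
    finally have "\<bar>E m k\<bar> \<le> sqrt (real (Suc m) / pi) ^ DIM('a) * (B * sqrt (pi / real (Suc m)) ^ DIM('a))"
      unfolding E_def abs_mult by (intro mult_mono) auto
    also have "\<dots> = B * (sqrt (real (Suc m) / pi) * sqrt (pi / real (Suc m))) ^ DIM('a)"
      by (simp only: power_mult_distrib ac_simps)
    also have "sqrt (real (Suc m) / pi) * sqrt (pi / real (Suc m)) = 1"
      by (simp add: real_sqrt_mult[symmetric] del: of_nat_Suc)
    finally show ?thesis by simp
  qed
  have E0: "(LINT k|lborel. f k * of_real (E m k)) = 0" for m
  proof -
    let ?F = "\<lambda>k y. f k * of_real (h y * exp (- (real (Suc m) * (norm (k - y))\<^sup>2)))"
    have "integrable (lborel \<Otimes>\<^sub>M lborel) (case_prod ?F)"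
    proof (rule integrableI_bounded)
      have "(\<integral>\<^sup>+z. ennreal (norm (case_prod ?F z)) \<partial>(lborel \<Otimes>\<^sub>M lborel))
         = (\<integral>\<^sup>+k. \<integral>\<^sup>+y. ennreal (norm (?F k y)) \<partial>lborel \<partial>lborel)"
        by (subst lborel.nn_integral_fst[symmetric]) auto
      also have "\<dots> \<le> (\<integral>\<^sup>+k. \<integral>\<^sup>+y. ennreal (norm (f k)) * ennreal (B * exp (- (real (Suc m) * (norm (k - y))\<^sup>2))) \<partial>lborel \<partial>lborel)"
        using bd by (intro nn_integral_mono) (auto simp: norm_mult abs_mult ennreal_mult'[symmetric] intro!: ennreal_leI mult_left_mono mult_right_mono)
      also have "\<dots> = (\<integral>\<^sup>+k. ennreal (norm (f k)) * ennreal (B * sqrt (pi / real (Suc m)) ^ DIM('a)) \<partial>lborel)"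
      proof (intro nn_integral_cong)
        fix k :: 'a
        have "0 \<le> B" using bd[of 0] by linarith
        then have "(\<integral>\<^sup>+y. ennreal (B * exp (- (real (Suc m) * (norm (k - y))\<^sup>2))) \<partial>lborel) = ennreal (B * sqrt (pi / real (Suc m)) ^ DIM('a))"
          by (subst nn_integral_eq_integral) (auto simp: val int simp del: of_nat_Suc)
        then show "(\<integral>\<^sup>+y. ennreal (norm (f k)) * ennreal (B * exp (- (real (Suc m) * (norm (k - y))\<^sup>2))) \<partial>lborel)
            = ennreal (norm (f k)) * ennreal (B * sqrt (pi / real (Suc m)) ^ DIM('a))"
          by (subst nn_integral_cmult) auto
      qed
      also have "\<dots> = (\<integral>\<^sup>+k. ennreal (norm (f k)) \<partial>lborel) * ennreal (B * sqrt (pi / real (Suc m)) ^ DIM('a))"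
        by (rule nn_integral_multc) measurable
      also have "\<dots> < \<infinity>" using f by (simp add: integrable_iff_bounded ennreal_mult_less_top)
      finally show "(\<integral>\<^sup>+z. ennreal (norm (case_prod ?F z)) \<partial>(lborel \<Otimes>\<^sub>M lborel)) < \<infinity>" .
    qed simp
    then have "(LINT k|lborel. LINT y|lborel. ?F k y) = (LINT y|lborel. LINT k|lborel. ?F k y)"
      by (rule lborel_pair.Fubini_integral[symmetric])
    also have "(\<lambda>y. LINT k|lborel. ?F k y) = (\<lambda>y. LINT k|lborel. of_real (h y) * (f k * of_real (exp (- (real (Suc m) * (norm (k - y))\<^sup>2)))))"
      by (simp add: ac_simps)
    also have "\<dots> = (\<lambda>y. 0)"
      by (simp only: integral_mult_right_zero fourier_zero_gauss[OF f zero] of_nat_0_less_iff zero_less_Suc mult_zero_right)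
    finally have "(LINT k|lborel. LINT y|lborel. ?F k y) = 0" by simp
    moreover have "f k * of_real (E m k) = of_real (sqrt (real (Suc m) / pi) ^ DIM('a)) * (LINT y|lborel. ?F k y)" for k
    proof -
      have "(LINT y|lborel. ?F k y) = f k * of_real (LINT y|lborel. h y * exp (- (real (Suc m) * (norm (k - y))\<^sup>2)))"
        by (simp only: integral_mult_right_zero integral_complex_of_real)
      then show ?thesis by (simp only: E_def of_real_mult ac_simps)
    qed
    ultimately show ?thesis by (simp only: integral_mult_right_zero mult_zero_right)
  qed
  have "(\<lambda>m. LINT k|lborel. f k * of_real (E m k)) \<longlonglongrightarrow> (LINT k|lborel. f k * of_real (h k))"
  proof (rule integral_dominated_convergence[where w="\<lambda>k. B * norm (f k)"])
    show "AE k in lborel. (\<lambda>m. f k * of_real (E m k)) \<longlonglongrightarrow> f k * of_real (h k)"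
    proof (intro AE_I2 tendsto_intros)
      fix k show "(\<lambda>m. E m k) \<longlonglongrightarrow> h k" unfolding E_def
        by (rule gauss_conv_tendsto[OF _ bd]) (use h in \<open>auto simp: continuous_on_eq_continuous_at\<close>)
    qed
    show "AE k in lborel. norm (f k * of_real (E m k)) \<le> B * norm (f k)" for m
    proof (rule AE_I2)
      fix k
      have "norm (f k) * \<bar>E m k\<bar> \<le> norm (f k) * B" by (intro mult_left_mono E_le) simp
      then show "norm (f k * of_real (E m k)) \<le> B * norm (f k)" by (simp add: norm_mult mult.commute)
    qed
  qed (use f in auto)
  then show ?thesis unfolding E0 by (simp add: LIMSEQ_const_iff)
qed

text \<open>The truncated multiples \<open>min 1 (real m * infdist k (- U))\<close> are continuous,
  bounded by 1 and tend to the indicator of \<open>U\<close>.\<close>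

lemma fourier_zero_open:
  fixes f :: "'a::euclidean_space \<Rightarrow> complex"
  assumes f: "integrable lborel f" and zero: "\<And>x. (LINT k|lborel. f k * cis (k \<bullet> x)) = 0" and U: "open U"
  shows "(LINT k|lborel. f k * of_real (indicator U k)) = 0"
\<comment> \<open>For the whole space the complement is empty and its \<open>infdist\<close> is 0 by
  convention, so the approximation would vanish; that case is the hypothesis at frequency 0.\<close>
proof (cases "U = UNIV")
  case True
  then show ?thesis using zero[of 0] by simp
next
  case False
  have [measurable]: "f \<in> borel_measurable borel" using f by auto
  have [measurable]: "U \<in> sets borel" using U by simp
  define h where "h m k = min 1 (real m * infdist k (- U))" for m and k
  have h01: "0 \<le> h m k" "h m k \<le> 1" for m k by (auto simp: h_def infdist_nonneg)
  have hc: "continuous_on UNIV (h m)" for m unfolding h_def by (intro continuous_intros)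
  then have [measurable]: "h m \<in> borel_measurable borel" for m by (rule borel_measurable_continuous_onI)
  have "(LINT k|lborel. f k * of_real (h m k)) = 0" for m
    by (rule fourier_zero_continuous[OF f zero hc, of _ 1]) (use h01 in auto)
  moreover have "(\<lambda>m. LINT k|lborel. f k * of_real (h m k)) \<longlonglongrightarrow> (LINT k|lborel. f k * of_real (indicator U k))"
  proof (rule integral_dominated_convergence[where w="\<lambda>k. norm (f k)"])
    show "AE k in lborel. (\<lambda>m. f k * of_real (h m k)) \<longlonglongrightarrow> f k * of_real (indicator U k)"
    proof (intro AE_I2 tendsto_intros)
      fix k
      show "(\<lambda>m. h m k) \<longlonglongrightarrow> indicator U k"
      proof (cases "k \<in> U")
        case True
        have d: "0 < infdist k (- U)"
          using infdist_pos_not_in_closed[of "- U" k] True False U by auto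
        obtain m0 where m0: "1 / infdist k (- U) \<le> real m0" using real_arch_simple by blast
        have "eventually (\<lambda>m. h m k = 1) sequentially"
        proof (rule eventually_sequentiallyI[of m0])
          fix m assume "m0 \<le> m"
          then have "1 / infdist k (- U) \<le> real m" using m0 by linarith
          then show "h m k = 1" using d by (simp add: h_def field_simps min_def)
        qed
        then show ?thesis using True by (simp add: tendsto_eventually)
      next
        case False
        then show ?thesis by (simp add: h_def)
      qed
    qed
    show "AE k in lborel. norm (f k * of_real (h m k)) \<le> norm (f k)" for m
      using h01 by (intro AE_I2) (simp add: norm_mult mult_left_le)
  qed (use f in auto)
  ultimately show ?thesis by (simp add: LIMSEQ_const_iff)
qed

text \<open>The positive and negative parts of \<open>f\<close> are densities of two finite
  measures. These agree on the open sets, an intersection-stable generator of the Borel sets, hence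
  everywhere, and densities are unique almost everywhere. The sign \<open>s\<close> treats both
  parts at once.\<close>

lemma integral_open_zero_AE_real:
  fixes f :: "'a::euclidean_space \<Rightarrow> real"
  assumes f: "integrable lborel f" and zero: "\<And>U. open U \<Longrightarrow> (LINT k|lborel. f k * indicator U k) = 0"
  shows "AE k in lborel. f k = 0"
proof -
  have [measurable]: "f \<in> borel_measurable borel" using f by auto
  have int: "integrable lborel (\<lambda>k. max 0 (s * f k) * indicator U k)" if "U \<in> sets borel" "\<bar>s\<bar> = 1" for s and U :: "'a set"
  proof (rule Bochner_Integration.integrable_bound[OF f])
    note that(1) [measurable]
    show "(\<lambda>k. max 0 (s * f k) * indicator U k) \<in> borel_measurable lborel" by measurable
    have "max 0 (s * f k) \<le> \<bar>f k\<bar>" for k using abs_ge_self[of "s * f k"] that(2) by (simp add: abs_mult)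
    then show "AE k in lborel. norm (max 0 (s * f k) * indicator U k) \<le> norm (f k)" by (auto split: split_indicator)
  qed
  have em: "emeasure (density lborel (\<lambda>k. ennreal (s * f k))) U = ennreal (LINT k|lborel. max 0 (s * f k) * indicator U k)"
    if [measurable]: "U \<in> sets borel" and s: "\<bar>s\<bar> = 1" for s and U :: "'a set"
  proof -
    have "emeasure (density lborel (\<lambda>k. ennreal (s * f k))) U = (\<integral>\<^sup>+k. ennreal (max 0 (s * f k) * indicator U k) \<partial>lborel)"
      by (subst emeasure_density) (auto intro!: nn_integral_cong simp: max_def ennreal_neg split: split_indicator)
    also have "\<dots> = ennreal (LINT k|lborel. max 0 (s * f k) * indicator U k)"
      by (rule nn_integral_eq_integral[OF int[OF that]]) auto
    finally show ?thesis .
  qed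
  have "density lborel (\<lambda>k. ennreal (1 * f k)) = density lborel (\<lambda>k. ennreal (- 1 * f k))"
  proof (rule measure_eqI_generator_eq[where E="{S. open S}" and \<Omega>=UNIV and A="\<lambda>_. UNIV"])
    fix U :: "'a set" assume "U \<in> {S. open S}"
    then have U: "open U" "U \<in> sets borel" by auto
    have "(LINT k|lborel. max 0 (1 * f k) * indicator U k) - (LINT k|lborel. max 0 (- 1 * f k) * indicator U k)
       = (LINT k|lborel. max 0 (1 * f k) * indicator U k - max 0 (- 1 * f k) * indicator U k)"
      by (rule Bochner_Integration.integral_diff[symmetric]) (rule int[OF U(2)], simp)+
    also have "\<dots> = (LINT k|lborel. f k * indicator U k)"
      by (intro Bochner_Integration.integral_cong refl) (auto simp: max_def split: split_indicator)
    finally show "emeasure (density lborel (\<lambda>k. ennreal (1 * f k))) U = emeasure (density lborel (\<lambda>k. ennreal (- 1 * f k))) U"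
      using zero[OF U(1)] em[OF U(2), of 1] em[OF U(2), of "- 1"] by simp
  next
    show "emeasure (density lborel (\<lambda>k. ennreal (1 * f k))) UNIV \<noteq> \<infinity>" by (subst em) auto
  qed (auto simp: Int_stable_def borel_def)
  then have "AE k in lborel. ennreal (1 * f k) = ennreal (- 1 * f k)"
    by (intro sigma_finite_measure.density_unique[OF sigma_finite_lborel]) auto
  then show ?thesis
  proof eventually_elim
    case (elim k)
    then show ?case by (cases "0 \<le> f k") (auto simp: ennreal_neg)
  qed
qed

lemma fourier_zero_AE:
  fixes f :: "'a::euclidean_space \<Rightarrow> complex"
  assumes f: "integrable lborel f" and zero: "\<And>x. (LINT k|lborel. f k * cis (k \<bullet> x)) = 0"
  shows "AE k in lborel. f k = 0"
proof -
  have [measurable]: "f \<in> borel_measurable borel" using f by auto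
  have int: "integrable lborel (\<lambda>k. f k * of_real (indicator U k))" if "open U" for U
    using that by (intro Bochner_Integration.integrable_bound[OF f]) (auto simp: norm_mult split: split_indicator)
  note z = fourier_zero_open[OF f zero]
  have "AE k in lborel. Re (f k) = 0"
  proof (rule integral_open_zero_AE_real)
    fix U :: "'a set" assume U: "open U"
    show "(LINT k|lborel. Re (f k) * indicator U k) = 0"
      using integral_Re[OF int[OF U]] z[OF U] by simp
  qed (use f in auto)
  moreover have "AE k in lborel. Im (f k) = 0"
  proof (rule integral_open_zero_AE_real)
    fix U :: "'a set" assume U: "open U"
    show "(LINT k|lborel. Im (f k) * indicator U k) = 0"
      using integral_Im[OF int[OF U]] z[OF U] by simp
  qed (use f in auto)
  ultimately show ?thesis by eventually_elim (simp add: complex_eq_iff)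
qed

lemma integrable_mult_cis:
  fixes g :: "'a::euclidean_space \<Rightarrow> complex"
  assumes "integrable lborel g" and [measurable]: "h \<in> borel_measurable borel"
  shows "integrable lborel (\<lambda>k. g k * cis (h k))"
proof (rule Bochner_Integration.integrable_bound[OF assms(1)])
  have [measurable]: "g \<in> borel_measurable borel" using assms(1) by auto
  show "(\<lambda>k. g k * cis (h k)) \<in> borel_measurable lborel" by measurable
qed (simp add: norm_mult)

text \<open>Makes the choice operator in \<open>L1_fourier\<close> harmless up to null sets.\<close>

lemma has_L1_fourier_unique:
  assumes g: "has_L1_fourier f g" and g': "has_L1_fourier f g'"
  shows "AE k in lborel. g k = g' k"
proof -
  have int: "integrable lborel g" "integrable lborel g'" using g g' by (auto simp: has_L1_fourier_def)
  have "AE k in lborel. g k - g' k = 0"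
  proof (rule fourier_zero_AE)
    show "integrable lborel (\<lambda>k. g k - g' k)" using int by simp
    fix x :: 'a
    have i: "integrable lborel (\<lambda>k. h k * cis (k \<bullet> x))" if "integrable lborel h" for h :: "'a \<Rightarrow> complex"
      by (rule integrable_mult_cis[OF that]) measurable
    have "(1 / (2 * pi) ^ DIM('a)) *\<^sub>R (LINT k|lborel. g k * cis (k \<bullet> x)) = (1 / (2 * pi) ^ DIM('a)) *\<^sub>R (LINT k|lborel. g' k * cis (k \<bullet> x))"
      using g g' unfolding has_L1_fourier_def by metis
    then have "(LINT k|lborel. g k * cis (k \<bullet> x)) = (LINT k|lborel. g' k * cis (k \<bullet> x))" by simp
    then show "(LINT k|lborel. (g k - g' k) * cis (k \<bullet> x)) = 0"
      unfolding left_diff_distrib by (subst Bochner_Integration.integral_diff[OF i i]) (use int in auto)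
  qed
  then show ?thesis by simp
qed

text \<open>A continuous integrable function may be unbounded, so it is cut at the unit ball.
  Inside, the bounded case applies; outside, the Gaussian is at most
  \<open>exp (- real (Suc m))\<close>, which beats the normalisation.\<close>

lemma gauss_conv_tendsto_integrable:
  fixes h :: "'a::euclidean_space \<Rightarrow> real"
  assumes h: "integrable lborel h" and cont: "continuous_on UNIV h"
  shows "(\<lambda>m. sqrt (real (Suc m) / pi) ^ DIM('a) * (LINT y|lborel. h y * exp (- (real (Suc m) * (norm y)\<^sup>2)))) \<longlonglongrightarrow> h 0"
proof -
  have [measurable]: "h \<in> borel_measurable borel" using h by auto
  let ?c = "\<lambda>m. sqrt (real (Suc m) / pi) ^ DIM('a)"
  define h1 where "h1 y = h y * indicator (ball 0 1) y" for y
  define h2 where "h2 y = h y * indicator (- ball 0 1) y" for y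
  have [measurable]: "h1 \<in> borel_measurable borel" "h2 \<in> borel_measurable borel"
    unfolding h1_def[abs_def] h2_def[abs_def] by (intro borel_measurable_times borel_measurable_indicator; simp)+
  have i2: "integrable lborel h2"
    by (rule Bochner_Integration.integrable_bound[OF h]) (simp, simp add: h2_def split: split_indicator)
  have "compact (h ` cball 0 1)"
    by (intro compact_continuous_image continuous_on_subset[OF cont]) auto
  then obtain B where B': "\<forall>x\<in>cball 0 1. \<bar>h x\<bar> \<le> B"
    using compact_imp_bounded[of "h ` cball 0 1"] by (auto simp: bounded_iff)
  then have B: "\<bar>h x\<bar> \<le> B" if "x \<in> cball 0 1" for x using that by blast
  have B0: "0 \<le> B" using B[of 0] by simp
  have "(\<lambda>m. ?c m * (LINT y|lborel. h1 y * exp (- (real (Suc m) * (norm (0 - y))\<^sup>2)))) \<longlonglongrightarrow> h1 0"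
  proof (rule gauss_conv_tendsto)
    show "\<bar>h1 x\<bar> \<le> B" for x using B[of x] B0 by (auto simp: h1_def split: split_indicator)
    have "isCont h 0" using cont by (simp add: continuous_on_eq_continuous_at)
    moreover have "eventually (\<lambda>y::'a. y \<in> ball 0 1) (nhds 0)" by (rule eventually_nhds_in_open) auto
    then have "eventually (\<lambda>y. h y = h1 y) (nhds 0)" by eventually_elim (simp add: h1_def)
    ultimately show "isCont h1 0" by (simp add: isCont_cong)
  qed measurable
  then have 1: "(\<lambda>m. ?c m * (LINT y|lborel. h1 y * exp (- (real (Suc m) * (norm y)\<^sup>2)))) \<longlonglongrightarrow> h 0"
    by (simp add: h1_def)
  have i: "integrable lborel (\<lambda>y. k y * exp (- (real (Suc m) * (norm y)\<^sup>2)))"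
    if "integrable lborel k" for k :: "'a \<Rightarrow> real" and m
  proof (rule Bochner_Integration.integrable_bound[OF that])
    have [measurable]: "k \<in> borel_measurable borel" using that by auto
    show "(\<lambda>y. k y * exp (- (real (Suc m) * (norm y)\<^sup>2))) \<in> borel_measurable lborel" by measurable
  qed (simp add: abs_mult mult_left_le)
  have 2: "(\<lambda>m. ?c m * (LINT y|lborel. h2 y * exp (- (real (Suc m) * (norm y)\<^sup>2)))) \<longlonglongrightarrow> 0"
  proof (rule Lim_null_comparison[where g="\<lambda>m. real (Suc m) ^ DIM('a) / exp (real (Suc m)) * (LINT y|lborel. \<bar>h2 y\<bar>)"])
    show "\<forall>\<^sub>F m in sequentially. norm (?c m * (LINT y|lborel. h2 y * exp (- (real (Suc m) * (norm y)\<^sup>2))))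
        \<le> real (Suc m) ^ DIM('a) / exp (real (Suc m)) * (LINT y|lborel. \<bar>h2 y\<bar>)"
    proof (rule always_eventually, rule allI)
      fix m
      have "norm (LINT y|lborel. h2 y * exp (- (real (Suc m) * (norm y)\<^sup>2))) \<le> (LINT y|lborel. exp (- real (Suc m)) * \<bar>h2 y\<bar>)"
      proof (rule Bochner_Integration.integral_norm_bound_integral)
        fix y
        show "norm (h2 y * exp (- (real (Suc m) * (norm y)\<^sup>2))) \<le> exp (- real (Suc m)) * \<bar>h2 y\<bar>"
        proof (cases "norm y < 1")
          case False
          then have "1 \<le> (norm y)\<^sup>2" by (simp add: power2_eq_square mult_ge1_I)
          then have "real (Suc m) * 1 \<le> real (Suc m) * (norm y)\<^sup>2" by (intro mult_left_mono) auto
          then have "\<bar>h2 y\<bar> * exp (- (real (Suc m) * (norm y)\<^sup>2)) \<le> \<bar>h2 y\<bar> * exp (- real (Suc m))"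
            by (intro mult_left_mono) (simp_all del: of_nat_Suc)
          then show ?thesis by (simp add: abs_mult mult.commute del: of_nat_Suc)
        qed (simp add: h2_def)
      qed (rule i[OF i2], use i2 in simp)
      also have "\<dots> = exp (- real (Suc m)) * (LINT y|lborel. \<bar>h2 y\<bar>)" by simp
      finally have "norm (?c m * (LINT y|lborel. h2 y * exp (- (real (Suc m) * (norm y)\<^sup>2)))) \<le> ?c m * (exp (- real (Suc m)) * (LINT y|lborel. \<bar>h2 y\<bar>))"
        unfolding norm_mult by (intro mult_mono) auto
      \<comment> \<open>For \<open>x \<ge> 1\<close> one has \<open>sqrt (x / pi) \<le> x\<close>;
        any power is good enough against the exponential.\<close>
      also have "\<dots> \<le> real (Suc m) ^ DIM('a) * (exp (- real (Suc m)) * (LINT y|lborel. \<bar>h2 y\<bar>))"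
      proof (intro mult_right_mono power_mono)
        have "real (Suc m) * 1 \<le> real (Suc m) * pi" using pi_ge_two by (intro mult_left_mono) auto
        then have "real (Suc m) / pi \<le> real (Suc m)" by (simp add: divide_le_eq)
        also have "real (Suc m) \<le> (real (Suc m))\<^sup>2" by (rule self_le_power) auto
        finally have "real (Suc m) / pi \<le> (real (Suc m))\<^sup>2" .
        then show "sqrt (real (Suc m) / pi) \<le> real (Suc m)" by (intro real_le_lsqrt) auto
      qed auto
      finally show "norm (?c m * (LINT y|lborel. h2 y * exp (- (real (Suc m) * (norm y)\<^sup>2))))
        \<le> real (Suc m) ^ DIM('a) / exp (real (Suc m)) * (LINT y|lborel. \<bar>h2 y\<bar>)"
        by (simp only: exp_minus[of "real (Suc m)"] divide_inverse mult.assoc)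
    qed
    have "(\<lambda>m. real m ^ DIM('a) / exp (real m)) \<longlonglongrightarrow> 0"
      by (rule filterlim_compose[OF tendsto_power_div_exp_0 filterlim_real_sequentially])
    from tendsto_mult_left_zero[OF LIMSEQ_Suc[OF this]]
    show "(\<lambda>m. real (Suc m) ^ DIM('a) / exp (real (Suc m)) * (LINT y|lborel. \<bar>h2 y\<bar>)) \<longlonglongrightarrow> 0" .
  qed
  have "integrable lborel h1"
    by (rule Bochner_Integration.integrable_bound[OF h]) (simp, simp add: h1_def split: split_indicator)
  note i1 = this
  have "h y = h1 y + h2 y" for y by (simp add: h1_def h2_def split: split_indicator)
  then have "(LINT y|lborel. h y * exp (- (real (Suc m) * (norm y)\<^sup>2)))
     = (LINT y|lborel. h1 y * exp (- (real (Suc m) * (norm y)\<^sup>2))) + (LINT y|lborel. h2 y * exp (- (real (Suc m) * (norm y)\<^sup>2)))" for m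
    by (simp only: distrib_right Bochner_Integration.integral_add[OF i[OF i1] i[OF i2]])
  then have "(\<lambda>m. ?c m * (LINT y|lborel. h y * exp (- (real (Suc m) * (norm y)\<^sup>2))))
     = (\<lambda>m. ?c m * (LINT y|lborel. h1 y * exp (- (real (Suc m) * (norm y)\<^sup>2))) + ?c m * (LINT y|lborel. h2 y * exp (- (real (Suc m) * (norm y)\<^sup>2))))"
    by (simp only: distrib_left)
  then show ?thesis using tendsto_add[OF 1 2] by (simp only: add_0_right)
qed

text \<open>A Gaussian damping of the frequency integral is moved onto \<open>C\<close> by Fubini,
  where it becomes an approximate identity. As the damping is removed, one side converges by
  integrability of the transform, the other by continuity of \<open>C\<close> at 0.\<close>

lemma fourier_inversion_0:
  fixes C :: "'a::euclidean_space \<Rightarrow> real"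
  assumes C: "integrable lborel C" and cont: "continuous_on UNIV C"
    and F: "integrable lborel (fourier (\<lambda>x. of_real (C x)))"
  shows "(LINT k|lborel. fourier (\<lambda>x. of_real (C x)) k) = of_real ((2 * pi) ^ DIM('a) * C 0)"
proof -
  let ?F = "fourier (\<lambda>x. complex_of_real (C x))"
  have [measurable]: "?F \<in> borel_measurable borel" "C \<in> borel_measurable borel" using F C by auto
  \<comment> \<open>With this rate the transform of the damping factor has exactly the exponent
    \<open>real (Suc m)\<close> of the approximate identity.\<close>
  define a where "a m = 1 / (4 * real (Suc m))" for m
  have a: "0 < a m" for m by (simp add: a_def)
  have "a = (\<lambda>m. 1 / 4 * inverse (real (Suc m)))" by (simp add: a_def fun_eq_iff field_simps)
  then have "a \<longlonglongrightarrow> 0" using tendsto_mult_right_zero[OF LIMSEQ_inverse_real_of_nat, of "1 / 4"] by (simp only:)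
  have "(\<lambda>m. LINT k|lborel. ?F k * of_real (exp (- (a m * (norm k)\<^sup>2)))) \<longlonglongrightarrow> (LINT k|lborel. ?F k * of_real (exp (- (0 * (norm k)\<^sup>2))))"
  proof (rule integral_dominated_convergence[where w="\<lambda>k. norm (?F k)"])
    show "AE k in lborel. (\<lambda>m. ?F k * of_real (exp (- (a m * (norm k)\<^sup>2)))) \<longlonglongrightarrow> ?F k * of_real (exp (- (0 * (norm k)\<^sup>2)))"
      by (intro AE_I2 tendsto_intros \<open>a \<longlonglongrightarrow> 0\<close>)
    show "AE k in lborel. norm (?F k * of_real (exp (- (a m * (norm k)\<^sup>2)))) \<le> norm (?F k)" for m
      using a[of m] by (intro AE_I2) (simp add: norm_mult mult_left_le)
  qed (use F in auto)
  moreover have "(LINT k|lborel. ?F k * of_real (exp (- (a m * (norm k)\<^sup>2))))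
     = of_real ((2 * pi) ^ DIM('a) * (sqrt (real (Suc m) / pi) ^ DIM('a) * (LINT y|lborel. C y * exp (- (real (Suc m) * (norm y)\<^sup>2)))))" for m
  proof -
    let ?G = "\<lambda>x k. of_real (C x) * (of_real (exp (- (a m * (norm k)\<^sup>2))) * cis (- (k \<bullet> x)))"
    have "(LINT k|lborel. ?F k * of_real (exp (- (a m * (norm k)\<^sup>2)))) = (LINT k|lborel. LINT x|lborel. ?G x k)"
      unfolding fourier_def by (simp only: integral_mult_left_zero[symmetric] ac_simps)
    also have "\<dots> = (LINT x|lborel. LINT k|lborel. ?G x k)"
    proof (rule lborel_pair.Fubini_integral, rule integrable_pair_bound[where f="\<lambda>x. of_real (C x)"])
      show "integrable lborel (\<lambda>k::'a. exp (- (a m * (norm k)\<^sup>2)))" by (rule gauss_integrable[OF a])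
    qed (use C in \<open>auto simp: norm_mult\<close>)
    also have "\<dots> = (LINT x|lborel. of_real (C x) * complex_of_real (sqrt (pi / a m) ^ DIM('a) * exp (- ((norm x)\<^sup>2 / (4 * a m)))))"
      by (simp only: integral_mult_right_zero gauss_fourier[OF a])
    also have "\<dots> = (LINT x|lborel. complex_of_real (sqrt (pi / a m) ^ DIM('a) * (C x * exp (- (real (Suc m) * (norm x)\<^sup>2)))))"
      by (intro Bochner_Integration.integral_cong refl) (simp add: a_def ac_simps)
    also have "\<dots> = of_real (sqrt (pi / a m) ^ DIM('a) * (LINT y|lborel. C y * exp (- (real (Suc m) * (norm y)\<^sup>2))))"
      by (simp only: integral_complex_of_real integral_mult_right_zero)
    also have "sqrt (pi / a m) = 2 * pi * sqrt (real (Suc m) / pi)"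
    proof -
      have "pi / a m = (2 * pi)\<^sup>2 * (real (Suc m) / pi)" by (simp add: a_def power2_eq_square)
      then have "sqrt (pi / a m) = sqrt ((2 * pi)\<^sup>2) * sqrt (real (Suc m) / pi)" by (simp only: real_sqrt_mult)
      moreover have "sqrt ((2 * pi)\<^sup>2) = 2 * pi" by (rule real_sqrt_unique) auto
      ultimately show ?thesis by simp
    qed
    finally show ?thesis by (simp only: power_mult_distrib mult.assoc)
  qed
  moreover have "(\<lambda>m. complex_of_real ((2 * pi) ^ DIM('a) * (sqrt (real (Suc m) / pi) ^ DIM('a) * (LINT y|lborel. C y * exp (- (real (Suc m) * (norm y)\<^sup>2))))))
     \<longlonglongrightarrow> of_real ((2 * pi) ^ DIM('a) * C 0)"
    by (rule tendsto_of_real[OF tendsto_mult[OF tendsto_const gauss_conv_tendsto_integrable[OF C cont]]])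
  ultimately have "(LINT k|lborel. ?F k * of_real (exp (- (0 * (norm k)\<^sup>2)))) = of_real ((2 * pi) ^ DIM('a) * C 0)"
    by (simp only:) (rule LIMSEQ_unique)
  then show ?thesis by simp
qed

section \<open>Sum and difference variables\<close>

lemma nn_integral_shift:
  fixes t :: "'a::euclidean_space"
  assumes "f \<in> borel_measurable borel"
  shows "(\<integral>\<^sup>+x. f (t + x) \<partial>lborel) = (\<integral>\<^sup>+x. f x \<partial>lborel)"
  using nn_integral_lborel_affine[OF assms, of 1 t] by simp

lemma nn_integral_reflect:
  fixes t :: "'a::euclidean_space"
  assumes "f \<in> borel_measurable borel"
  shows "(\<integral>\<^sup>+x. f (t - x) \<partial>lborel) = (\<integral>\<^sup>+x. f x \<partial>lborel)"
  using nn_integral_lborel_affine[OF assms, of "- 1" t] by simp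

lemma distr_lborel_eqI:
  fixes T :: "'a::euclidean_space \<Rightarrow> 'a"
  assumes [measurable]: "T \<in> borel_measurable borel"
    and eq: "\<And>f. f \<in> borel_measurable borel \<Longrightarrow> (\<integral>\<^sup>+x. f (T x) \<partial>lborel) = (\<integral>\<^sup>+x. (f x :: ennreal) \<partial>lborel)"
  shows "distr lborel borel T = lborel"
proof (rule measure_eqI)
  fix A assume "A \<in> sets (distr lborel borel T)"
  then have [measurable]: "A \<in> sets borel" by simp
  have "emeasure (distr lborel borel T) A = (\<integral>\<^sup>+x. indicator A (T x) \<partial>lborel)"
    using nn_integral_distr[of T lborel borel "indicator A"] by simp
  then show "emeasure (distr lborel borel T) A = emeasure lborel A" by (simp add: eq)
qed simp

text \<open>
  Dual maps, both of determinant of modulus 1: \<open>(p, p')\<close> in terms of \<open>(\<xi>, \<zeta>)\<close>, and \<open>(x, y)\<close> in terms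
  of \<open>(q, r)\<close>.
\<close>

definition sum_diff_map :: "'a::euclidean_space \<times> 'a \<Rightarrow> 'a \<times> 'a" where
  "sum_diff_map = (\<lambda>(\<xi>, \<zeta>). (\<zeta> /\<^sub>R 2 + \<xi>, \<zeta> /\<^sub>R 2 - \<xi>))"

definition mid_diff_map :: "'a::euclidean_space \<times> 'a \<Rightarrow> 'a \<times> 'a" where
  "mid_diff_map = (\<lambda>(q, r). (r + q /\<^sub>R 2, r - q /\<^sub>R 2))"

lemma sum_diff_map_measurable [measurable]: "sum_diff_map \<in> borel_measurable borel"
  unfolding sum_diff_map_def split_beta' by (intro borel_measurable_continuous_onI continuous_intros)

lemma mid_diff_map_measurable [measurable]: "mid_diff_map \<in> borel_measurable borel"
  unfolding mid_diff_map_def split_beta' by (intro borel_measurable_continuous_onI continuous_intros)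

text \<open>Exhibits the map as a translation of the first variable followed by a shear, so that
  invariance of Lebesgue measure reduces to Tonelli and translations.\<close>

lemma sum_diff_map_split: "sum_diff_map (\<xi>, \<zeta>) = (\<zeta> /\<^sub>R 2 + \<xi>, \<zeta> - (\<zeta> /\<^sub>R 2 + \<xi>))"
  using scaleR_left_distrib[of "1 / 2" "1 / 2" \<zeta>] by (simp add: sum_diff_map_def algebra_simps)

lemma mid_diff_map_split: "mid_diff_map (q, r) = (q /\<^sub>R 2 + r, q /\<^sub>R 2 + r - q)"
  using scaleR_left_distrib[of "1 / 2" "1 / 2" q] by (simp add: mid_diff_map_def algebra_simps)

lemma nn_integral_sum_diff_map:
  assumes [measurable]: "f \<in> borel_measurable borel"
  shows "(\<integral>\<^sup>+x. f (sum_diff_map x) \<partial>lborel) = (\<integral>\<^sup>+x. f x \<partial>lborel)"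
proof -
  have "(\<integral>\<^sup>+x. f (sum_diff_map x) \<partial>lborel) = (\<integral>\<^sup>+\<zeta>. \<integral>\<^sup>+\<xi>. f (\<zeta> /\<^sub>R 2 + \<xi>, \<zeta> - (\<zeta> /\<^sub>R 2 + \<xi>)) \<partial>lborel \<partial>lborel)"
    using nn_integral_lborel_Pair(2)[of "\<lambda>x. f (sum_diff_map x)"] by (simp add: sum_diff_map_split)
  also have "\<dots> = (\<integral>\<^sup>+\<zeta>. \<integral>\<^sup>+p. f (p, \<zeta> - p) \<partial>lborel \<partial>lborel)"
    by (intro nn_integral_cong nn_integral_shift[where f="\<lambda>p. f (p, _ - p)"]) measurable
  also have "\<dots> = (\<integral>\<^sup>+p. \<integral>\<^sup>+\<zeta>. f (p, - p + \<zeta>) \<partial>lborel \<partial>lborel)"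
    by (subst lborel_pair.Fubini') (simp_all add: add.commute)
  also have "\<dots> = (\<integral>\<^sup>+p. \<integral>\<^sup>+\<zeta>. f (p, \<zeta>) \<partial>lborel \<partial>lborel)"
    by (intro nn_integral_cong nn_integral_shift[where f="\<lambda>\<zeta>. f (_, \<zeta>)"]) measurable
  also have "\<dots> = (\<integral>\<^sup>+x. f x \<partial>lborel)" by (rule nn_integral_lborel_Pair(1)[symmetric]) measurable
  finally show ?thesis .
qed

lemma nn_integral_mid_diff_map:
  assumes [measurable]: "f \<in> borel_measurable borel"
  shows "(\<integral>\<^sup>+x. f (mid_diff_map x) \<partial>lborel) = (\<integral>\<^sup>+x. f x \<partial>lborel)"
proof -
  have "(\<integral>\<^sup>+x. f (mid_diff_map x) \<partial>lborel) = (\<integral>\<^sup>+q. \<integral>\<^sup>+r. f (q /\<^sub>R 2 + r, (q /\<^sub>R 2 + r) - q) \<partial>lborel \<partial>lborel)"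
    using nn_integral_lborel_Pair(1)[of "\<lambda>x. f (mid_diff_map x)"] by (simp add: mid_diff_map_split)
  also have "\<dots> = (\<integral>\<^sup>+q. \<integral>\<^sup>+x. f (x, x - q) \<partial>lborel \<partial>lborel)"
    by (intro nn_integral_cong nn_integral_shift[where f="\<lambda>p. f (p, p - _)"]) measurable
  also have "\<dots> = (\<integral>\<^sup>+x. \<integral>\<^sup>+q. f (x, x - q) \<partial>lborel \<partial>lborel)"
    by (rule lborel_pair.Fubini') simp
  also have "\<dots> = (\<integral>\<^sup>+x. \<integral>\<^sup>+q. f (x, q) \<partial>lborel \<partial>lborel)"
    by (intro nn_integral_cong nn_integral_reflect[where f="\<lambda>q. f (_, q)"]) measurable
  also have "\<dots> = (\<integral>\<^sup>+x. f x \<partial>lborel)" by (rule nn_integral_lborel_Pair(1)[symmetric]) measurable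
  finally show ?thesis .
qed

lemma distr_sum_diff_map: "distr lborel borel sum_diff_map = lborel"
  by (rule distr_lborel_eqI) (auto intro: nn_integral_sum_diff_map)

lemma distr_mid_diff_map: "distr lborel borel mid_diff_map = lborel"
  by (rule distr_lborel_eqI) (auto intro: nn_integral_mid_diff_map)

lemma lint_distr_lborel:
  fixes f :: "'a::euclidean_space \<Rightarrow> 'b::{banach, second_countable_topology}"
  assumes "distr lborel borel T = lborel" "T \<in> borel_measurable borel" "f \<in> borel_measurable borel"
  shows "(LINT x|lborel. f (T x)) = (LINT x|lborel. f x)"
  using integral_distr[of T lborel borel f] assms by simp

lemma nn_integral_scale_snd:
  fixes f :: "'a::euclidean_space \<times> 'b::euclidean_space \<Rightarrow> ennreal"
  assumes [measurable]: "f \<in> borel_measurable borel" and e: "0 < e"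
  shows "(\<integral>\<^sup>+x. f x \<partial>lborel) = ennreal (e ^ DIM('b)) * (\<integral>\<^sup>+x. f (fst x, e *\<^sub>R snd x) \<partial>lborel)"
proof -
  have [measurable]: "(\<lambda>x. f (fst x, e *\<^sub>R snd x)) \<in> borel_measurable borel"
    by (rule measurable_compose[OF _ assms(1)]) (intro borel_measurable_continuous_onI continuous_intros)
  have "(\<integral>\<^sup>+x. f x \<partial>lborel) = (\<integral>\<^sup>+a. \<integral>\<^sup>+b. f (a, b) \<partial>lborel \<partial>lborel)"
    by (rule nn_integral_lborel_Pair(1)) measurable
  also have "\<dots> = (\<integral>\<^sup>+a. ennreal (e ^ DIM('b)) * (\<integral>\<^sup>+b. f (a, 0 + e *\<^sub>R b) \<partial>lborel) \<partial>lborel)"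
  proof (intro nn_integral_cong)
    fix a
    show "(\<integral>\<^sup>+b. f (a, b) \<partial>lborel) = ennreal (e ^ DIM('b)) * (\<integral>\<^sup>+b. f (a, 0 + e *\<^sub>R b) \<partial>lborel)"
      using nn_integral_lborel_affine[of "\<lambda>b. f (a, b)" e 0] e by simp
  qed
  also have "\<dots> = ennreal (e ^ DIM('b)) * (\<integral>\<^sup>+a. \<integral>\<^sup>+b. f (a, 0 + e *\<^sub>R b) \<partial>lborel \<partial>lborel)"
    by (rule nn_integral_cmult) measurable
  also have "(\<integral>\<^sup>+a. \<integral>\<^sup>+b. f (a, 0 + e *\<^sub>R b) \<partial>lborel \<partial>lborel) = (\<integral>\<^sup>+x. f (fst x, e *\<^sub>R snd x) \<partial>lborel)"
    by (subst nn_integral_lborel_Pair(1)) auto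
  finally show ?thesis .
qed

section \<open>The covariance function\<close>

lemma fourier_continuous:
  fixes f :: "'a::euclidean_space \<Rightarrow> complex"
  assumes f: "integrable lborel f"
  shows "continuous_on UNIV (fourier f)"
  unfolding continuous_on_sequentially comp_def fourier_def
proof (intro ballI allI impI, elim conjE)
  fix X and a :: 'a assume X: "X \<longlonglongrightarrow> a"
  have [measurable]: "f \<in> borel_measurable borel" using f by auto
  show "(\<lambda>n. LINT x|lborel. f x * cis (- (X n \<bullet> x))) \<longlonglongrightarrow> (LINT x|lborel. f x * cis (- (a \<bullet> x)))"
  proof (rule integral_dominated_convergence[where w="\<lambda>x. norm (f x)"])
    show "AE x in lborel. (\<lambda>n. f x * cis (- (X n \<bullet> x))) \<longlonglongrightarrow> f x * cis (- (a \<bullet> x))"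
      by (intro AE_I2 tendsto_intros X)
    show "AE x in lborel. norm (f x * cis (- (X n \<bullet> x))) \<le> norm (f x)" for n
      by (intro AE_I2) (simp add: norm_mult)
  qed (use f in auto)
qed

text \<open>The L^1 norm is continuous along the path, hence bounded on compact intervals. This is
  the a priori bound that Gronwall's inequality asks for.\<close>

lemma L1_path_bounded:
  fixes u :: "real \<Rightarrow> 'a::euclidean_space \<Rightarrow> complex"
  assumes u: "L1_path u"
  shows "\<exists>B. \<forall>s\<in>{0..Z}. (\<integral>\<^sup>+p. ennreal (norm (u s p)) \<partial>lborel) \<le> ennreal B"
proof -
  have int: "integrable lborel (u z)" if "0 \<le> z" for z using u that by (auto simp: L1_path_def)
  have cont: "continuous_on {0..} (\<lambda>s. LINT p|lborel. norm (u s p))"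
    unfolding continuous_on_def
  proof (intro ballI)
    fix z :: real assume "z \<in> {0..}"
    then have z: "0 \<le> z" by simp
    have "((\<lambda>s. LINT p|lborel. norm (u s p - u z p)) \<longlongrightarrow> 0) (at z within {0..})"
      using u z by (auto simp: L1_path_def)
    moreover have "eventually (\<lambda>s. norm ((LINT p|lborel. norm (u s p)) - (LINT p|lborel. norm (u z p)))
        \<le> (LINT p|lborel. norm (u s p - u z p))) (at z within {0..})"
      unfolding eventually_at_filter
    proof (intro always_eventually allI impI)
      fix s :: real assume "s \<in> {0..}"
      then have s: "0 \<le> s" by simp
      have "(LINT p|lborel. norm (u s p)) - (LINT p|lborel. norm (u z p)) = (LINT p|lborel. norm (u s p) - norm (u z p))"
        using int[OF s] int[OF z] by simp
      also have "norm (LINT p|lborel. norm (u s p) - norm (u z p)) \<le> (LINT p|lborel. norm (u s p - u z p))"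
        using int[OF s] int[OF z]
        by (intro Bochner_Integration.integral_norm_bound_integral) (auto simp: norm_triangle_ineq3)
      finally show "norm ((LINT p|lborel. norm (u s p)) - (LINT p|lborel. norm (u z p)))
        \<le> (LINT p|lborel. norm (u s p - u z p))" .
    qed
    ultimately have "((\<lambda>s. (LINT p|lborel. norm (u s p)) - (LINT p|lborel. norm (u z p))) \<longlongrightarrow> 0) (at z within {0..})"
      by (rule Lim_null_comparison[rotated])
    then show "((\<lambda>s. LINT p|lborel. norm (u s p)) \<longlongrightarrow> (LINT p|lborel. norm (u z p))) (at z within {0..})"
      by (rule LIM_zero_cancel)
  qed
  have "compact ((\<lambda>s. LINT p|lborel. norm (u s p)) ` {0..Z})"
    by (intro compact_continuous_image continuous_on_subset[OF cont]) auto
  then obtain B where B: "\<forall>s\<in>{0..Z}. norm (LINT p|lborel. norm (u s p)) \<le> B"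
    using compact_imp_bounded[of "(\<lambda>s. LINT p|lborel. norm (u s p)) ` {0..Z}"] by (auto simp: bounded_iff)
  show ?thesis
  proof (intro exI[of _ B] ballI)
    fix s assume s: "s \<in> {0..Z}"
    then have "(\<integral>\<^sup>+p. ennreal (norm (u s p)) \<partial>lborel) = ennreal (LINT p|lborel. norm (u s p))"
      by (intro nn_integral_eq_integral integrable_norm int) auto
    also have "\<dots> \<le> ennreal B" using B s by (intro ennreal_leI) (auto simp: abs_le_iff)
    finally show "(\<integral>\<^sup>+p. ennreal (norm (u s p)) \<partial>lborel) \<le> ennreal B" .
  qed
qed

text \<open>A path is arbitrary at negative distances; cutting these off gives a function measurable
  on the whole product.\<close>

lemma L1_path_measurable:
  assumes "L1_path u"
  shows "(\<lambda>(s, p). indicator {0..} s *\<^sub>R u s p) \<in> borel_measurable (borel \<Otimes>\<^sub>M borel)"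
proof -
  have "(\<lambda>x. indicator ({0..} \<times> UNIV) x *\<^sub>R (case x of (s, p) \<Rightarrow> u s p)) \<in> borel_measurable borel"
    using assms unfolding L1_path_def set_borel_measurable_def by auto
  also have "(\<lambda>x. indicator ({0..} \<times> UNIV) x *\<^sub>R (case x of (s, p) \<Rightarrow> u s p)) = (\<lambda>(s, p). indicator {0..} s *\<^sub>R u s p)"
    by (auto simp: fun_eq_iff indicator_def)
  finally show ?thesis by (simp add: borel_prod)
qed

lemma covariance_function_scale:
  assumes C: "covariance_function C" and e: "0 < e"
  shows "covariance_function (\<lambda>x. e * C x)" and "C_hat (\<lambda>x. e * C x) k = of_real e * C_hat C k"
proof -
  have eq: "C_hat (\<lambda>x. e * C x) k = of_real e * C_hat C k" for k
    unfolding fourier_def of_real_mult mult.assoc by (rule integral_mult_right_zero)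
  then show "C_hat (\<lambda>x. e * C x) k = of_real e * C_hat C k" by this
  have "C_hat (\<lambda>x. e * C x) = (\<lambda>k. of_real e * C_hat C k)" using eq by auto
  then show "covariance_function (\<lambda>x. e * C x)"
    using C e unfolding covariance_function_def
    by (auto intro!: continuous_intros nonneg_Reals_mult_I)
qed

locale covariance =
  fixes C :: "R2 \<Rightarrow> real"
  assumes cov: "covariance_function C"
begin

definition ch :: "R2 \<Rightarrow> real" where "ch k = Re (C_hat C k)"

lemma C_hat_eq: "C_hat C k = of_real (ch k)" and ch_nonneg: "0 \<le> ch k"
proof -
  have "C_hat C k \<in> \<real>\<^sub>\<ge>\<^sub>0" using cov by (simp add: covariance_function_def)
  then show "C_hat C k = of_real (ch k)" "0 \<le> ch k"
    by (auto simp: ch_def complex_nonneg_Reals_iff complex_eq_iff)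
qed

lemma C_hat_integrable: "integrable lborel (C_hat C)"
  using cov by (simp add: covariance_function_def)

lemma ch_integrable: "integrable lborel ch"
  using integrable_Re[OF C_hat_integrable] by (simp add: ch_def[abs_def])

lemma ch_measurable [measurable]: "ch \<in> borel_measurable borel"
  using ch_integrable by auto

lemma C_hat_measurable [measurable]: "C_hat C \<in> borel_measurable borel"
  using C_hat_integrable by auto

lemma ch_continuous: "continuous_on UNIV ch"
proof -
  have "integrable lborel (\<lambda>x. complex_of_real (C x))" using cov by (simp add: covariance_function_def)
  from fourier_continuous[OF this] show ?thesis unfolding ch_def[abs_def] by (intro continuous_intros)
qed

text \<open>Ties the damping, which is written with \<open>C 0\<close>, to the total scattering
  rate.\<close>

lemma ch_integral: "(LINT k|lborel. ch k) = (2 * pi)\<^sup>2 * C 0"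
proof -
  have "(LINT k|lborel. C_hat C k) = of_real ((2 * pi) ^ DIM(R2) * C 0)"
    using cov by (intro fourier_inversion_0) (auto simp: covariance_function_def)
  then have "complex_of_real (LINT k|lborel. ch k) = of_real ((2 * pi)\<^sup>2 * C 0)"
    by (simp add: C_hat_eq)
  then show ?thesis by (simp only: of_real_eq_iff)
qed

lemma C0_nonneg: "0 \<le> C 0"
proof -
  have "0 \<le> (LINT k|lborel. ch k)" by (intro Bochner_Integration.integral_nonneg ch_nonneg)
  then show ?thesis unfolding ch_integral by (simp add: zero_le_mult_iff)
qed

end

section \<open>The second-order moment\<close>

lemma DIM_R2: "DIM(R2) = 2" by simp

lemma M1_init_mid_diff_map:
  assumes "0 < r" "0 < \<rho>"
  shows "M1_init r \<rho> (mid_diff_map (q, x)) = exp (- (1 / (4 * \<rho>\<^sup>2) * (norm q)\<^sup>2)) * exp (- (1 / r\<^sup>2 * (norm x)\<^sup>2))"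
proof -
  have "x + q /\<^sub>R 2 + (x - q /\<^sub>R 2) = 2 *\<^sub>R x" by (simp add: scaleR_2)
  moreover have "x + q /\<^sub>R 2 - (x - q /\<^sub>R 2) = q"
    using scaleR_left_distrib[of "1 / 2" "1 / 2" q] by simp
  ultimately show ?thesis
    by (simp add: M1_init_def mid_diff_map_def exp_add[symmetric] power_mult_distrib)
qed

text \<open>Each map is the inverse transpose of the other. Hence the Fourier transform in
  \<open>(q, r)\<close> is the one in \<open>(x, y)\<close> composed with
  \<open>sum_diff_map\<close>.\<close>

lemma inner_sum_diff_mid_diff: "sum_diff_map (\<xi>, \<zeta>) \<bullet> mid_diff_map (q, x) = q \<bullet> \<xi> + x \<bullet> (\<zeta>::'a::euclidean_space)"
proof -
  have "sum_diff_map (\<xi>, \<zeta>) \<bullet> mid_diff_map (q, x) = (\<zeta> \<bullet> x) / 2 + (\<zeta> \<bullet> x) / 2 + ((\<xi> \<bullet> q) / 2 + (\<xi> \<bullet> q) / 2)"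
    by (simp add: sum_diff_map_def mid_diff_map_def inner_add_left inner_add_right inner_diff_left inner_diff_right field_simps)
  then show ?thesis by (simp add: inner_commute)
qed

lemma inner_sum_diff_mid_diff': "sum_diff_map Q \<bullet> mid_diff_map X = Q \<bullet> (X :: 'a::euclidean_space \<times> 'a)"
  by (cases Q; cases X) (simp add: inner_sum_diff_mid_diff, simp add: inner_commute)

lemma M1_init_measurable [measurable]: "M1_init r \<rho> \<in> borel_measurable borel"
  unfolding M1_init_def split_beta' divide_inverse by (intro borel_measurable_continuous_onI continuous_intros)

lemma fourier_M1_init:
  assumes r: "0 < r" and \<rho>: "0 < \<rho>"
  shows "fourier (\<lambda>X. of_real (M1_init r \<rho> X)) (sum_diff_map (\<xi>, \<zeta>))
     = of_real (4 * pi * \<rho>\<^sup>2 * exp (- (\<rho>\<^sup>2 * (norm \<xi>)\<^sup>2)) * (pi * r\<^sup>2 * exp (- (r\<^sup>2 * (norm \<zeta>)\<^sup>2 / 4))))"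
proof -
  \<comment> \<open>Rates of the Gaussians in \<open>q\<close> and in \<open>r\<close>: in these
    variables \<open>x - y\<close> is \<open>q\<close> and \<open>x + y\<close> is twice
    \<open>r\<close>, which cancels the 4 beside the squared radius.\<close>
  define a b where "a = 1 / (4 * \<rho>\<^sup>2)" and "b = 1 / r\<^sup>2"
  have a: "0 < a" and b: "0 < b" using r \<rho> by (auto simp: a_def b_def)
  let ?f = "\<lambda>q. complex_of_real (exp (- (a * (norm q)\<^sup>2))) * cis (- (q \<bullet> \<xi>))"
  let ?g = "\<lambda>x. complex_of_real (exp (- (b * (norm x)\<^sup>2))) * cis (- (x \<bullet> \<zeta>))"
  let ?F = "\<lambda>X. of_real (M1_init r \<rho> X) * cis (- (sum_diff_map (\<xi>, \<zeta>) \<bullet> X))"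
  have i: "integrable lborel (\<lambda>q::R2. complex_of_real (exp (- (a * (norm q)\<^sup>2))))"
    by (intro integrable_of_real gauss_integrable a)
  have int: "integrable (lborel \<Otimes>\<^sub>M lborel) (\<lambda>Y. ?f (fst Y) * ?g (snd Y))"
    by (rule integrable_pair_bound[OF _ i gauss_integrable[OF b]]) (auto simp: norm_mult)
  have "fourier (\<lambda>X. of_real (M1_init r \<rho> X)) (sum_diff_map (\<xi>, \<zeta>)) = (LINT Y|lborel. ?F (mid_diff_map Y))"
    unfolding fourier_def by (rule lint_distr_lborel[OF distr_mid_diff_map, symmetric]) measurable
  also have "\<dots> = (LINT Y|(lborel \<Otimes>\<^sub>M lborel). ?f (fst Y) * ?g (snd Y))"
    unfolding lborel_prod
  proof (intro Bochner_Integration.integral_cong refl)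
    fix Y :: "R2 \<times> R2"
    obtain q x where Y: "Y = (q, x)" by (cases Y)
    have "cis (- (q \<bullet> \<xi> + x \<bullet> \<zeta>)) = cis (- (q \<bullet> \<xi>)) * cis (- (x \<bullet> \<zeta>))" by (simp add: cis_mult)
    then show "?F (mid_diff_map Y) = ?f (fst Y) * ?g (snd Y)"
      unfolding Y inner_sum_diff_mid_diff M1_init_mid_diff_map[OF r \<rho>] fst_conv snd_conv
      by (simp only: a_def b_def of_real_mult mult_ac)
  qed
  also have "\<dots> = (LINT q|lborel. LINT x|lborel. ?f q * ?g x)"
    using lborel_pair.integral_fst'[OF int] by simp
  also have "\<dots> = (LINT q|lborel. ?f q) * (LINT x|lborel. ?g x)"
    by (simp only: integral_mult_right_zero integral_mult_left_zero)
  also have "(LINT q|lborel. ?f q) = of_real (sqrt (pi / a) ^ 2 * exp (- ((norm \<xi>)\<^sup>2 / (4 * a))))"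
    using gauss_fourier[OF a, of \<xi>] by (simp only: DIM_R2)
  also have "(LINT x|lborel. ?g x) = of_real (sqrt (pi / b) ^ 2 * exp (- ((norm \<zeta>)\<^sup>2 / (4 * b))))"
    using gauss_fourier[OF b, of \<zeta>] by (simp only: DIM_R2)
  also have "sqrt (pi / a) ^ 2 = 4 * pi * \<rho>\<^sup>2" using \<rho> by (simp add: a_def)
  also have "sqrt (pi / b) ^ 2 = pi * r\<^sup>2" using r by (simp add: b_def)
  finally show ?thesis using r \<rho> by (simp add: a_def b_def mult_ac)
qed

lemma fourier_M1_init_measurable [measurable]: "fourier (\<lambda>X. of_real (M1_init r \<rho> X)) \<in> borel_measurable borel"
  unfolding fourier_def by (rule lborel.borel_measurable_lebesgue_integral) measurable

lemma nn_integral_prod_mult: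
  fixes f :: "'a::euclidean_space \<Rightarrow> ennreal" and g :: "'b::euclidean_space \<Rightarrow> ennreal"
  assumes [measurable]: "f \<in> borel_measurable borel" "g \<in> borel_measurable borel"
  shows "(\<integral>\<^sup>+X. f (fst X) * g (snd X) \<partial>lborel) = (\<integral>\<^sup>+x. f x \<partial>lborel) * (\<integral>\<^sup>+y. g y \<partial>lborel)"
proof -
  have "(\<integral>\<^sup>+X. f (fst X) * g (snd X) \<partial>lborel) = (\<integral>\<^sup>+x. \<integral>\<^sup>+y. f x * g y \<partial>lborel \<partial>lborel)"
    by (subst nn_integral_lborel_Pair(1)) (auto intro!: borel_measurable_times_ennreal simp: borel_prod[symmetric])
  then show ?thesis by (simp add: nn_integral_cmult nn_integral_multc)
qed

lemma nn_integral_gauss_less_top: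
  assumes "0 < a"
  shows "(\<integral>\<^sup>+(x::'a::euclidean_space). ennreal (c * exp (- (a * (norm x)\<^sup>2))) \<partial>lborel) < \<infinity>"
proof -
  have "integrable lborel (\<lambda>x::'a. c * exp (- (a * (norm x)\<^sup>2)))"
    using gauss_integrable[OF assms, where 'a='a] by simp
  then have "(\<integral>\<^sup>+(x::'a). ennreal (norm (c * exp (- (a * (norm x)\<^sup>2)))) \<partial>lborel) < \<infinity>"
    by (simp only: integrable_iff_bounded)
  then show ?thesis
    by (rule le_less_trans[rotated]) (intro nn_integral_mono ennreal_leI, simp)
qed

lemma fourier_M1_init_finite:
  assumes r: "0 < r" and \<rho>: "0 < \<rho>"
  shows "(\<integral>\<^sup>+P. ennreal (norm (fourier (\<lambda>X. of_real (M1_init r \<rho> X)) P)) \<partial>lborel) < \<infinity>"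
proof -
  let ?f = "\<lambda>\<xi>::R2. ennreal (4 * pi * \<rho>\<^sup>2 * exp (- (\<rho>\<^sup>2 * (norm \<xi>)\<^sup>2)))"
  let ?g = "\<lambda>\<zeta>::R2. ennreal (pi * r\<^sup>2 * exp (- (r\<^sup>2 / 4 * (norm \<zeta>)\<^sup>2)))"
  have "(\<integral>\<^sup>+P. ennreal (norm (fourier (\<lambda>X. of_real (M1_init r \<rho> X)) P)) \<partial>lborel)
     = (\<integral>\<^sup>+Y. ennreal (norm (fourier (\<lambda>X. of_real (M1_init r \<rho> X)) (sum_diff_map Y))) \<partial>lborel)"
    by (rule nn_integral_sum_diff_map[symmetric]) measurable
  also have "\<dots> = (\<integral>\<^sup>+Y. ?f (fst Y) * ?g (snd Y) \<partial>lborel)"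
  proof (intro nn_integral_cong)
    fix Y :: "R2 \<times> R2"
    show "ennreal (norm (fourier (\<lambda>X. of_real (M1_init r \<rho> X)) (sum_diff_map Y))) = ?f (fst Y) * ?g (snd Y)"
      by (cases Y) (simp add: fourier_M1_init[OF r \<rho>] ennreal_mult[symmetric] abs_mult norm_mult del: of_real_mult)
  qed
  also have "\<dots> = (\<integral>\<^sup>+x. ?f x \<partial>lborel) * (\<integral>\<^sup>+y. ?g y \<partial>lborel)"
    by (rule nn_integral_prod_mult) measurable
  also have "\<dots> < \<infinity>"
    using nn_integral_gauss_less_top[of "\<rho>\<^sup>2" "4 * pi * \<rho>\<^sup>2", where 'a=R2] nn_integral_gauss_less_top[of "r\<^sup>2 / 4" "pi * r\<^sup>2", where 'a=R2] r \<rho>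
    by (simp add: ennreal_mult_less_top)
  finally show ?thesis .
qed

lemma M1_symbol_measurable [measurable]: "M1_symbol c \<omega> \<omega>' \<in> borel_measurable borel"
  unfolding M1_symbol_def split_beta' divide_inverse by (intro borel_measurable_continuous_onI continuous_intros)

context covariance
begin

text \<open>Scattering transfers \<open>k\<close> from one momentum to the other, hence the shift
  \<open>(k, - k)\<close>. The kernel is majorised with \<open>\<bar>b\<bar>\<close> because
  \<open>\<omega> * \<omega>'\<close> may be negative.\<close>

lemma M1_mild_fourier_exists:
  assumes r: "0 < r" and \<rho>: "0 < \<rho>"
  shows "\<exists>m. M1_mild_fourier C c r \<rho> \<omega> \<omega>' m"
proof -
  define b where "b = 2 * \<omega> * \<omega>' / (2 * pi)\<^sup>2 / (8 * c\<^sup>2)"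
  define lam where "lam = (\<omega>\<^sup>2 + \<omega>'\<^sup>2) * C 0 / (8 * c\<^sup>2)"
  interpret V: volterra_slice "\<lambda>k::R2. (k, - k)" "\<lambda>s P k. of_real b * C_hat C k" "\<lambda>k. \<bar>b\<bar> * ch k" lam
    "\<lambda>P. - M1_symbol c \<omega> \<omega>' P" "\<lambda>P. P"
  proof
    show "(\<lambda>k::R2. (k, - k)) \<in> borel_measurable borel"
      by (intro borel_measurable_continuous_onI continuous_intros)
    show "(\<lambda>(s :: real, P :: R2 \<times> R2, k). of_real b * C_hat C k) \<in> borel_measurable (borel \<Otimes>\<^sub>M borel \<Otimes>\<^sub>M borel)"
      by measurable
    show "integrable lborel (\<lambda>k. \<bar>b\<bar> * ch k)" using ch_integrable by simp
    show "0 \<le> lam" using C0_nonneg by (simp add: lam_def)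
    show "norm (of_real b * C_hat C k) \<le> \<bar>b\<bar> * ch k" for k
      by (simp add: norm_mult C_hat_eq ch_nonneg)
    show "(\<integral>\<^sup>+P. f (P - (k, - k)) \<partial>lborel) = (\<integral>\<^sup>+P. (f P :: ennreal) \<partial>lborel)"
      if "f \<in> borel_measurable borel" for f and k :: R2
    proof -
      have "P - (k, - k) = - (k, - k) + P" for P :: "R2 \<times> R2" by simp
      then show ?thesis by (simp only: nn_integral_shift[OF that])
    qed
  qed measurable
  define I where "I = fourier (\<lambda>X. of_real (M1_init r \<rho> X))"
  have Im [measurable]: "I \<in> borel_measurable borel" unfolding I_def by measurable
  \<comment> \<open>Free evolution of the initial datum; its modulus does not depend on the
    distance, so the modulus of the datum dominates it.\<close>
  define S where "S z P = cis (z * - M1_symbol c \<omega> \<omega>' P) * I P" for z P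
  define \<sigma> where "\<sigma> P = ennreal (norm (I P))" for P
  have \<sigma>m [measurable]: "\<sigma> \<in> borel_measurable borel" unfolding \<sigma>_def[abs_def] by measurable
  have Sm: "(\<lambda>(s, P). S s P) \<in> borel_measurable (borel \<Otimes>\<^sub>M borel)" unfolding S_def by measurable
  have Sle: "ennreal (norm (S z P)) \<le> ennreal (1 + z) * \<sigma> P" if "0 \<le> z" for z P
  proof -
    have "1 * \<sigma> P \<le> ennreal (1 + z) * \<sigma> P" using that by (intro mult_right_mono) (auto simp: ennreal_plus)
    then show ?thesis by (simp add: S_def norm_mult \<sigma>_def)
  qed
  have Sc: "continuous_on {0..Z} (\<lambda>z. S z P)" for Z P unfolding S_def by (intro continuous_intros)
  have fin: "(\<integral>\<^sup>+P. \<sigma> P \<partial>lborel) < \<infinity>"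
    using fourier_M1_init_finite[OF r \<rho>] by (simp add: \<sigma>_def I_def)
  have gen: "M1_interaction C c \<omega> \<omega>' f P = V.gen s f P" for f s P
  proof (cases P)
    case (Pair p p')
    have "V.gen s f P = of_real b * (LINT k|lborel. C_hat C k * f (p - k, p' + k)) - lam *\<^sub>R f P"
      unfolding V.gen_def mult.assoc integral_mult_right_zero Pair by simp
    also have "\<dots> = M1_interaction C c \<omega> \<omega>' f P"
      by (simp add: M1_interaction_def Pair b_def lam_def scaleR_diff_right) (simp add: scaleR_conv_of_real)
    finally show ?thesis by simp
  qed
  have "M1_mild_fourier C c r \<rho> \<omega> \<omega>' (V.sol S)"
    unfolding M1_mild_fourier_def
  proof (intro conjI allI impI)
    show "L1_path (V.sol S)" by (rule V.sol_L1_path[OF \<sigma>m Sm Sle Sc fin])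
    fix z :: real assume z: "0 \<le> z"
    show "AE P in lborel. V.sol S z P = cis (- (z * M1_symbol c \<omega> \<omega>' P)) * fourier (\<lambda>X. of_real (M1_init r \<rho> X)) P
          + (LINT s:{0..z}|lborel. cis (- ((z - s) * M1_symbol c \<omega> \<omega>' P)) * M1_interaction C c \<omega> \<omega>' (V.sol S s) P)"
      using V.AE_W_finite[OF \<sigma>m fin]
    proof eventually_elim
      case (elim P)
      show ?case
        using V.sol_eq[OF \<sigma>m Sm Sle z, of P] elim z by (simp add: S_def[of z P] I_def gen[symmetric])
    qed
  qed
  then show ?thesis by blast
qed

text \<open>\<open>M1\<close> is a choice and has properties only once a candidate exists; the
  inverse Fourier transform of a mild solution is one.\<close>

lemma M1_fourier:
  assumes r: "0 < r" and \<rho>: "0 < \<rho>"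
  shows "\<exists>m. M1_mild_fourier C c r \<rho> \<omega> \<omega>' m \<and> (\<forall>z\<ge>0. has_L1_fourier (\<lambda>(x, y). M1 C c r \<rho> \<omega> \<omega>' z x y) (m z))"
proof -
  obtain m where m: "M1_mild_fourier C c r \<rho> \<omega> \<omega>' m" using M1_mild_fourier_exists[OF r \<rho>] by blast
  have "is_M1 C c r \<rho> \<omega> \<omega>' (\<lambda>z x y. (1 / (2 * pi) ^ DIM(R2 \<times> R2)) *\<^sub>R (LINT k|lborel. m z k * cis (k \<bullet> (x, y))))"
    unfolding is_M1_def has_L1_fourier_def
    using m by (intro exI[of _ m]) (auto simp: M1_mild_fourier_def L1_path_def)
  then have "\<exists>M. is_M1 C c r \<rho> \<omega> \<omega>' M" by blast
  then have "is_M1 C c r \<rho> \<omega> \<omega>' (M1 C c r \<rho> \<omega> \<omega>')" unfolding M1_def by (rule someI_ex)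
  then show ?thesis unfolding is_M1_def by blast
qed

end

text \<open>Resolves both choice operators: \<open>M1\<close> through existence of a mild solution,
  \<open>L1_fourier\<close> through uniqueness of the L^1 representative. One path \<open>m\<close>
  serves all distances, and only the null set may depend on \<open>z\<close>.\<close>

lemma M1_hat_eq:
  assumes C: "covariance_function C" and e: "0 < \<epsilon>" and r: "0 < r" and \<rho>: "0 < \<rho>"
  shows "\<exists>m. M1_mild_fourier (\<lambda>x. \<epsilon> * C x) c (r / \<epsilon>) (\<rho> / \<epsilon>) (\<omega> + \<epsilon> * Om) (\<omega> - \<epsilon> * Om) m \<and>
    (\<forall>z\<ge>0. integrable lborel (\<lambda>Q. M1_hat C c r \<rho> \<omega> Om \<epsilon> z (fst Q) (snd Q)) \<and>
       (AE Q in lborel. M1_hat C c r \<rho> \<omega> Om \<epsilon> z (fst Q) (snd Q) = m z (sum_diff_map Q)))"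
proof -
  interpret covariance "\<lambda>x. \<epsilon> * C x" by unfold_locales (rule covariance_function_scale[OF C e])
  obtain m where m: "M1_mild_fourier (\<lambda>x. \<epsilon> * C x) c (r / \<epsilon>) (\<rho> / \<epsilon>) (\<omega> + \<epsilon> * Om) (\<omega> - \<epsilon> * Om) m"
    and M: "\<And>z. 0 \<le> z \<Longrightarrow> has_L1_fourier (\<lambda>(x, y). M1 (\<lambda>x. \<epsilon> * C x) c (r / \<epsilon>) (\<rho> / \<epsilon>) (\<omega> + \<epsilon> * Om) (\<omega> - \<epsilon> * Om) z x y) (m z)"
    using M1_fourier[of "r / \<epsilon>" "\<rho> / \<epsilon>" c "\<omega> + \<epsilon> * Om" "\<omega> - \<epsilon> * Om"] r \<rho> e by auto
  show ?thesis
  proof (intro exI[of _ m] conjI allI impI m)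
    fix z :: real assume z: "0 \<le> z"
    let ?f = "\<lambda>(q, r'). M1_eps C c r \<rho> \<omega> Om \<epsilon> z q r'"
    have int: "integrable lborel (m z)" using M[OF z] by (simp add: has_L1_fourier_def)
    then have [measurable]: "m z \<in> borel_measurable borel" by auto
    have "integrable (distr lborel borel sum_diff_map) (m z)" unfolding distr_sum_diff_map by (rule int)
    then have int': "integrable lborel (\<lambda>Q. m z (sum_diff_map Q))"
      by (subst (asm) integrable_distr_eq) auto
    have 1: "has_L1_fourier ?f (\<lambda>Q. m z (sum_diff_map Q))"
      unfolding has_L1_fourier_def
    proof (intro conjI allI int')
      fix X :: "R2 \<times> R2"
      obtain q x where X: "X = (q, x)" by (cases X)
      have "?f X = (1 / (2 * pi) ^ DIM(R2 \<times> R2)) *\<^sub>R (LINT k|lborel. m z k * cis (k \<bullet> mid_diff_map X))"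
        using M[OF z] unfolding has_L1_fourier_def X by (auto simp: M1_eps_def mid_diff_map_def)
      also have "(LINT k|lborel. m z k * cis (k \<bullet> mid_diff_map X)) = (LINT Q|lborel. m z (sum_diff_map Q) * cis (sum_diff_map Q \<bullet> mid_diff_map X))"
        by (rule lint_distr_lborel[OF distr_sum_diff_map, symmetric]) measurable
      also have "\<dots> = (LINT Q|lborel. m z (sum_diff_map Q) * cis (Q \<bullet> X))"
        by (simp only: inner_sum_diff_mid_diff')
      finally show "?f X = (1 / (2 * pi) ^ DIM(R2 \<times> R2)) *\<^sub>R (LINT Q|lborel. m z (sum_diff_map Q) * cis (Q \<bullet> X))" .
    qed
    then have "\<exists>g. has_L1_fourier ?f g" by blast
    then have 2: "has_L1_fourier ?f (L1_fourier ?f)" unfolding L1_fourier_def by (rule someI_ex)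
    from has_L1_fourier_unique[OF 2 1] 2[unfolded has_L1_fourier_def, THEN conjunct1]
    show "integrable lborel (\<lambda>Q. M1_hat C c r \<rho> \<omega> Om \<epsilon> z (fst Q) (snd Q))"
      "AE Q in lborel. M1_hat C c r \<rho> \<omega> Om \<epsilon> z (fst Q) (snd Q) = m z (sum_diff_map Q)"
      by (simp_all add: M1_hat_def)
  qed
qed

section \<open>The equation for \<open>A\<close>\<close>

text \<open>A null set of first components lifts to a null cylinder; this fits majorants that do not
  depend on the second component.\<close>

lemma AE_lborel_fst:
  assumes "AE x in (lborel :: 'a::euclidean_space measure). X x"
  shows "AE P in (lborel :: ('a \<times> 'b::euclidean_space) measure). X (fst P)"
proof -
  obtain N where N: "{x \<in> space lborel. \<not> X x} \<subseteq> N" "emeasure lborel N = 0" "N \<in> sets lborel"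
    using assms by (rule AE_E)
  then have "N \<times> (UNIV :: 'b set) \<in> null_sets (lborel \<Otimes>\<^sub>M lborel)"
    by (intro lborel.times_in_null_sets1) auto
  then have "N \<times> (UNIV :: 'b set) \<in> null_sets lborel" by (simp only: lborel_prod)
  then show ?thesis using N(1) by (intro AE_I'[of "N \<times> UNIV"]) auto
qed

locale scint = covariance C for C +
  fixes c w Om :: real
  assumes c_pos: "0 < c" and w_pos: "0 < w"
begin

definition kap :: real where "kap = w\<^sup>2 / (4 * (2 * pi)\<^sup>2 * c\<^sup>2)"

definition lam :: real where "lam = w\<^sup>2 / (4 * c\<^sup>2) * C 0"

definition theta0 :: "R2 \<times> R2 \<Rightarrow> real" where "theta0 P = c * Om / w\<^sup>2 * (norm (fst P))\<^sup>2"

definition HA :: "real \<Rightarrow> R2 \<times> R2 \<Rightarrow> R2 \<Rightarrow> complex" where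
  "HA s P k = of_real kap * C_hat C k * cis (c * s / w * (k \<bullet> snd P))"

text \<open>Source of the equation for \<open>A\<close>: one scattering out of the part of the beam
  that is still unscattered at distance \<open>s\<close>.\<close>

definition QA :: "real \<Rightarrow> R2 \<times> R2 \<Rightarrow> complex" where
  "QA s P = (kap * K C c w s) *\<^sub>R (C_hat C (fst P) * cis (c * s / w * (fst P \<bullet> snd P)))"

text \<open>\<open>K\<close> is largest at distance 0. The bound ignores the second component, so
  all that is built from it is uniform in \<open>\<zeta>\<close>.\<close>

definition sigA :: "R2 \<times> R2 \<Rightarrow> ennreal" where
  "sigA P = ennreal (kap * K C c w 0 * ch (fst P))"

lemma kap_pos: "0 < kap"
  using c_pos w_pos by (simp add: kap_def)

text \<open>Balance of gain and loss: the term \<open>- A(\<xi>)\<close> under the scattering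
  integral acts as multiplication by \<open>- lam\<close>, and \<open>K\<close> decays at the same
  rate.\<close>

lemma lam_eq: "lam = kap * (LINT k|lborel. ch k)"
  by (simp add: lam_def kap_def ch_integral power_mult_distrib)

lemma lam_nonneg: "0 \<le> lam"
  using C0_nonneg by (simp add: lam_def)

lemma K_eq: "K C c w z = (2 * pi) ^ 4 * exp (- (lam * z))"
  by (simp add: K_def lam_def)

lemma K_nonneg: "0 \<le> K C c w z"
  by (simp add: K_eq)

lemma K_le: "0 \<le> z \<Longrightarrow> K C c w z \<le> K C c w 0"
  using lam_nonneg by (simp add: K_eq)

lemma K_measurable [measurable]: "K C c w \<in> borel_measurable borel"
  unfolding K_eq[abs_def] by measurable

lemma fst_R2_measurable [measurable]: "fst \<in> borel_measurable (borel :: (R2 \<times> R2) measure)"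
  by (intro borel_measurable_continuous_onI continuous_intros)

lemma snd_R2_measurable [measurable]: "snd \<in> borel_measurable (borel :: (R2 \<times> R2) measure)"
  by (intro borel_measurable_continuous_onI continuous_intros)

lemma Pair_R2_measurable [measurable]: "(\<lambda>\<xi>::R2. (\<xi>, \<zeta>::R2)) \<in> borel_measurable borel"
  by (intro borel_measurable_continuous_onI continuous_intros)

text \<open>\<open>A\<close> is treated as a function of \<open>(\<xi>, \<zeta>)\<close>; the shift
  \<open>(k, 0)\<close> leaves the second component frozen.\<close>

sublocale VA: volterra "\<lambda>k::R2. (k, 0::R2)" HA "\<lambda>k. kap * ch k" lam theta0
proof
  show "(\<lambda>(s, P, k). HA s P k) \<in> borel_measurable (borel \<Otimes>\<^sub>M borel \<Otimes>\<^sub>M borel)"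
    unfolding HA_def by measurable
  show "norm (HA s P k) \<le> kap * ch k" for s P k
    using kap_pos ch_nonneg by (simp add: HA_def norm_mult C_hat_eq)
  show "integrable lborel (\<lambda>k. kap * ch k)" using ch_integrable by simp
  show "theta0 \<in> borel_measurable borel" unfolding theta0_def by measurable
qed (rule lam_nonneg Pair_R2_measurable)+

lemma slice: "volterra_slice (\<lambda>k::R2. (k, 0::R2)) HA (\<lambda>k. kap * ch k) lam theta0 (\<lambda>\<xi>. (\<xi>, \<zeta>))"
proof (unfold_locales, goal_cases)
  case (2 f k)
  then have [measurable]: "(\<lambda>\<xi>. f (\<xi>, \<zeta>)) \<in> borel_measurable borel" by measurable
  show ?case using nn_integral_shift[of "\<lambda>\<xi>. f (\<xi>, \<zeta>)" "- k"] by simp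
qed measurable

lemma QA_measurable: "(\<lambda>(s, P). QA s P) \<in> borel_measurable (borel \<Otimes>\<^sub>M borel)"
  unfolding QA_def by measurable

lemma norm_QA_le: "0 \<le> s \<Longrightarrow> norm (QA s P) \<le> kap * K C c w 0 * ch (fst P)"
  using kap_pos K_nonneg K_le ch_nonneg
  by (simp add: QA_def norm_mult C_hat_eq mult_right_mono)

lemma sigA_measurable [measurable]: "sigA \<in> borel_measurable borel"
  unfolding sigA_def[abs_def] by measurable

lemma src_QA_le: "0 \<le> z \<Longrightarrow> ennreal (norm (VA.src QA z P)) \<le> ennreal (1 + z) * sigA P"
  unfolding sigA_def by (rule VA.norm_src_le) (auto intro: ennreal_leI norm_QA_le)

lemma src_QA_measurable: "(\<lambda>(s, P). VA.src QA s P) \<in> borel_measurable (borel \<Otimes>\<^sub>M borel)"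
  by (rule VA.src_measurable[OF QA_measurable])

lemma src_QA_continuous: "continuous_on {0..Z} (\<lambda>z. VA.src QA z P)"
  by (rule VA.src_continuous[OF QA_measurable norm_QA_le])

lemma sigA_finite: "(\<integral>\<^sup>+\<xi>. sigA (\<xi>, \<zeta>) \<partial>lborel) < \<infinity>"
proof -
  have "integrable lborel (\<lambda>\<xi>. kap * K C c w 0 * ch \<xi>)" using ch_integrable by simp
  then have "(\<integral>\<^sup>+\<xi>. ennreal (norm (kap * K C c w 0 * ch \<xi>)) \<partial>lborel) < \<infinity>"
    by (simp only: integrable_iff_bounded)
  then show ?thesis using kap_pos K_nonneg ch_nonneg by (simp add: sigA_def abs_mult)
qed

text \<open>One solution on the product space instead of one for each \<open>\<zeta>\<close>: this
  provides the joint measurability in \<open>(\<xi>, \<zeta>)\<close> that the L^1 norm of the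
  remainder presupposes.\<close>

definition AA :: "real \<Rightarrow> R2 \<times> R2 \<Rightarrow> complex" where "AA = VA.sol (VA.src QA)"

lemma AA_measurable: "(\<lambda>(s, P). AA s P) \<in> borel_measurable (borel \<Otimes>\<^sub>M borel)"
  unfolding AA_def by (rule VA.sol_measurable[OF src_QA_measurable])

lemma norm_AA_le: "0 \<le> s \<Longrightarrow> s \<le> z \<Longrightarrow> ennreal (norm (AA s P)) \<le> ennreal (1 + z) * VA.W sigA z P"
  unfolding AA_def by (rule VA.norm_sol_le[OF sigA_measurable src_QA_le])

lemma AA_eq:
  assumes "0 \<le> z" "VA.W sigA z P < \<infinity>" "VA.dom (VA.W sigA z) P < \<infinity>"
  shows "AA z P = VA.src QA z P + (LINT s:{0..z}|lborel. cis ((z - s) * theta0 P) * VA.gen s (AA s) P)"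
  unfolding AA_def by (rule VA.sol_eq[OF sigA_measurable src_QA_measurable src_QA_le assms])

lemma AA_dom_finite:
  assumes "VA.dom (VA.W sigA z) P < \<infinity>"
  shows "(\<integral>\<^sup>+s\<in>{0..z}. VA.dom (\<lambda>Q. ennreal (norm (AA s Q))) P \<partial>lborel) < \<infinity>"
proof -
  have "(\<integral>\<^sup>+s\<in>{0..z}. VA.dom (\<lambda>Q. ennreal (norm (AA s Q))) P \<partial>lborel)
     \<le> (\<integral>\<^sup>+s\<in>{0..z}. VA.dom (\<lambda>Q. ennreal (1 + z) * VA.W sigA z Q) P \<partial>lborel)"
    by (intro nn_integral_mono) (auto split: split_indicator simp del: ennreal_plus intro!: VA.dom_mono norm_AA_le)
  also have "\<dots> < \<infinity>"
    by (rule nn_integral_const_Icc_less_top) (use assms in \<open>simp add: VA.dom_cmult ennreal_mult_less_top\<close>)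
  finally show ?thesis .
qed

lemma C_hat_mult_integrable:
  assumes [measurable]: "u \<in> borel_measurable borel"
    and fin: "VA.dom (\<lambda>Q. ennreal (norm (u Q))) (\<xi>, \<zeta>) < \<infinity>"
  shows "integrable lborel (\<lambda>k. C_hat C k * (u (\<xi> - k, \<zeta>) * cis (c * s / w * (k \<bullet> \<zeta>))))"
    and "ennreal (kap * norm (LINT k|lborel. C_hat C k * (u (\<xi> - k, \<zeta>) * cis (c * s / w * (k \<bullet> \<zeta>)))) + lam * norm (u (\<xi>, \<zeta>)))
      \<le> VA.dom (\<lambda>Q. ennreal (norm (u Q))) (\<xi>, \<zeta>)"
proof -
  let ?f = "\<lambda>k. C_hat C k * (u (\<xi> - k, \<zeta>) * cis (c * s / w * (k \<bullet> \<zeta>)))"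
  have m [measurable]: "(\<lambda>k. u (\<xi> - k, \<zeta>)) \<in> borel_measurable borel"
    by (rule measurable_compose[OF _ assms(1)]) (intro borel_measurable_continuous_onI continuous_intros)
  have eq: "ennreal kap * (\<integral>\<^sup>+k. ennreal (norm (?f k)) \<partial>lborel) = (\<integral>\<^sup>+k. ennreal (kap * ch k) * ennreal (norm (u (\<xi> - k, \<zeta>))) \<partial>lborel)"
    using kap_pos ch_nonneg
    by (subst nn_integral_cmult[symmetric]) (auto intro!: nn_integral_cong simp: norm_mult C_hat_eq ennreal_mult mult.assoc)
  show "integrable lborel ?f"
  proof (rule integrableI_bounded)
    have "ennreal kap * (\<integral>\<^sup>+k. ennreal (norm (?f k)) \<partial>lborel) \<le> VA.dom (\<lambda>Q. ennreal (norm (u Q))) (\<xi>, \<zeta>)"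
      unfolding VA.dom_def eq by (simp add: add_increasing2)
    then have "ennreal kap * (\<integral>\<^sup>+k. ennreal (norm (?f k)) \<partial>lborel) < \<infinity>" using fin by (rule le_less_trans)
    then show "(\<integral>\<^sup>+k. ennreal (norm (?f k)) \<partial>lborel) < \<infinity>"
      using kap_pos by (auto simp: ennreal_mult_less_top)
  qed measurable
  have "ennreal (kap * norm (LINT k|lborel. ?f k) + lam * norm (u (\<xi>, \<zeta>)))
     = ennreal kap * ennreal (norm (LINT k|lborel. ?f k)) + ennreal lam * ennreal (norm (u (\<xi>, \<zeta>)))"
    using kap_pos lam_nonneg by (simp add: ennreal_mult)
  also have "\<dots> \<le> ennreal kap * (\<integral>\<^sup>+k. ennreal (norm (?f k)) \<partial>lborel) + ennreal lam * ennreal (norm (u (\<xi>, \<zeta>)))"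
    by (intro add_right_mono mult_left_mono norm_lint_le) simp
  also have "\<dots> = VA.dom (\<lambda>Q. ennreal (norm (u Q))) (\<xi>, \<zeta>)" unfolding eq VA.dom_def by simp
  finally show "ennreal (kap * norm (LINT k|lborel. ?f k) + lam * norm (u (\<xi>, \<zeta>))) \<le> VA.dom (\<lambda>Q. ennreal (norm (u Q))) (\<xi>, \<zeta>)" .
qed

text \<open>Where the convolution converges, the difference under the integral in
  \<open>A_rhs\<close> may be split; the subtracted part is then evaluated by
  \<open>lam_eq\<close>.\<close>

lemma A_rhs_eq:
  assumes [measurable]: "u \<in> borel_measurable borel"
    and fin: "VA.dom (\<lambda>Q. ennreal (norm (u Q))) (\<xi>, \<zeta>) < \<infinity>"
  shows "A_rhs C c w \<zeta> s (\<lambda>\<xi>. u (\<xi>, \<zeta>)) \<xi> = VA.gen s u (\<xi>, \<zeta>) + QA s (\<xi>, \<zeta>)"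
proof -
  let ?f = "\<lambda>k. C_hat C k * (u (\<xi> - k, \<zeta>) * cis (c * s / w * (k \<bullet> \<zeta>)))"
  note int = C_hat_mult_integrable(1)[OF assms]
  have "(LINT k|lborel. C_hat C k * (u (\<xi> - k, \<zeta>) * cis (c * s / w * (k \<bullet> \<zeta>)) - u (\<xi>, \<zeta>)))
      = (LINT k|lborel. ?f k) - (LINT k|lborel. C_hat C k * u (\<xi>, \<zeta>))"
    unfolding right_diff_distrib
    by (rule Bochner_Integration.integral_diff[OF int]) (use C_hat_integrable in simp)
  also have "(LINT k|lborel. C_hat C k * u (\<xi>, \<zeta>)) = of_real (LINT k|lborel. ch k) * u (\<xi>, \<zeta>)"
    by (simp add: C_hat_eq)
  finally have "kap *\<^sub>R (LINT k|lborel. C_hat C k * (u (\<xi> - k, \<zeta>) * cis (c * s / w * (k \<bullet> \<zeta>)) - u (\<xi>, \<zeta>)))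
      = kap *\<^sub>R (LINT k|lborel. ?f k) - lam *\<^sub>R u (\<xi>, \<zeta>)"
    by (simp add: lam_eq scaleR_conv_of_real right_diff_distrib mult.assoc)
  moreover have "kap *\<^sub>R (LINT k|lborel. ?f k) = (LINT k|lborel. HA s (\<xi>, \<zeta>) k * u ((\<xi>, \<zeta>) - (k, 0)))"
  proof -
    have "(LINT k|lborel. HA s (\<xi>, \<zeta>) k * u ((\<xi>, \<zeta>) - (k, 0))) = (LINT k|lborel. of_real kap * ?f k)"
      by (intro Bochner_Integration.integral_cong refl) (simp add: HA_def)
    then show ?thesis by (simp only: integral_mult_right_zero scaleR_conv_of_real)
  qed
  ultimately show ?thesis
    unfolding A_rhs_def VA.gen_def QA_def kap_def[symmetric] by simp
qed

lemma A_rhs_integral_eq: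
  assumes u: "(\<lambda>(s, P). u s P) \<in> borel_measurable (borel \<Otimes>\<^sub>M borel)"
    and fin: "(\<integral>\<^sup>+s\<in>{0..z}. VA.dom (\<lambda>Q. ennreal (norm (u s Q))) (\<xi>, \<zeta>) \<partial>lborel) < \<infinity>"
  shows "(LINT s:{0..z}|lborel. cis ((z - s) * (c * Om / w\<^sup>2 * (norm \<xi>)\<^sup>2)) * A_rhs C c w \<zeta> s (\<lambda>\<xi>. u s (\<xi>, \<zeta>)) \<xi>)
    = VA.src QA z (\<xi>, \<zeta>) + (LINT s:{0..z}|lborel. cis ((z - s) * theta0 (\<xi>, \<zeta>)) * VA.gen s (u s) (\<xi>, \<zeta>))"
proof -
  have um [measurable]: "u s \<in> borel_measurable borel" for s by (rule VA.section_measurable[OF u])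
  have u': "(\<lambda>(s, P). ennreal (norm (u s P))) \<in> borel_measurable (borel \<Otimes>\<^sub>M borel)"
    using u by (simp add: split_beta')
  let ?P = "(\<xi>, \<zeta>)"
  have gm [measurable]: "(\<lambda>s. VA.gen s (u s) ?P) \<in> borel_measurable borel" by (rule VA.gen_measurable[OF u]) auto
  have qm [measurable]: "(\<lambda>s. QA s ?P) \<in> borel_measurable borel" by (rule VA.uncurry_measurable[OF QA_measurable]) auto
  have eq: "AE s in lborel. s \<in> {0..z} \<longrightarrow>
     A_rhs C c w \<zeta> s (\<lambda>\<xi>. u s (\<xi>, \<zeta>)) \<xi> = VA.gen s (u s) ?P + QA s ?P"
    using VA.AE_dom_path_finite[OF u' fin] by eventually_elim (auto intro: A_rhs_eq[OF um])
  have meas: "(\<lambda>s. A_rhs C c w \<zeta> s (\<lambda>\<xi>. u s (\<xi>, \<zeta>)) \<xi>) \<in> borel_measurable borel"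
  proof -
    have [measurable]: "(\<lambda>x. u (fst x) (\<xi> - snd x, \<zeta>)) \<in> borel_measurable (borel \<Otimes>\<^sub>M lborel)"
      by (rule VA.uncurry_measurable[OF u]) measurable
    have [measurable]: "(\<lambda>x. u (fst x) (\<xi>, \<zeta>)) \<in> borel_measurable (borel \<Otimes>\<^sub>M lborel)"
      by (rule VA.uncurry_measurable[OF u]) measurable
    have "(\<lambda>s. LINT k|lborel. C_hat C k * (u s (\<xi> - k, \<zeta>) * cis (c * s / w * (k \<bullet> \<zeta>)) - u s (\<xi>, \<zeta>))) \<in> borel_measurable borel"
      by (rule lborel.borel_measurable_lebesgue_integral) (simp only: split_beta', measurable)
    then show ?thesis unfolding A_rhs_def by measurable
  qed
  have "(LINT s:{0..z}|lborel. cis ((z - s) * (c * Om / w\<^sup>2 * (norm \<xi>)\<^sup>2)) * A_rhs C c w \<zeta> s (\<lambda>\<xi>. u s (\<xi>, \<zeta>)) \<xi>)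
     = (LINT s:{0..z}|lborel. cis ((z - s) * theta0 ?P) * QA s ?P + cis ((z - s) * theta0 ?P) * VA.gen s (u s) ?P)"
    unfolding set_lebesgue_integral_def
  proof (rule integral_cong_AE)
    show "AE s in lborel. indicator {0..z} s *\<^sub>R (cis ((z - s) * (c * Om / w\<^sup>2 * (norm \<xi>)\<^sup>2)) * A_rhs C c w \<zeta> s (\<lambda>\<xi>. u s (\<xi>, \<zeta>)) \<xi>)
       = indicator {0..z} s *\<^sub>R (cis ((z - s) * theta0 ?P) * QA s ?P + cis ((z - s) * theta0 ?P) * VA.gen s (u s) ?P)"
      using eq by eventually_elim (simp add: theta0_def distrib_left add.commute split: split_indicator)
  qed (use meas in measurable)
  also have "\<dots> = VA.src QA z ?P + (LINT s:{0..z}|lborel. cis ((z - s) * theta0 ?P) * VA.gen s (u s) ?P)"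
    unfolding VA.src_def
    by (rule set_integral_add(2)[OF VA.src_set_integrable[OF QA_measurable norm_QA_le] VA.gen_set_integrable[OF u fin]])
  finally show ?thesis .
qed

lemma AE_W_sigA_finite: "AE \<xi> in lborel. \<forall>z\<ge>0. VA.W sigA z (\<xi>, \<zeta>) < \<infinity> \<and> VA.dom (VA.W sigA z) (\<xi>, \<zeta>) < \<infinity>"
  by (rule volterra_slice.AE_W_finite[OF slice sigA_measurable sigA_finite])

lemma A_mild_AA: "A_mild C c w \<zeta> Om (\<lambda>z \<xi>. AA z (\<xi>, \<zeta>))"
  unfolding A_mild_def
proof (intro conjI allI impI)
  show "L1_path (\<lambda>z \<xi>. AA z (\<xi>, \<zeta>))"
    unfolding AA_def
    by (rule volterra_slice.sol_L1_path[OF slice sigA_measurable src_QA_measurable src_QA_le src_QA_continuous sigA_finite])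
  fix z :: real assume z: "0 \<le> z"
  show "AE \<xi> in lborel. AA z (\<xi>, \<zeta>) = (LINT s:{0..z}|lborel. cis ((z - s) * (c * Om / w\<^sup>2 * (norm \<xi>)\<^sup>2)) *
      A_rhs C c w \<zeta> s (\<lambda>\<xi>. AA s (\<xi>, \<zeta>)) \<xi>)"
    using AE_W_sigA_finite[of \<zeta>]
  proof eventually_elim
    case (elim \<xi>)
    then have f: "VA.W sigA z (\<xi>, \<zeta>) < \<infinity>" "VA.dom (VA.W sigA z) (\<xi>, \<zeta>) < \<infinity>" using z by auto
    show ?case
      unfolding A_rhs_integral_eq[OF AA_measurable AA_dom_finite[OF f(2)]] by (rule AA_eq[OF z f])
  qed
qed

text \<open>The difference of two solutions satisfies the Volterra inequality with source 0, so
  Gronwall's inequality forces its L^1 norm to vanish.\<close>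

lemma A_mild_unique:
  assumes a: "A_mild C c w \<zeta> Om a" and z: "0 \<le> z"
  shows "AE \<xi> in lborel. a z \<xi> = AA z (\<xi>, \<zeta>)"
proof -
  interpret S: volterra_slice "\<lambda>k::R2. (k, 0::R2)" HA "\<lambda>k. kap * ch k" lam theta0 "\<lambda>\<xi>. (\<xi>, \<zeta>)" by (rule slice)
  have path: "L1_path a" using a by (simp add: A_mild_def)
  \<comment> \<open>Lifts \<open>a\<close> to the product space as a function constant in the second
    component, and cuts off negative distances, where \<open>a\<close> is arbitrary.\<close>
  define u where "u s P = indicator {0..} s *\<^sub>R a s (fst P)" for s and P :: "R2 \<times> R2"
  have u: "(\<lambda>(s, P). u s P) \<in> borel_measurable (borel \<Otimes>\<^sub>M borel)"
  proof -
    have "(\<lambda>x::real \<times> R2 \<times> R2. (fst x, fst (snd x))) \<in> borel \<Otimes>\<^sub>M borel \<rightarrow>\<^sub>M borel \<Otimes>\<^sub>M borel"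
      by (intro measurable_Pair measurable_compose[OF measurable_snd fst_R2_measurable] measurable_fst)
    from measurable_compose[OF this L1_path_measurable[OF path]] show ?thesis
      by (simp add: u_def split_beta')
  qed
  have u_eq: "u s (\<xi>, \<zeta>') = a s \<xi>" if "0 \<le> s" for s \<xi> \<zeta>' using that by (simp add: u_def)
  obtain B1 where B1: "\<forall>s\<in>{0..z}. (\<integral>\<^sup>+\<xi>. ennreal (norm (a s \<xi>)) \<partial>lborel) \<le> ennreal B1"
    using L1_path_bounded[OF path] by blast
  have "L1_path (\<lambda>z \<xi>. AA z (\<xi>, \<zeta>))" using A_mild_AA by (simp add: A_mild_def)
  then obtain B2 where B2: "\<forall>s\<in>{0..z}. (\<integral>\<^sup>+\<xi>. ennreal (norm (AA s (\<xi>, \<zeta>))) \<partial>lborel) \<le> ennreal B2"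
    using L1_path_bounded by blast
  have u_ae: "AE \<xi> in lborel. (\<integral>\<^sup>+s\<in>{0..y}. VA.dom (\<lambda>Q. ennreal (norm (u s Q))) (\<xi>, \<zeta>) \<partial>lborel) < \<infinity>"
    if y: "0 \<le> y" "y \<le> z" for y
    by (rule S.AE_path_dom_finite[where B="ennreal B1"]) (use u B1 y in \<open>auto simp: u_eq split_beta'\<close>)
  let ?D = "\<lambda>s Q. ennreal (norm (u s Q - AA s Q))"
  have "(\<integral>\<^sup>+\<xi>. ?D z (\<xi>, \<zeta>) \<partial>lborel) \<le> 2 * (\<integral>\<^sup>+(\<xi>::R2). 0 \<partial>lborel) * ennreal (exp (2 * (S.L + 1) * z))"
  proof (rule S.path_gronwall[where B="ennreal B1 + ennreal B2"])
    show "(\<lambda>(s, P). ?D s P) \<in> borel_measurable (borel \<Otimes>\<^sub>M borel)"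
      using u AA_measurable by (simp add: split_beta')
    fix y assume y: "0 \<le> y" "y \<le> z"
    note um [measurable] = measurable_compose[OF Pair_R2_measurable VA.section_measurable[OF u], of y \<zeta>]
    note am [measurable] = measurable_compose[OF Pair_R2_measurable VA.section_measurable[OF AA_measurable], of y \<zeta>]
    have "(\<integral>\<^sup>+\<xi>. ?D y (\<xi>, \<zeta>) \<partial>lborel) \<le> (\<integral>\<^sup>+\<xi>. ennreal (norm (u y (\<xi>, \<zeta>))) + ennreal (norm (AA y (\<xi>, \<zeta>))) \<partial>lborel)"
      by (intro nn_integral_mono) (simp add: ennreal_plus[symmetric] norm_triangle_ineq4 del: ennreal_plus)
    also have "\<dots> = (\<integral>\<^sup>+\<xi>. ennreal (norm (u y (\<xi>, \<zeta>))) \<partial>lborel) + (\<integral>\<^sup>+\<xi>. ennreal (norm (AA y (\<xi>, \<zeta>))) \<partial>lborel)"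
      by (rule nn_integral_add) measurable
    also have "\<dots> \<le> ennreal B1 + ennreal B2" using B1 B2 y by (intro add_mono) (auto simp: u_eq)
    finally show "(\<integral>\<^sup>+\<xi>. ?D y (\<xi>, \<zeta>) \<partial>lborel) \<le> ennreal B1 + ennreal B2" .
    have "AE \<xi> in lborel. a y \<xi> = (LINT s:{0..y}|lborel. cis ((y - s) * (c * Om / w\<^sup>2 * (norm \<xi>)\<^sup>2)) * A_rhs C c w \<zeta> s (a s) \<xi>)"
      using a y by (simp add: A_mild_def)
    then show "AE \<xi> in lborel. ?D y (\<xi>, \<zeta>) \<le> 0 + (\<integral>\<^sup>+s\<in>{0..y}. VA.dom (?D s) (\<xi>, \<zeta>) \<partial>lborel)"
      using u_ae[OF y] AE_W_sigA_finite[of \<zeta>]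
    proof eventually_elim
      case (elim \<xi>)
      then have f: "VA.W sigA y (\<xi>, \<zeta>) < \<infinity>" "VA.dom (VA.W sigA y) (\<xi>, \<zeta>) < \<infinity>" using y by auto
      have "u y (\<xi>, \<zeta>) = (LINT s:{0..y}|lborel. cis ((y - s) * (c * Om / w\<^sup>2 * (norm \<xi>)\<^sup>2)) * A_rhs C c w \<zeta> s (\<lambda>\<xi>. u s (\<xi>, \<zeta>)) \<xi>)"
        unfolding u_eq[OF y(1)] elim(1)
        by (intro set_lebesgue_integral_cong) (auto simp: u_eq)
      then have "u y (\<xi>, \<zeta>) - AA y (\<xi>, \<zeta>)
        = (LINT s:{0..y}|lborel. cis ((y - s) * theta0 (\<xi>, \<zeta>)) * VA.gen s (u s) (\<xi>, \<zeta>))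
        - (LINT s:{0..y}|lborel. cis ((y - s) * theta0 (\<xi>, \<zeta>)) * VA.gen s (AA s) (\<xi>, \<zeta>))"
        using A_rhs_integral_eq[OF u elim(2)] AA_eq[OF y(1) f] by simp
      then show ?case
        using VA.gen_integral_diff_le[OF u AA_measurable elim(2) AA_dom_finite[OF f(2)]] by simp
    qed
  qed (use z in auto)
  then have "(\<integral>\<^sup>+\<xi>. ?D z (\<xi>, \<zeta>) \<partial>lborel) = 0" by simp
  moreover have "(\<lambda>\<xi>. ?D z (\<xi>, \<zeta>)) \<in> borel_measurable lborel"
  proof -
    note um [measurable] = measurable_compose[OF Pair_R2_measurable VA.section_measurable[OF u], of z \<zeta>]
    note am [measurable] = measurable_compose[OF Pair_R2_measurable VA.section_measurable[OF AA_measurable], of z \<zeta>]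
    show ?thesis by measurable
  qed
  ultimately have "AE \<xi> in lborel. ?D z (\<xi>, \<zeta>) = 0" by (simp add: nn_integral_0_iff_AE)
  then show ?thesis by eventually_elim (simp add: u_eq z)
qed

text \<open>Neither \<open>sigA\<close> nor the shift involves the second component. Hence one
  majorant, and one null set of \<open>\<xi>\<close>, serves all \<open>\<zeta>\<close> at
  once.\<close>

lemma dom_power_sigA: "(VA.dom ^^ n) sigA (\<xi>, \<zeta>) = (VA.dom ^^ n) sigA (\<xi>, 0)"
proof (induction n arbitrary: \<xi>)
  case (Suc n)
  then show ?case by (simp add: VA.dom_def)
qed (simp add: sigA_def)

lemma W_sigA: "VA.W sigA z (\<xi>, \<zeta>) = VA.W sigA z (\<xi>, 0)"
  unfolding VA.W_def by (simp only: dom_power_sigA[of _ _ \<zeta>])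

lemma dom_W_sigA: "VA.dom (VA.W sigA z) (\<xi>, \<zeta>) = VA.dom (VA.W sigA z) (\<xi>, 0)"
  unfolding VA.dom_def by (simp add: W_sigA[of z _ \<zeta>])

end

section \<open>The error terms\<close>

lemma nn_integral_dominated_within:
  fixes f :: "real \<Rightarrow> 'a \<Rightarrow> ennreal"
  assumes "\<And>s. s \<in> S \<Longrightarrow> f s \<in> borel_measurable M"
    and w: "w \<in> borel_measurable M" "(\<integral>\<^sup>+x. w x \<partial>M) < \<infinity>"
    and lim: "AE x in M. ((\<lambda>s. f s x) \<longlongrightarrow> 0) (at z within S)"
    and bd: "\<And>s. s \<in> S \<Longrightarrow> AE x in M. f s x \<le> w x"
  shows "((\<lambda>s. \<integral>\<^sup>+x. f s x \<partial>M) \<longlongrightarrow> 0) (at z within S)"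
  unfolding tendsto_at_iff_sequentially comp_def
proof (intro allI impI)
  fix X :: "nat \<Rightarrow> real"
  assume X: "\<forall>i. X i \<in> S - {z}" "X \<longlonglongrightarrow> z"
  have "(\<lambda>i. \<integral>\<^sup>+x. f (X i) x \<partial>M) \<longlonglongrightarrow> (\<integral>\<^sup>+x. 0 \<partial>M)"
  proof (rule nn_integral_dominated_convergence[where w=w])
    show "AE x in M. (\<lambda>i. f (X i) x) \<longlonglongrightarrow> 0"
      using lim by eventually_elim (use X in \<open>simp add: tendsto_at_iff_sequentially comp_def\<close>)
  qed (use assms X in auto)
  then show "(\<lambda>i. \<integral>\<^sup>+x. f (X i) x \<partial>M) \<longlonglongrightarrow> 0" by simp
qed

text \<open>Both entries of the minimum are used: the constant supplies a dominating function for
  unbounded phases, the phase difference the pointwise limit.\<close>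

lemma norm_cis_diff_le: "norm (cis x - cis y) \<le> min 2 \<bar>x - y\<bar>"
proof -
  have "cis x - cis y = cis y * (cis (x - y) - 1)" by (simp add: right_diff_distrib cis_mult)
  then have "norm (cis x - cis y) = norm (iexp (x - y) - 1)" by (simp add: norm_mult cis_conv_exp)
  also have "\<dots> \<le> \<bar>x - y\<bar>" using iexp_approx1[of "x - y" 0] by simp
  finally have "norm (cis x - cis y) \<le> \<bar>x - y\<bar>" .
  moreover have "norm (cis x - cis y) \<le> 2" using norm_triangle_ineq4[of "cis x" "cis y"] by simp
  ultimately show ?thesis by simp
qed

text \<open>Scheffe's argument: \<open>\<bar>a - b\<bar> = a + b - 2 * min a b\<close>. The minimum
  is dominated by \<open>h\<close> itself, and the masses are preserved by translation.\<close>

lemma translation_L1_tendsto: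
  fixes h :: "'a::euclidean_space \<Rightarrow> real" and X :: "real \<Rightarrow> 'a"
  assumes h: "integrable lborel h" and nn: "\<And>x. 0 \<le> h x" and cont: "continuous_on UNIV h"
    and X: "(X \<longlongrightarrow> 0) (at z within S)"
  shows "((\<lambda>s. LINT x|lborel. \<bar>h x - h (x - X s)\<bar>) \<longlongrightarrow> 0) (at z within S)"
proof -
  have [measurable]: "h \<in> borel_measurable borel" using h by auto
  have sh: "integrable lborel (\<lambda>x. h (x - y))" "(LINT x|lborel. h (x - y)) = (LINT x|lborel. h x)" for y
  proof -
    have "integrable (distr lborel borel ((+) (- y))) h" using h by (simp only: lborel_distr_plus)
    then show "integrable lborel (\<lambda>x. h (x - y))" by (subst (asm) integrable_distr_eq) auto
    show "(LINT x|lborel. h (x - y)) = (LINT x|lborel. h x)"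
      using lint_lborel_affine[of h 1 "- y"] by simp
  qed
  have m: "integrable lborel (\<lambda>x. min (h x) (h (x - y)))" for y
    by (rule Bochner_Integration.integrable_bound[OF h]) (auto simp: nn min_def)
  have eq: "(LINT x|lborel. \<bar>h x - h (x - y)\<bar>) = 2 * (LINT x|lborel. h x) - 2 * (LINT x|lborel. min (h x) (h (x - y)))" for y
  proof -
    have "(LINT x|lborel. \<bar>h x - h (x - y)\<bar>) = (LINT x|lborel. (h x + h (x - y)) - 2 * min (h x) (h (x - y)))"
      by (intro Bochner_Integration.integral_cong refl) (auto simp: min_def abs_if)
    also have "\<dots> = (LINT x|lborel. h x + h (x - y)) - (LINT x|lborel. 2 * min (h x) (h (x - y)))"
      using h sh(1) m by (intro Bochner_Integration.integral_diff) auto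
    finally show ?thesis using h sh m by simp
  qed
  have "((\<lambda>s. LINT x|lborel. min (h x) (h (x - X s))) \<longlongrightarrow> (LINT x|lborel. h x)) (at z within S)"
  proof (rule lint_dominated_within[where w=h])
    show "AE x in lborel. ((\<lambda>s. min (h x) (h (x - X s))) \<longlongrightarrow> h x) (at z within S)"
    proof (rule AE_I2)
      fix x
      have "((\<lambda>s. x - X s) \<longlongrightarrow> x - 0) (at z within S)" by (intro tendsto_intros X)
      moreover have "isCont h x" using cont by (simp add: continuous_on_eq_continuous_at)
      ultimately have "((\<lambda>s. h (x - X s)) \<longlongrightarrow> h x) (at z within S)"
        by (intro isCont_tendsto_compose[of x h]) simp_all
      from tendsto_min[OF tendsto_const this, of "h x"] show "((\<lambda>s. min (h x) (h (x - X s))) \<longlongrightarrow> h x) (at z within S)" by simp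
    qed
    show "AE x in lborel. norm (min (h x) (h (x - X s))) \<le> h x" for s
      by (intro AE_I2) (simp add: nn min_def)
  qed (use h in simp_all)
  from tendsto_diff[OF tendsto_const tendsto_mult[OF tendsto_const this], of "2 * (LINT x|lborel. h x)" 2]
  show ?thesis unfolding eq by simp
qed

section \<open>The Gaussian \<open>phi\<close> as an approximate identity\<close>

lemma phi_eq: "phi \<epsilon> \<rho> \<xi> = \<rho>\<^sup>2 / (2 * pi * \<epsilon>\<^sup>2) * exp (- (\<rho>\<^sup>2 / (2 * \<epsilon>\<^sup>2) * (norm \<xi>)\<^sup>2))"
  by (simp add: phi_def)

lemma phi_nonneg: "0 \<le> phi \<epsilon> \<rho> \<xi>"
  by (simp add: phi_def)

lemma phi_measurable [measurable]: "phi \<epsilon> \<rho> \<in> borel_measurable borel"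
  unfolding phi_def[abs_def] by measurable

lemma phi_le: "phi \<epsilon> \<rho> \<xi> \<le> \<rho>\<^sup>2 / (2 * pi * \<epsilon>\<^sup>2)"
  unfolding phi_def by (rule mult_left_le) auto

lemma phi_scale: "0 < \<epsilon> \<Longrightarrow> \<epsilon>\<^sup>2 * phi \<epsilon> \<rho> (\<epsilon> *\<^sub>R \<eta>) = phi 1 \<rho> \<eta>"
  by (simp add: phi_def power_mult_distrib)

lemma phi_integrable:
  assumes "0 < \<epsilon>" "0 < \<rho>"
  shows "integrable lborel (phi \<epsilon> \<rho>)" and "(LINT \<xi>|lborel. phi \<epsilon> \<rho> \<xi>) = 1"
proof -
  define a where "a = \<rho>\<^sup>2 / (2 * \<epsilon>\<^sup>2)"
  have a: "0 < a" using assms by (simp add: a_def)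
  have eq: "phi \<epsilon> \<rho> = (\<lambda>\<xi>. a / pi * exp (- (a * (norm \<xi>)\<^sup>2)))"
    by (simp add: fun_eq_iff phi_eq a_def)
  show "integrable lborel (phi \<epsilon> \<rho>)" unfolding eq using gauss_integrable[OF a, where 'a=R2] by simp
  have "(LINT \<xi>|lborel. phi \<epsilon> \<rho> \<xi>) = a / pi * (sqrt (pi / a))\<^sup>2"
    unfolding eq using gauss_integral[OF a, where 'a=R2] by simp
  also have "\<dots> = 1" using a by simp
  finally show "(LINT \<xi>|lborel. phi \<epsilon> \<rho> \<xi>) = 1" .
qed

lemma phi_nn_integral:
  assumes "0 < \<epsilon>" "0 < \<rho>"
  shows "(\<integral>\<^sup>+\<xi>. ennreal (phi \<epsilon> \<rho> \<xi>) \<partial>lborel) = 1"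
  using phi_integrable[OF assms] by (subst nn_integral_eq_integral) (auto simp: phi_nonneg)

text \<open>Moves the concentration from the Gaussian to the integrand, which gives integrals over a
  fixed probability density.\<close>

lemma nn_integral_phi_scale:
  assumes e: "0 < \<epsilon>" and [measurable]: "f \<in> borel_measurable borel"
  shows "(\<integral>\<^sup>+\<xi>. ennreal (phi \<epsilon> \<rho> \<xi>) * f \<xi> \<partial>lborel) = (\<integral>\<^sup>+\<eta>. ennreal (phi 1 \<rho> \<eta>) * f (\<epsilon> *\<^sub>R \<eta>) \<partial>lborel)"
proof -
  have "(\<integral>\<^sup>+\<xi>. ennreal (phi \<epsilon> \<rho> \<xi>) * f \<xi> \<partial>lborel)
     = ennreal (\<epsilon>\<^sup>2) * (\<integral>\<^sup>+\<eta>. ennreal (phi \<epsilon> \<rho> (\<epsilon> *\<^sub>R \<eta>)) * f (\<epsilon> *\<^sub>R \<eta>) \<partial>lborel)"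
    using nn_integral_lborel_affine[of "\<lambda>\<xi>. ennreal (phi \<epsilon> \<rho> \<xi>) * f \<xi>" \<epsilon> 0] e by simp
  also have "\<dots> = (\<integral>\<^sup>+\<eta>. ennreal (\<epsilon>\<^sup>2) * (ennreal (phi \<epsilon> \<rho> (\<epsilon> *\<^sub>R \<eta>)) * f (\<epsilon> *\<^sub>R \<eta>)) \<partial>lborel)"
    by (rule nn_integral_cmult[symmetric]) measurable
  also have "\<dots> = (\<integral>\<^sup>+\<eta>. ennreal (phi 1 \<rho> \<eta>) * f (\<epsilon> *\<^sub>R \<eta>) \<partial>lborel)"
    using phi_nonneg by (simp add: mult.assoc[symmetric] ennreal_mult[symmetric] phi_scale e)
  finally show ?thesis .
qed

section \<open>Coefficients at positive \<open>\<epsilon>\<close> and the limits of the error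
  integrals\<close>

context scint
begin

text \<open>
  With \<open>\<omega>, \<omega>' = w \<plusminus> \<epsilon> Om\<close> one has \<open>\<omega> \<omega>' = dd \<epsilon>\<close>; relative to the limit, the scattering
  coefficient carries the factor \<open>1 - de \<epsilon>\<close> and the damping the factor \<open>1 + de \<epsilon>\<close>.  The function
  \<open>psi\<close> is the phase that remains after compensation, and \<open>\<epsilon> < eps0\<close> keeps both frequencies
  positive.
\<close>

definition de :: "real \<Rightarrow> real" where "de \<epsilon> = \<epsilon>\<^sup>2 * Om\<^sup>2 / w\<^sup>2"

definition dd :: "real \<Rightarrow> real" where "dd \<epsilon> = w\<^sup>2 - \<epsilon>\<^sup>2 * Om\<^sup>2"

definition psi :: "real \<Rightarrow> R2 \<times> R2 \<Rightarrow> real" where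
  "psi \<epsilon> P = c * Om / dd \<epsilon> * ((norm (fst P))\<^sup>2 + \<epsilon>\<^sup>2 * (norm (snd P))\<^sup>2 / 4) + (c / w - c * w / dd \<epsilon>) * (fst P \<bullet> snd P)"

definition eps0 :: real where "eps0 = w / (\<bar>Om\<bar> + 1)"

lemma eps0_pos: "0 < eps0"
  using w_pos by (simp add: eps0_def)

lemma less_eps0D:
  assumes "0 < \<epsilon>" "\<epsilon> < eps0"
  shows "\<epsilon> * \<bar>Om\<bar> < w" and "0 < dd \<epsilon>" and "de \<epsilon> \<le> 1" and "0 \<le> de \<epsilon>"
proof -
  have "\<epsilon> * (\<bar>Om\<bar> + 1) < w" using assms by (simp add: eps0_def field_simps)
  then show 1: "\<epsilon> * \<bar>Om\<bar> < w" using assms by (simp add: distrib_left)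
  have "(\<epsilon> * \<bar>Om\<bar>)\<^sup>2 < w\<^sup>2" using 1 assms by (intro power_strict_mono) auto
  then have 2: "\<epsilon>\<^sup>2 * Om\<^sup>2 < w\<^sup>2" by (simp add: power_mult_distrib)
  then show "0 < dd \<epsilon>" by (simp add: dd_def)
  show "de \<epsilon> \<le> 1" using 2 w_pos by (simp add: de_def)
  show "0 \<le> de \<epsilon>" by (simp add: de_def)
qed

lemma psi_measurable [measurable]: "psi \<epsilon> \<in> borel_measurable borel"
  unfolding psi_def[abs_def] by measurable

lemma de_tendsto: "(de \<longlongrightarrow> 0) (at 0 within S)"
proof -
  have "((\<lambda>\<epsilon>. \<epsilon>\<^sup>2 * Om\<^sup>2 / w\<^sup>2) \<longlongrightarrow> 0\<^sup>2 * Om\<^sup>2 / w\<^sup>2) (at 0 within S)"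
    by (intro tendsto_intros) (use w_pos in auto)
  then show ?thesis by (simp add: de_def[abs_def])
qed

lemma dd_tendsto: "(dd \<longlongrightarrow> w\<^sup>2) (at 0 within S)"
proof -
  have "((\<lambda>\<epsilon>. w\<^sup>2 - \<epsilon>\<^sup>2 * Om\<^sup>2) \<longlongrightarrow> w\<^sup>2 - 0\<^sup>2 * Om\<^sup>2) (at 0 within S)" by (intro tendsto_intros)
  then show ?thesis by (simp add: dd_def[abs_def])
qed

text \<open>The point is allowed to move with \<open>\<epsilon>\<close>, because the concentrated
  beam is evaluated at \<open>\<epsilon> *\<^sub>R \<xi>\<close>.\<close>

lemma psi_tendsto:
  assumes "(x \<longlongrightarrow> \<xi>) (at 0 within S)"
  shows "((\<lambda>\<epsilon>. psi \<epsilon> (x \<epsilon>, \<zeta>)) \<longlongrightarrow> theta0 (\<xi>, \<zeta>)) (at 0 within S)"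
proof -
  have "((\<lambda>\<epsilon>. psi \<epsilon> (x \<epsilon>, \<zeta>)) \<longlongrightarrow> c * Om / w\<^sup>2 * ((norm \<xi>)\<^sup>2 + 0\<^sup>2 * (norm \<zeta>)\<^sup>2 / 4) + (c / w - c * w / w\<^sup>2) * (\<xi> \<bullet> \<zeta>)) (at 0 within S)"
    unfolding psi_def fst_conv snd_conv by (intro tendsto_intros dd_tendsto assms) (use w_pos in auto)
  moreover have "c / w - c * w / w\<^sup>2 = 0" using w_pos by (simp add: power2_eq_square)
  ultimately show ?thesis by (simp add: theta0_def)
qed

text \<open>\<open>mu1\<close> compares the residual phase with 0, its limit on the beam that
  concentrates at \<open>\<xi> = 0\<close>; \<open>mu2\<close> compares it with
  \<open>theta0\<close>, its limit at fixed \<open>\<xi>\<close>.\<close>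

definition mu1 :: "real \<Rightarrow> real \<Rightarrow> R2 \<times> R2 \<Rightarrow> real" where
  "mu1 Z \<epsilon> P = min 2 (Z * \<bar>psi \<epsilon> P\<bar>)"

definition mu2 :: "real \<Rightarrow> real \<Rightarrow> R2 \<times> R2 \<Rightarrow> real" where
  "mu2 Z \<epsilon> P = min 2 (Z * \<bar>psi \<epsilon> P - theta0 P\<bar>)"

lemma mu1_measurable [measurable]: "mu1 Z \<epsilon> \<in> borel_measurable borel"
  unfolding mu1_def[abs_def] by measurable

lemma mu2_measurable [measurable]: "mu2 Z \<epsilon> \<in> borel_measurable borel"
  unfolding mu2_def[abs_def] by measurable

lemma mu_bounds: "0 \<le> Z \<Longrightarrow> 0 \<le> mu1 Z \<epsilon> P" "0 \<le> Z \<Longrightarrow> 0 \<le> mu2 Z \<epsilon> P" "mu1 Z \<epsilon> P \<le> 2" "mu2 Z \<epsilon> P \<le> 2"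
  by (auto simp: mu1_def mu2_def)

text \<open>Dominates, uniformly in the distance up to \<open>Z\<close> and in
  \<open>\<zeta>\<close>, all that the coefficient errors multiply: gain and loss acting on
  \<open>A\<close>, and the source.\<close>

definition Y :: "real \<Rightarrow> R2 \<Rightarrow> real" where
  "Y Z \<xi> = (1 + Z) * enn2real (VA.dom (VA.W sigA Z) (\<xi>, 0)) + K C c w 0 * kap * ch \<xi>"

lemma Y_measurable [measurable]: "Y Z \<in> borel_measurable borel"
  unfolding Y_def[abs_def] by measurable

lemma Y_nonneg: "0 \<le> Z \<Longrightarrow> 0 \<le> Y Z \<xi>"
  unfolding Y_def using K_nonneg kap_pos ch_nonneg by simp

lemma Y_finite:
  assumes Z: "0 \<le> Z"
  shows "(\<integral>\<^sup>+\<xi>. ennreal (Y Z \<xi>) \<partial>lborel) < \<infinity>"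
proof -
  interpret S: volterra_slice "\<lambda>k::R2. (k, 0::R2)" HA "\<lambda>k. kap * ch k" lam theta0 "\<lambda>\<xi>. (\<xi>, 0)" by (rule slice)
  have "(\<integral>\<^sup>+\<xi>. ennreal (Y Z \<xi>) \<partial>lborel) \<le> (\<integral>\<^sup>+\<xi>. ennreal (1 + Z) * VA.dom (VA.W sigA Z) (\<xi>, 0) + sigA (\<xi>, 0) \<partial>lborel)"
  proof (intro nn_integral_mono)
    fix \<xi>
    have "ennreal (Y Z \<xi>) = ennreal (1 + Z) * ennreal (enn2real (VA.dom (VA.W sigA Z) (\<xi>, 0))) + sigA (\<xi>, 0)"
      unfolding Y_def sigA_def using Z K_nonneg kap_pos ch_nonneg
      by (subst ennreal_plus) (auto simp: ennreal_mult mult_ac simp del: ennreal_plus)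
    also have "\<dots> \<le> ennreal (1 + Z) * VA.dom (VA.W sigA Z) (\<xi>, 0) + sigA (\<xi>, 0)"
      by (intro add_mono mult_left_mono) (auto simp: ennreal_enn2real_if)
    finally show "ennreal (Y Z \<xi>) \<le> ennreal (1 + Z) * VA.dom (VA.W sigA Z) (\<xi>, 0) + sigA (\<xi>, 0)" .
  qed
  also have "\<dots> = (\<integral>\<^sup>+\<xi>. ennreal (1 + Z) * VA.dom (VA.W sigA Z) (\<xi>, 0) \<partial>lborel) + (\<integral>\<^sup>+\<xi>. sigA (\<xi>, 0) \<partial>lborel)"
    by (rule nn_integral_add) measurable
  also have "(\<integral>\<^sup>+\<xi>. ennreal (1 + Z) * VA.dom (VA.W sigA Z) (\<xi>, 0) \<partial>lborel) = ennreal (1 + Z) * (\<integral>\<^sup>+\<xi>. VA.dom (VA.W sigA Z) (\<xi>, 0) \<partial>lborel)"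
    by (rule nn_integral_cmult) measurable
  also have "(\<integral>\<^sup>+\<xi>. VA.dom (VA.W sigA Z) (\<xi>, 0) \<partial>lborel) = ennreal S.L * (ennreal (exp (S.L * Z)) * (\<integral>\<^sup>+\<xi>. sigA (\<xi>, 0) \<partial>lborel))"
    using Z by (simp add: S.nn_integral_dom S.nn_integral_W)
  also have "ennreal (1 + Z) * (ennreal S.L * (ennreal (exp (S.L * Z)) * (\<integral>\<^sup>+\<xi>. sigA (\<xi>, 0) \<partial>lborel))) + (\<integral>\<^sup>+\<xi>. sigA (\<xi>, 0) \<partial>lborel) < \<infinity>"
    using sigA_finite[of 0] by (simp add: ennreal_mult_less_top del: ennreal_plus)
  finally show ?thesis .
qed

text \<open>
  Three sources of error: the phase acquired by the concentrated beam \<open>\<phi>(\<xi>)\<close>, the coefficients that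
  act on \<open>A\<close>, and the replacement of \<open>\<phi> * C_hat\<close> by \<open>C_hat\<close> in the source.
\<close>

definition E1 :: "real \<Rightarrow> real \<Rightarrow> real \<Rightarrow> real \<Rightarrow> R2 \<times> R2 \<Rightarrow> ennreal" where
  "E1 r \<rho> Z \<epsilon> P = ennreal (phi 1 r (snd P) * (phi \<epsilon> \<rho> (fst P) * (de \<epsilon> + mu1 Z \<epsilon> P)))"

definition E2 :: "real \<Rightarrow> real \<Rightarrow> real \<Rightarrow> R2 \<times> R2 \<Rightarrow> ennreal" where
  "E2 r Z \<epsilon> P = ennreal (phi 1 r (snd P) * (Y Z (fst P) * (de \<epsilon> + mu2 Z \<epsilon> P)))"

text \<open>The two summands are the increments of \<open>C_hat\<close> and of the phase when their
  argument is shifted by \<open>\<eta>\<close>, averaged over the beam profile.\<close>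

definition conv_error :: "real \<Rightarrow> real \<Rightarrow> real \<Rightarrow> R2 \<times> R2 \<Rightarrow> ennreal" where
  "conv_error \<rho> Z \<epsilon> P = (\<integral>\<^sup>+\<eta>. ennreal (phi \<epsilon> \<rho> \<eta>) *
     ennreal (\<bar>ch (fst P) - ch (fst P - \<eta>)\<bar> + ch (fst P) * min 2 (c * Z / w * (norm \<eta> * norm (snd P)))) \<partial>lborel)"

definition E3 :: "real \<Rightarrow> real \<Rightarrow> real \<Rightarrow> real \<Rightarrow> R2 \<times> R2 \<Rightarrow> ennreal" where
  "E3 r \<rho> Z \<epsilon> P = ennreal (phi 1 r (snd P)) * conv_error \<rho> Z \<epsilon> P"

lemma E1_measurable [measurable]: "E1 r \<rho> Z \<epsilon> \<in> borel_measurable borel"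
  unfolding E1_def[abs_def] by measurable

lemma E2_measurable [measurable]: "E2 r Z \<epsilon> \<in> borel_measurable borel"
  unfolding E2_def[abs_def] by measurable

lemma conv_error_measurable [measurable]: "conv_error \<rho> Z \<epsilon> \<in> borel_measurable borel"
  unfolding conv_error_def[abs_def] by (rule lborel.borel_measurable_nn_integral) measurable

lemma E3_measurable [measurable]: "E3 r \<rho> Z \<epsilon> \<in> borel_measurable borel"
  unfolding E3_def[abs_def] by measurable

lemma phi_phi_finite:
  assumes "0 < r" "0 < \<rho>"
  shows "(\<integral>\<^sup>+P. ennreal (a * (phi 1 \<rho> (fst P) * phi 1 r (snd P))) \<partial>lborel) < \<infinity>"
proof -
  have "(\<integral>\<^sup>+P. ennreal (a * (phi 1 \<rho> (fst P) * phi 1 r (snd P))) \<partial>lborel)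
     \<le> (\<integral>\<^sup>+P. ennreal \<bar>a\<bar> * (ennreal (phi 1 \<rho> (fst P)) * ennreal (phi 1 r (snd P))) \<partial>lborel)"
    using phi_nonneg by (intro nn_integral_mono) (auto simp: ennreal_mult[symmetric] intro!: ennreal_leI mult_right_mono)
  also have "\<dots> = ennreal \<bar>a\<bar> * (\<integral>\<^sup>+P. ennreal (phi 1 \<rho> (fst P)) * ennreal (phi 1 r (snd P)) \<partial>lborel)"
    by (rule nn_integral_cmult) measurable
  also have "(\<integral>\<^sup>+P. ennreal (phi 1 \<rho> (fst P)) * ennreal (phi 1 r (snd P)) \<partial>(lborel :: (R2 \<times> R2) measure)) = 1"
    using assms by (subst nn_integral_prod_mult) (auto simp: phi_nn_integral)
  finally show ?thesis by (simp add: le_less_trans)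
qed

text \<open>After \<open>\<xi> = \<epsilon> \<eta>\<close> the Gaussian is fixed and the phase is
  evaluated at a point tending to 0, where its limit vanishes. The dominating factor 3 bounds
  \<open>de\<close> by 1 and \<open>mu1\<close> by 2.\<close>

lemma E1_tendsto:
  assumes r: "0 < r" and \<rho>: "0 < \<rho>" and Z: "0 \<le> Z"
  shows "((\<lambda>\<epsilon>. \<integral>\<^sup>+P. E1 r \<rho> Z \<epsilon> P \<partial>lborel) \<longlongrightarrow> 0) (at 0 within {0<..<eps0})"
proof -
  let ?f = "\<lambda>\<epsilon> P. ennreal (phi 1 \<rho> (fst P) * phi 1 r (snd P) * (de \<epsilon> + mu1 Z \<epsilon> (\<epsilon> *\<^sub>R fst P, snd P)))"
  have fm: "?f \<epsilon> \<in> borel_measurable borel" for \<epsilon>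
  proof -
    have "(\<lambda>P :: R2 \<times> R2. (\<epsilon> *\<^sub>R fst P, snd P)) \<in> borel_measurable borel"
      by (intro borel_measurable_continuous_onI continuous_intros)
    from measurable_compose[OF this mu1_measurable] show ?thesis by measurable
  qed
  have eq: "(\<integral>\<^sup>+P. E1 r \<rho> Z \<epsilon> P \<partial>lborel) = (\<integral>\<^sup>+P. ?f \<epsilon> P \<partial>lborel)" if e: "\<epsilon> \<in> {0<..<eps0}" for \<epsilon>
  proof -
    have nn: "0 \<le> de \<epsilon> + mu1 Z \<epsilon> P" for P using less_eps0D[of \<epsilon>] e mu_bounds(1)[OF Z, of \<epsilon> P] by simp
    have pm [measurable]: "(\<lambda>\<xi>. mu1 Z \<epsilon> (\<xi>, \<zeta>)) \<in> borel_measurable borel" for \<zeta>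
      by (rule measurable_compose[OF Pair_R2_measurable mu1_measurable])
    have "(\<integral>\<^sup>+P. E1 r \<rho> Z \<epsilon> P \<partial>lborel) = (\<integral>\<^sup>+\<zeta>. \<integral>\<^sup>+\<xi>. E1 r \<rho> Z \<epsilon> (\<xi>, \<zeta>) \<partial>lborel \<partial>lborel)"
      by (rule nn_integral_lborel_Pair(2)) measurable
    also have "\<dots> = (\<integral>\<^sup>+\<zeta>. \<integral>\<^sup>+\<xi>. ennreal (phi \<epsilon> \<rho> \<xi>) * ennreal (phi 1 r \<zeta> * (de \<epsilon> + mu1 Z \<epsilon> (\<xi>, \<zeta>))) \<partial>lborel \<partial>lborel)"
      using phi_nonneg nn by (intro nn_integral_cong) (auto simp: E1_def ennreal_mult[symmetric] mult_ac)
    also have "\<dots> = (\<integral>\<^sup>+\<zeta>. \<integral>\<^sup>+\<xi>. ennreal (phi 1 \<rho> \<xi>) * ennreal (phi 1 r \<zeta> * (de \<epsilon> + mu1 Z \<epsilon> (\<epsilon> *\<^sub>R \<xi>, \<zeta>))) \<partial>lborel \<partial>lborel)"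
    proof (rule nn_integral_cong)
      fix \<zeta>
      show "(\<integral>\<^sup>+\<xi>. ennreal (phi \<epsilon> \<rho> \<xi>) * ennreal (phi 1 r \<zeta> * (de \<epsilon> + mu1 Z \<epsilon> (\<xi>, \<zeta>))) \<partial>lborel)
        = (\<integral>\<^sup>+\<xi>. ennreal (phi 1 \<rho> \<xi>) * ennreal (phi 1 r \<zeta> * (de \<epsilon> + mu1 Z \<epsilon> (\<epsilon> *\<^sub>R \<xi>, \<zeta>))) \<partial>lborel)"
        by (rule nn_integral_phi_scale) (use e in auto)
    qed
    also have "\<dots> = (\<integral>\<^sup>+\<zeta>. \<integral>\<^sup>+\<xi>. ?f \<epsilon> (\<xi>, \<zeta>) \<partial>lborel \<partial>lborel)"
      using phi_nonneg nn by (intro nn_integral_cong) (auto simp: ennreal_mult[symmetric] mult_ac)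
    also have "\<dots> = (\<integral>\<^sup>+P. ?f \<epsilon> P \<partial>lborel)" by (rule nn_integral_lborel_Pair(2)[OF fm, symmetric])
    finally show ?thesis .
  qed
  have "((\<lambda>\<epsilon>. \<integral>\<^sup>+P. ?f \<epsilon> P \<partial>lborel) \<longlongrightarrow> 0) (at 0 within {0<..<eps0})"
  proof (rule nn_integral_dominated_within[where w="\<lambda>P. ennreal (3 * (phi 1 \<rho> (fst P) * phi 1 r (snd P)))"])
    show "(\<integral>\<^sup>+P. ennreal (3 * (phi 1 \<rho> (fst P) * phi 1 r (snd P))) \<partial>lborel) < \<infinity>" by (rule phi_phi_finite[OF r \<rho>])
    show "AE P in lborel. ((\<lambda>\<epsilon>. ?f \<epsilon> P) \<longlongrightarrow> 0) (at 0 within {0<..<eps0})"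
    proof (rule AE_I2)
      fix P :: "R2 \<times> R2"
      have "((\<lambda>\<epsilon>. \<epsilon> *\<^sub>R fst P) \<longlongrightarrow> 0 *\<^sub>R fst P) (at 0 within {0<..<eps0})" by (intro tendsto_intros)
      then have "((\<lambda>\<epsilon>. psi \<epsilon> (\<epsilon> *\<^sub>R fst P, snd P)) \<longlongrightarrow> theta0 (0, snd P)) (at 0 within {0<..<eps0})"
        by (intro psi_tendsto) simp
      then have "((\<lambda>\<epsilon>. min 2 (Z * \<bar>psi \<epsilon> (\<epsilon> *\<^sub>R fst P, snd P)\<bar>)) \<longlongrightarrow> min 2 (Z * \<bar>theta0 (0, snd P)\<bar>)) (at 0 within {0<..<eps0})"
        by (intro tendsto_intros)
      then have "((\<lambda>\<epsilon>. mu1 Z \<epsilon> (\<epsilon> *\<^sub>R fst P, snd P)) \<longlongrightarrow> 0) (at 0 within {0<..<eps0})"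
        by (simp add: mu1_def theta0_def)
      then have "((\<lambda>\<epsilon>. ?f \<epsilon> P) \<longlongrightarrow> ennreal (phi 1 \<rho> (fst P) * phi 1 r (snd P) * (0 + 0))) (at 0 within {0<..<eps0})"
        by (intro tendsto_intros de_tendsto)
      then show "((\<lambda>\<epsilon>. ?f \<epsilon> P) \<longlongrightarrow> 0) (at 0 within {0<..<eps0})" by simp
    qed
    fix \<epsilon> assume e: "\<epsilon> \<in> {0<..<eps0}"
    show "AE P in lborel. ?f \<epsilon> P \<le> ennreal (3 * (phi 1 \<rho> (fst P) * phi 1 r (snd P)))"
    proof (intro AE_I2 ennreal_leI)
      fix P :: "R2 \<times> R2"
      have "de \<epsilon> + mu1 Z \<epsilon> (\<epsilon> *\<^sub>R fst P, snd P) \<le> 3"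
        using less_eps0D(3)[of \<epsilon>] e mu_bounds(3)[of Z \<epsilon> "(\<epsilon> *\<^sub>R fst P, snd P)"] by simp
      then have "phi 1 \<rho> (fst P) * phi 1 r (snd P) * (de \<epsilon> + mu1 Z \<epsilon> (\<epsilon> *\<^sub>R fst P, snd P)) \<le> phi 1 \<rho> (fst P) * phi 1 r (snd P) * 3"
        by (intro mult_left_mono) (auto simp: phi_nonneg)
      then show "phi 1 \<rho> (fst P) * phi 1 r (snd P) * (de \<epsilon> + mu1 Z \<epsilon> (\<epsilon> *\<^sub>R fst P, snd P)) \<le> 3 * (phi 1 \<rho> (fst P) * phi 1 r (snd P))"
        by simp
    qed
  qed (use fm in simp_all)
  then show ?thesis by (rule Lim_transform_within[of _ _ _ _ eps0]) (use eq eps0_pos in auto)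
qed

text \<open>Nothing concentrates here: \<open>Y\<close> is a fixed integrable function, and at each
  point the phase error tends to 0.\<close>

lemma E2_tendsto:
  assumes r: "0 < r" and Z: "0 \<le> Z"
  shows "((\<lambda>\<epsilon>. \<integral>\<^sup>+P. E2 r Z \<epsilon> P \<partial>lborel) \<longlongrightarrow> 0) (at 0 within {0<..<eps0})"
proof (rule nn_integral_dominated_within[where w="\<lambda>P. 3 * (ennreal (Y Z (fst P)) * ennreal (phi 1 r (snd P)))"])
  have "(\<integral>\<^sup>+(P :: R2 \<times> R2). 3 * (ennreal (Y Z (fst P)) * ennreal (phi 1 r (snd P))) \<partial>lborel)
    = 3 * (\<integral>\<^sup>+(P :: R2 \<times> R2). ennreal (Y Z (fst P)) * ennreal (phi 1 r (snd P)) \<partial>lborel)"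
    by (rule nn_integral_cmult) measurable
  also have "(\<integral>\<^sup>+(P :: R2 \<times> R2). ennreal (Y Z (fst P)) * ennreal (phi 1 r (snd P)) \<partial>lborel) = (\<integral>\<^sup>+\<xi>. ennreal (Y Z \<xi>) \<partial>lborel)"
    using r by (subst nn_integral_prod_mult) (auto simp: phi_nn_integral)
  also have "3 * \<dots> < \<infinity>" using Y_finite[OF Z] by (simp add: ennreal_mult_less_top)
  finally show "(\<integral>\<^sup>+(P :: R2 \<times> R2). 3 * (ennreal (Y Z (fst P)) * ennreal (phi 1 r (snd P))) \<partial>lborel) < \<infinity>" .
  show "AE P in lborel. ((\<lambda>\<epsilon>. E2 r Z \<epsilon> P) \<longlongrightarrow> 0) (at 0 within {0<..<eps0})"
  proof (rule AE_I2)
    fix P :: "R2 \<times> R2"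
    have "((\<lambda>\<epsilon>. psi \<epsilon> P) \<longlongrightarrow> theta0 P) (at 0 within {0<..<eps0})"
      using psi_tendsto[where x="\<lambda>_. fst P" and \<xi>="fst P" and \<zeta>="snd P"] by simp
    then have "((\<lambda>\<epsilon>. mu2 Z \<epsilon> P) \<longlongrightarrow> min 2 (Z * \<bar>theta0 P - theta0 P\<bar>)) (at 0 within {0<..<eps0})"
      unfolding mu2_def by (intro tendsto_intros)
    then have "((\<lambda>\<epsilon>. mu2 Z \<epsilon> P) \<longlongrightarrow> 0) (at 0 within {0<..<eps0})" by simp
    then have "((\<lambda>\<epsilon>. E2 r Z \<epsilon> P) \<longlongrightarrow> ennreal (phi 1 r (snd P) * (Y Z (fst P) * (0 + 0)))) (at 0 within {0<..<eps0})"
      unfolding E2_def by (intro tendsto_intros de_tendsto)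
    then show "((\<lambda>\<epsilon>. E2 r Z \<epsilon> P) \<longlongrightarrow> 0) (at 0 within {0<..<eps0})" by simp
  qed
  fix \<epsilon> assume e: "\<epsilon> \<in> {0<..<eps0}"
  show "AE P in lborel. E2 r Z \<epsilon> P \<le> 3 * (ennreal (Y Z (fst P)) * ennreal (phi 1 r (snd P)))"
  proof (rule AE_I2)
    fix P :: "R2 \<times> R2"
    have "de \<epsilon> + mu2 Z \<epsilon> P \<le> 3" using less_eps0D(3)[of \<epsilon>] e mu_bounds(4)[of Z \<epsilon> P] by simp
    then have "phi 1 r (snd P) * (Y Z (fst P) * (de \<epsilon> + mu2 Z \<epsilon> P)) \<le> phi 1 r (snd P) * (Y Z (fst P) * 3)"
      using Y_nonneg[OF Z] phi_nonneg by (intro mult_left_mono) auto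
    then have "E2 r Z \<epsilon> P \<le> ennreal (phi 1 r (snd P) * (Y Z (fst P) * 3))"
      unfolding E2_def by (rule ennreal_leI)
    also have "\<dots> = ennreal 3 * (ennreal (Y Z (fst P)) * ennreal (phi 1 r (snd P)))"
      using Y_nonneg[OF Z] phi_nonneg by (simp only: ennreal_mult[symmetric] mult_nonneg_nonneg mult_ac zero_le_numeral)
    finally show "E2 r Z \<epsilon> P \<le> 3 * (ennreal (Y Z (fst P)) * ennreal (phi 1 r (snd P)))" by simp
  qed
qed simp_all

definition chI :: real where "chI = (LINT k|lborel. ch k)"

text \<open>L^1 modulus of continuity of \<open>C_hat\<close> under translation.\<close>

definition chT :: "R2 \<Rightarrow> real" where "chT \<eta> = (LINT \<xi>|lborel. \<bar>ch \<xi> - ch (\<xi> - \<eta>)\<bar>)"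

lemma chI_nonneg: "0 \<le> chI"
  unfolding chI_def by (intro Bochner_Integration.integral_nonneg ch_nonneg)

lemma ch_shift_integrable: "integrable lborel (\<lambda>\<xi>. ch (\<xi> - \<eta>))" "(LINT \<xi>|lborel. ch (\<xi> - \<eta>)) = chI"
proof -
  have "integrable (distr lborel borel ((+) (- \<eta>))) ch" using ch_integrable by (simp only: lborel_distr_plus)
  then show "integrable lborel (\<lambda>\<xi>. ch (\<xi> - \<eta>))" by (subst (asm) integrable_distr_eq) auto
  show "(LINT \<xi>|lborel. ch (\<xi> - \<eta>)) = chI"
    using lint_lborel_affine[of ch 1 "- \<eta>"] by (simp add: chI_def)
qed

lemma chT_measurable [measurable]: "chT \<in> borel_measurable borel"
  unfolding chT_def[abs_def] by (rule lborel.borel_measurable_lebesgue_integral) measurable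

lemma chT_bounds: "0 \<le> chT \<eta>" "chT \<eta> \<le> 2 * chI"
proof -
  show "0 \<le> chT \<eta>" unfolding chT_def by (intro Bochner_Integration.integral_nonneg) simp
  have "chT \<eta> \<le> (LINT \<xi>|lborel. ch \<xi> + ch (\<xi> - \<eta>))"
    unfolding chT_def
  proof (rule Bochner_Integration.integral_mono)
    show "\<bar>ch \<xi> - ch (\<xi> - \<eta>)\<bar> \<le> ch \<xi> + ch (\<xi> - \<eta>)" for \<xi>
      using ch_nonneg[of \<xi>] ch_nonneg[of "\<xi> - \<eta>"] by linarith
  qed (use ch_integrable ch_shift_integrable in auto)
  then show "chT \<eta> \<le> 2 * chI" using ch_integrable ch_shift_integrable by (simp add: chI_def)
qed

lemma chT_tendsto:
  fixes X :: "real \<Rightarrow> R2"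
  assumes "(X \<longlongrightarrow> 0) (at z within S)"
  shows "((\<lambda>s. chT (X s)) \<longlongrightarrow> 0) (at z within S)"
  unfolding chT_def by (rule translation_L1_tendsto[OF ch_integrable ch_nonneg ch_continuous assms])

text \<open>Integrating over \<open>\<xi>\<close> first turns the shift of \<open>C_hat\<close> into
  its L^1 modulus \<open>chT\<close>; the substitution
  \<open>\<eta> \<mapsto> \<epsilon> \<eta>\<close> then fixes the Gaussian. The bound
  \<open>4 * chI\<close> consists of \<open>2 * chI\<close> for the modulus and
  \<open>2 * chI\<close> for the phase.\<close>

lemma E3_tendsto:
  assumes r: "0 < r" and \<rho>: "0 < \<rho>" and Z: "0 \<le> Z"
  shows "((\<lambda>\<epsilon>. \<integral>\<^sup>+P. E3 r \<rho> Z \<epsilon> P \<partial>lborel) \<longlongrightarrow> 0) (at 0 within {0<..<eps0})"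
proof -
  let ?m = "\<lambda>(\<eta>::R2) (\<zeta>::R2). min 2 (c * Z / w * (norm \<eta> * norm \<zeta>))"
  let ?f = "\<lambda>\<epsilon> (P::R2 \<times> R2). ennreal (phi 1 \<rho> (fst P) * phi 1 r (snd P) * (chT (\<epsilon> *\<^sub>R fst P) + chI * ?m (\<epsilon> *\<^sub>R fst P) (snd P)))"
  have m_nn: "0 \<le> ?m \<eta> \<zeta>" for \<eta> \<zeta> using c_pos w_pos Z by simp
  have fm: "?f \<epsilon> \<in> borel_measurable borel" for \<epsilon> by measurable
  have eq: "(\<integral>\<^sup>+P. E3 r \<rho> Z \<epsilon> P \<partial>lborel) = (\<integral>\<^sup>+P. ?f \<epsilon> P \<partial>lborel)" if e: "\<epsilon> \<in> {0<..<eps0}" for \<epsilon>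
  proof -
    have inner: "(\<integral>\<^sup>+\<xi>. conv_error \<rho> Z \<epsilon> (\<xi>, \<zeta>) \<partial>lborel) = (\<integral>\<^sup>+\<eta>. ennreal (phi 1 \<rho> \<eta>) * ennreal (chT (\<epsilon> *\<^sub>R \<eta>) + chI * ?m (\<epsilon> *\<^sub>R \<eta>) \<zeta>) \<partial>lborel)" for \<zeta>
    proof -
      have "(\<integral>\<^sup>+\<xi>. conv_error \<rho> Z \<epsilon> (\<xi>, \<zeta>) \<partial>lborel)
        = (\<integral>\<^sup>+\<eta>. \<integral>\<^sup>+\<xi>. ennreal (phi \<epsilon> \<rho> \<eta>) * ennreal (\<bar>ch \<xi> - ch (\<xi> - \<eta>)\<bar> + ch \<xi> * ?m \<eta> \<zeta>) \<partial>lborel \<partial>lborel)"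
        unfolding conv_error_def fst_conv snd_conv by (rule lborel_pair.Fubini'[symmetric]) measurable
      also have "\<dots> = (\<integral>\<^sup>+\<eta>. ennreal (phi \<epsilon> \<rho> \<eta>) * ennreal (chT \<eta> + chI * ?m \<eta> \<zeta>) \<partial>lborel)"
      proof (rule nn_integral_cong)
        fix \<eta>
        have i1: "integrable lborel (\<lambda>\<xi>. \<bar>ch \<xi> - ch (\<xi> - \<eta>)\<bar>)" using ch_integrable ch_shift_integrable by auto
        have i2: "integrable lborel (\<lambda>\<xi>. ch \<xi> * ?m \<eta> \<zeta>)" using ch_integrable by auto
        have "(\<integral>\<^sup>+\<xi>. ennreal (\<bar>ch \<xi> - ch (\<xi> - \<eta>)\<bar> + ch \<xi> * ?m \<eta> \<zeta>) \<partial>lborel)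
          = ennreal (LINT \<xi>|lborel. \<bar>ch \<xi> - ch (\<xi> - \<eta>)\<bar> + ch \<xi> * ?m \<eta> \<zeta>)"
          by (rule nn_integral_eq_integral[OF Bochner_Integration.integrable_add[OF i1 i2]])
            (use ch_nonneg m_nn in \<open>auto intro!: add_nonneg_nonneg mult_nonneg_nonneg\<close>)
        also have "(LINT \<xi>|lborel. \<bar>ch \<xi> - ch (\<xi> - \<eta>)\<bar> + ch \<xi> * ?m \<eta> \<zeta>) = chT \<eta> + chI * ?m \<eta> \<zeta>"
          unfolding Bochner_Integration.integral_add[OF i1 i2] by (simp add: chT_def chI_def)
        finally show "(\<integral>\<^sup>+\<xi>. ennreal (phi \<epsilon> \<rho> \<eta>) * ennreal (\<bar>ch \<xi> - ch (\<xi> - \<eta>)\<bar> + ch \<xi> * ?m \<eta> \<zeta>) \<partial>lborel)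
           = ennreal (phi \<epsilon> \<rho> \<eta>) * ennreal (chT \<eta> + chI * ?m \<eta> \<zeta>)"
          by (subst nn_integral_cmult) auto
      qed
      also have "\<dots> = (\<integral>\<^sup>+\<eta>. ennreal (phi 1 \<rho> \<eta>) * ennreal (chT (\<epsilon> *\<^sub>R \<eta>) + chI * ?m (\<epsilon> *\<^sub>R \<eta>) \<zeta>) \<partial>lborel)"
        by (rule nn_integral_phi_scale) (use e in auto)
      finally show ?thesis .
    qed
    have "(\<integral>\<^sup>+P. E3 r \<rho> Z \<epsilon> P \<partial>lborel) = (\<integral>\<^sup>+\<zeta>. \<integral>\<^sup>+\<xi>. E3 r \<rho> Z \<epsilon> (\<xi>, \<zeta>) \<partial>lborel \<partial>lborel)"
      by (rule nn_integral_lborel_Pair(2)) measurable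
    also have "\<dots> = (\<integral>\<^sup>+\<zeta>. \<integral>\<^sup>+\<eta>. ?f \<epsilon> (\<eta>, \<zeta>) \<partial>lborel \<partial>lborel)"
    proof (rule nn_integral_cong)
      fix \<zeta>
      have [measurable]: "(\<lambda>\<xi>. conv_error \<rho> Z \<epsilon> (\<xi>, \<zeta>)) \<in> borel_measurable borel"
        by (rule measurable_compose[OF Pair_R2_measurable conv_error_measurable])
      have "(\<integral>\<^sup>+\<xi>. E3 r \<rho> Z \<epsilon> (\<xi>, \<zeta>) \<partial>lborel) = ennreal (phi 1 r \<zeta>) * (\<integral>\<^sup>+\<xi>. conv_error \<rho> Z \<epsilon> (\<xi>, \<zeta>) \<partial>lborel)"
        unfolding E3_def snd_conv by (rule nn_integral_cmult) measurable
      also have "\<dots> = (\<integral>\<^sup>+\<eta>. ennreal (phi 1 r \<zeta>) * (ennreal (phi 1 \<rho> \<eta>) * ennreal (chT (\<epsilon> *\<^sub>R \<eta>) + chI * ?m (\<epsilon> *\<^sub>R \<eta>) \<zeta>)) \<partial>lborel)"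
        unfolding inner by (rule nn_integral_cmult[symmetric]) measurable
      also have "\<dots> = (\<integral>\<^sup>+\<eta>. ?f \<epsilon> (\<eta>, \<zeta>) \<partial>lborel)"
      proof (rule nn_integral_cong)
        fix \<eta>
        have "0 \<le> chT (\<epsilon> *\<^sub>R \<eta>) + chI * ?m (\<epsilon> *\<^sub>R \<eta>) \<zeta>"
          by (intro add_nonneg_nonneg mult_nonneg_nonneg chT_bounds chI_nonneg m_nn)
        then show "ennreal (phi 1 r \<zeta>) * (ennreal (phi 1 \<rho> \<eta>) * ennreal (chT (\<epsilon> *\<^sub>R \<eta>) + chI * ?m (\<epsilon> *\<^sub>R \<eta>) \<zeta>)) = ?f \<epsilon> (\<eta>, \<zeta>)"
          by (simp only: ennreal_mult[symmetric] mult_nonneg_nonneg phi_nonneg fst_conv snd_conv mult_ac)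
      qed
      finally show "(\<integral>\<^sup>+\<xi>. E3 r \<rho> Z \<epsilon> (\<xi>, \<zeta>) \<partial>lborel) = (\<integral>\<^sup>+\<eta>. ?f \<epsilon> (\<eta>, \<zeta>) \<partial>lborel)" .
    qed
    also have "\<dots> = (\<integral>\<^sup>+P. ?f \<epsilon> P \<partial>lborel)" by (rule nn_integral_lborel_Pair(2)[OF fm, symmetric])
    finally show ?thesis .
  qed
  have "((\<lambda>\<epsilon>. \<integral>\<^sup>+P. ?f \<epsilon> P \<partial>lborel) \<longlongrightarrow> 0) (at 0 within {0<..<eps0})"
  proof (rule nn_integral_dominated_within[where w="\<lambda>P. ennreal (4 * chI * (phi 1 \<rho> (fst P) * phi 1 r (snd P)))"])
    show "(\<integral>\<^sup>+P. ennreal (4 * chI * (phi 1 \<rho> (fst P) * phi 1 r (snd P))) \<partial>lborel) < \<infinity>" by (rule phi_phi_finite[OF r \<rho>])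
    show "AE P in lborel. ((\<lambda>\<epsilon>. ?f \<epsilon> P) \<longlongrightarrow> 0) (at 0 within {0<..<eps0})"
    proof (rule AE_I2)
      fix P :: "R2 \<times> R2"
      have 1: "((\<lambda>\<epsilon>. \<epsilon> *\<^sub>R fst P) \<longlongrightarrow> 0) (at 0 within {0<..<eps0})"
        using tendsto_scaleR[OF tendsto_ident_at tendsto_const, of "fst P" 0 "{0<..<eps0}"] by simp
      have "((\<lambda>\<epsilon>. ?m (\<epsilon> *\<^sub>R fst P) (snd P)) \<longlongrightarrow> ?m 0 (snd P)) (at 0 within {0<..<eps0})"
        by (intro tendsto_intros 1)
      then have "((\<lambda>\<epsilon>. ?f \<epsilon> P) \<longlongrightarrow> ennreal (phi 1 \<rho> (fst P) * phi 1 r (snd P) * (0 + chI * ?m 0 (snd P)))) (at 0 within {0<..<eps0})"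
        by (intro tendsto_ennrealI tendsto_mult tendsto_add tendsto_const chT_tendsto 1)
      then show "((\<lambda>\<epsilon>. ?f \<epsilon> P) \<longlongrightarrow> 0) (at 0 within {0<..<eps0})" by simp
    qed
    fix \<epsilon> assume e: "\<epsilon> \<in> {0<..<eps0}"
    show "AE P in lborel. ?f \<epsilon> P \<le> ennreal (4 * chI * (phi 1 \<rho> (fst P) * phi 1 r (snd P)))"
    proof (intro AE_I2 ennreal_leI)
      fix P :: "R2 \<times> R2"
      have "chI * ?m (\<epsilon> *\<^sub>R fst P) (snd P) \<le> chI * 2" by (intro mult_left_mono chI_nonneg) simp
      then have "chT (\<epsilon> *\<^sub>R fst P) + chI * ?m (\<epsilon> *\<^sub>R fst P) (snd P) \<le> 4 * chI"
        using chT_bounds(2)[of "\<epsilon> *\<^sub>R fst P"] by linarith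
      then have "phi 1 \<rho> (fst P) * phi 1 r (snd P) * (chT (\<epsilon> *\<^sub>R fst P) + chI * ?m (\<epsilon> *\<^sub>R fst P) (snd P))
          \<le> phi 1 \<rho> (fst P) * phi 1 r (snd P) * (4 * chI)"
        by (intro mult_left_mono) (auto simp: phi_nonneg)
      then show "phi 1 \<rho> (fst P) * phi 1 r (snd P) * (chT (\<epsilon> *\<^sub>R fst P) + chI * ?m (\<epsilon> *\<^sub>R fst P) (snd P))
          \<le> 4 * chI * (phi 1 \<rho> (fst P) * phi 1 r (snd P))"
        by (simp only: mult_ac)
    qed
  qed (use fm in simp_all)
  then show ?thesis by (rule Lim_transform_within[of _ _ _ _ eps0]) (use eq eps0_pos in auto)
qed

text \<open>Weights of the Duhamel estimate: \<open>E1\<close> enters once through the initial term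
  and with \<open>Z * lam\<close> through the integral, whose length is at most \<open>Z\<close>;
  the other errors enter only through the integral.\<close>

definition error_bound :: "real \<Rightarrow> real \<Rightarrow> real \<Rightarrow> real \<Rightarrow> R2 \<times> R2 \<Rightarrow> ennreal" where
  "error_bound r \<rho> Z \<epsilon> P = ennreal (K C c w 0 * (1 + Z * lam)) * E1 r \<rho> Z \<epsilon> P + ennreal Z * E2 r Z \<epsilon> P
     + ennreal (Z * K C c w 0 * kap) * E3 r \<rho> Z \<epsilon> P"

lemma error_bound_measurable [measurable]: "error_bound r \<rho> Z \<epsilon> \<in> borel_measurable borel"
  unfolding error_bound_def[abs_def] by measurable

lemma error_bound_tendsto:
  assumes r: "0 < r" and \<rho>: "0 < \<rho>" and Z: "0 \<le> Z"
  shows "((\<lambda>\<epsilon>. \<integral>\<^sup>+P. error_bound r \<rho> Z \<epsilon> P \<partial>lborel) \<longlongrightarrow> 0) (at 0 within {0<..<eps0})"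
proof -
  have eq: "(\<integral>\<^sup>+P. error_bound r \<rho> Z \<epsilon> P \<partial>lborel) = ennreal (K C c w 0 * (1 + Z * lam)) * (\<integral>\<^sup>+P. E1 r \<rho> Z \<epsilon> P \<partial>lborel)
     + ennreal Z * (\<integral>\<^sup>+P. E2 r Z \<epsilon> P \<partial>lborel) + ennreal (Z * K C c w 0 * kap) * (\<integral>\<^sup>+P. E3 r \<rho> Z \<epsilon> P \<partial>lborel)" for \<epsilon>
    unfolding error_bound_def by (simp add: nn_integral_add nn_integral_cmult)
  have "((\<lambda>\<epsilon>. \<integral>\<^sup>+P. error_bound r \<rho> Z \<epsilon> P \<partial>lborel) \<longlongrightarrow> ennreal (K C c w 0 * (1 + Z * lam)) * 0 + ennreal Z * 0
      + ennreal (Z * K C c w 0 * kap) * 0) (at 0 within {0<..<eps0})"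
    unfolding eq
    by (intro tendsto_add ennreal_tendsto_cmult E1_tendsto E2_tendsto E3_tendsto assms) auto
  then show ?thesis by simp
qed

text \<open>A uniform bound beside integrability; it makes the convolution with the beam integrable
  after the variable of integration is reflected.\<close>

lemma norm_C_hat_le: "ch k \<le> (LINT x|lborel. \<bar>C x\<bar>)"
proof -
  have "integrable lborel (\<lambda>x. of_real (C x) * cis (- (k \<bullet> x)))"
    using cov by (intro integrable_mult_cis) (auto simp: covariance_function_def)
  then have "norm (C_hat C k) \<le> (LINT x|lborel. \<bar>C x\<bar>)"
    unfolding fourier_def using cov
    by (intro Bochner_Integration.integral_norm_bound_integral) (auto simp: covariance_function_def norm_mult)
  then show ?thesis using ch_nonneg by (simp add: C_hat_eq)
qed

text \<open>Integrates \<open>K' = - lam K\<close>. With \<open>K z\<close> written as an integral,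
  the decay of the unscattered part can be compared with the scattering terms under one integral
  sign.\<close>

lemma K_integral:
  assumes z: "0 \<le> z"
  shows "(LINT s:{0..z}|lborel. complex_of_real (lam * K C c w s)) = of_real (K C c w 0 - K C c w z)"
proof -
  have "(LINT s|lborel. indicator {0..z} s *\<^sub>R complex_of_real (lam * K C c w s)) = of_real (- K C c w z) - of_real (- K C c w 0)"
  proof (rule integral_FTC_Icc[OF z])
    fix x
    have "((\<lambda>s. - K C c w s) has_vector_derivative lam * K C c w x) (at x within {0..z})"
      unfolding K_eq has_real_derivative_iff_has_vector_derivative[symmetric]
      by (auto intro!: derivative_eq_intros)
    then show "((\<lambda>s. complex_of_real (- K C c w s)) has_vector_derivative complex_of_real (lam * K C c w x)) (at x within {0..z})"
      by (rule bounded_linear.has_vector_derivative[OF bounded_linear_of_real])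
  next
    show "continuous_on {0..z} (\<lambda>s. complex_of_real (lam * K C c w s))" unfolding K_eq by (intro continuous_intros)
  qed
  then show ?thesis unfolding set_lebesgue_integral_def by (rule trans) simp
qed

text \<open>Taken as the difference, so that the decomposition is an identity and all content lies
  in its size.\<close>

definition remainder :: "real \<Rightarrow> real \<Rightarrow> real \<Rightarrow> real \<Rightarrow> R2 \<Rightarrow> R2 \<Rightarrow> complex" where
  "remainder r rho eps z \<xi> \<zeta> = M1_tilde C c r rho w Om eps (z / eps) \<xi> \<zeta>
     - of_real (K C c w z * phi eps (sqrt 2 * rho) \<xi> * phi eps (r / sqrt 2) \<zeta>)
     - of_real (phi eps (r / sqrt 2) \<zeta>) * AA z (\<xi>, \<zeta> /\<^sub>R eps)"

end

section \<open>The rescaled moment\<close>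

lemma set_lint_scale:
  fixes f :: "real \<Rightarrow> complex"
  assumes e: "0 < e"
  shows "(LINT s:{0..z / e}|lborel. f s) = (LINT s:{0..z}|lborel. (1 / e) *\<^sub>R f (s / e))"
proof -
  have "(LINT s|lborel. indicator {0..z / e} s *\<^sub>R f s) = \<bar>1 / e\<bar> *\<^sub>R (LINT s|lborel. indicator {0..z / e} (0 + 1 / e * s) *\<^sub>R f (0 + 1 / e * s))"
    using e by (intro lborel_integral_real_affine) simp
  also have "\<dots> = (1 / e) *\<^sub>R (LINT s|lborel. indicator {0..z} s *\<^sub>R f (s / e))"
    using e by (simp add: indicator_def zero_le_divide_iff divide_le_cancel)
  also have "\<dots> = (LINT s|lborel. (1 / e) *\<^sub>R (indicator {0..z} s *\<^sub>R f (s / e)))"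
    by (simp only: scaleR_conv_of_real integral_mult_right_zero)
  also have "\<dots> = (LINT s|lborel. indicator {0..z} s *\<^sub>R ((1 / e) *\<^sub>R f (s / e)))"
    by (simp only: scaleR_scaleR mult.commute)
  finally show ?thesis by (simp only: set_lebesgue_integral_def)
qed

text \<open>Algebra behind the residual. Here \<open>u\<close> and \<open>v\<close> are the phases
  at positive \<open>\<epsilon>\<close> and in the limit, \<open>\<delta>\<close> is the relative
  coefficient error, \<open>\<beta>\<close> the beam, \<open>b\<close> its convolution with
  \<open>C_hat\<close>, \<open>cs\<close> the limit of \<open>b\<close>, and \<open>a\<close> the
  convolution of \<open>A\<close>. The terms are regrouped so that each carries one of the small
  quantities \<open>1 - (1 + \<delta>) u\<close>, \<open>(1 - \<delta>) u - v\<close>,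
  \<open>(1 + \<delta>) u - v\<close> or \<open>b - cs\<close>.\<close>

lemma norm_combination_le:
  fixes a A b cs u v :: complex and kap lam K \<beta> \<delta> :: real
  assumes nn: "0 \<le> kap" "0 \<le> lam" "0 \<le> K" "0 \<le> \<beta>" "0 \<le> \<delta>" "\<delta> \<le> 1"
    and u: "norm u = 1" and u1: "norm (u - 1) \<le> \<mu>1" and uv: "norm (u - v) \<le> \<mu>2"
  shows "norm (u * (of_real K * (of_real (kap * (1 - \<delta>)) * b - of_real (lam * (1 + \<delta>)) * of_real \<beta>)
        + (of_real (kap * (1 - \<delta>)) * a - of_real (lam * (1 + \<delta>)) * A))
      + of_real (lam * K * \<beta>) - v * (of_real (kap * K) * cs) - v * (of_real kap * a - of_real lam * A))
    \<le> K * \<beta> * lam * (\<delta> + \<mu>1) + (\<delta> + \<mu>2) * (kap * norm a + lam * norm A + K * kap * norm cs) + K * kap * norm (b - cs)"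
    (is "norm ?G \<le> _")
proof -
  let ?p = "of_real (1 - \<delta>) * u - v" and ?q = "of_real (1 + \<delta>) * u - v" and ?r = "1 - of_real (1 + \<delta>) * u"
  have eq: "?G = of_real (K * \<beta> * lam) * ?r + ((of_real kap * a * ?p - of_real lam * A * ?q)
      + (of_real (K * kap) * (of_real (1 - \<delta>) * u * (b - cs)) + of_real (K * kap) * (?p * cs)))"
    by (simp add: algebra_simps)
  have du: "norm (of_real \<delta> * u) = \<delta>" using u nn by (simp add: norm_mult)
  have r: "norm ?r \<le> \<delta> + \<mu>1"
  proof -
    have "?r = - (u - 1) - of_real \<delta> * u" by (simp add: algebra_simps)
    also have "norm \<dots> \<le> norm (u - 1) + \<delta>" using norm_triangle_ineq4[of "- (u - 1)" "of_real \<delta> * u"] du by (simp only: norm_minus_cancel)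
    finally show ?thesis using u1 by linarith
  qed
  have p: "norm ?p \<le> \<delta> + \<mu>2"
  proof -
    have "?p = (u - v) - of_real \<delta> * u" by (simp add: algebra_simps)
    also have "norm \<dots> \<le> norm (u - v) + \<delta>" using norm_triangle_ineq4[of "u - v" "of_real \<delta> * u"] du by simp
    finally show ?thesis using uv by linarith
  qed
  have q: "norm ?q \<le> \<delta> + \<mu>2"
  proof -
    have "?q = (u - v) + of_real \<delta> * u" by (simp add: algebra_simps)
    also have "norm \<dots> \<le> norm (u - v) + \<delta>" using norm_triangle_ineq[of "u - v" "of_real \<delta> * u"] du by simp
    finally show ?thesis using uv by linarith
  qed
  have "norm ?G \<le> norm (of_real (K * \<beta> * lam) * ?r) + ((norm (of_real kap * a * ?p) + norm (of_real lam * A * ?q))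
      + (norm (of_real (K * kap) * (of_real (1 - \<delta>) * u * (b - cs))) + norm (of_real (K * kap) * (?p * cs))))"
    unfolding eq by (intro norm_triangle_mono add_mono norm_triangle_ineq4 order_refl order_trans[OF norm_triangle_ineq4])
  also have "\<dots> = K * \<beta> * lam * norm ?r + ((kap * norm a * norm ?p + lam * norm A * norm ?q)
      + (K * kap * ((1 - \<delta>) * norm (b - cs)) + K * kap * (norm ?p * norm cs)))"
    unfolding norm_mult norm_of_real u using nn by (simp only: abs_of_nonneg mult_nonneg_nonneg diff_ge_0_iff_ge mult_1_right abs_mult)
  also have "\<dots> \<le> K * \<beta> * lam * (\<delta> + \<mu>1) + ((kap * norm a * (\<delta> + \<mu>2) + lam * norm A * (\<delta> + \<mu>2))
      + (K * kap * (1 * norm (b - cs)) + K * kap * ((\<delta> + \<mu>2) * norm cs)))"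
    using nn by (intro add_mono mult_left_mono mult_right_mono r p q) auto
  finally show ?thesis by (simp add: algebra_simps)
qed

locale scint_eps = scint C c w Om for C c w Om +
  fixes eps r rho :: real
  assumes eps_pos: "0 < eps" and eps_less: "eps < eps0" and r_pos: "0 < r" and rho_pos: "0 < rho"
begin

definition kape :: real where "kape = kap * (1 - de eps)"

definition lame :: real where "lame = lam * (1 + de eps)"

definition HE :: "real \<Rightarrow> R2 \<times> R2 \<Rightarrow> R2 \<Rightarrow> complex" where
  "HE s P k = of_real kape * C_hat C k * cis (c * s / w * (k \<bullet> snd P))"

definition bet :: "R2 \<Rightarrow> real" where "bet = phi eps (sqrt 2 * rho)"

text \<open>Width parameter 1 instead of \<open>eps\<close>, because the second component is
  measured in units of \<open>eps\<close>.\<close>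

definition gam :: "R2 \<Rightarrow> real" where "gam = phi 1 (r / sqrt 2)"

lemma de_bounds: "0 \<le> de eps" "de eps \<le> 1" and dd_pos: "0 < dd eps"
  using less_eps0D[OF eps_pos eps_less] by auto

lemma kape_bounds: "0 \<le> kape" "kape \<le> kap"
  using de_bounds kap_pos by (auto simp: kape_def mult_left_le)

lemma lame_bounds: "0 \<le> lame" "lame \<le> 2 * lam"
proof -
  show "0 \<le> lame" using de_bounds lam_nonneg by (simp add: lame_def)
  show "lame \<le> 2 * lam" using de_bounds mult_left_mono[OF de_bounds(2) lam_nonneg] by (simp add: lame_def distrib_left)
qed

lemma bet_measurable [measurable]: "bet \<in> borel_measurable borel" and bet_nonneg: "0 \<le> bet \<xi>"
  and gam_measurable [measurable]: "gam \<in> borel_measurable borel" and gam_nonneg: "0 \<le> gam \<zeta>"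
  by (simp_all add: bet_def gam_def phi_nonneg)

text \<open>The identity slice, because the remainder is measured in both variables jointly.\<close>

sublocale VE: volterra_slice "\<lambda>k::R2. (k, 0::R2)" HE "\<lambda>k. kape * ch k" lame "psi eps" "\<lambda>P. P"
proof
  show "(\<lambda>(s, P, k). HE s P k) \<in> borel_measurable (borel \<Otimes>\<^sub>M borel \<Otimes>\<^sub>M borel)"
    unfolding HE_def by measurable
  show "norm (HE s P k) \<le> kape * ch k" for s P k
    using kape_bounds ch_nonneg by (simp add: HE_def norm_mult C_hat_eq)
  show "integrable lborel (\<lambda>k. kape * ch k)" using ch_integrable by simp
  show "0 \<le> lame" by (rule lame_bounds)
  show "(\<integral>\<^sup>+P. f (P - (k, 0::R2)) \<partial>lborel) = (\<integral>\<^sup>+P. (f P :: ennreal) \<partial>lborel)"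
    if "f \<in> borel_measurable borel" for f and k :: R2
  proof -
    have "P - (k, 0) = - (k, 0) + P" for P :: "R2 \<times> R2" by simp
    then show ?thesis by (simp only: nn_integral_shift[OF that])
  qed
qed measurable

text \<open>As a measurability rule the identity slice makes the method \<open>measurable\<close> diverge.\<close>

declare VE.e_measurable [measurable del]

definition Teps :: "R2 \<times> R2 \<Rightarrow> R2 \<times> R2" where "Teps Q = sum_diff_map (fst Q, eps *\<^sub>R snd Q)"

lemma Teps_measurable: "Teps \<in> borel_measurable borel"
  unfolding Teps_def[abs_def]
  by (rule measurable_compose[OF _ sum_diff_map_measurable]) (intro borel_measurable_continuous_onI continuous_intros)

lemma nn_integral_Teps:
  assumes [measurable]: "f \<in> borel_measurable borel"
  shows "(\<integral>\<^sup>+P. f P \<partial>lborel) = ennreal (eps\<^sup>2) * (\<integral>\<^sup>+Q. f (Teps Q) \<partial>lborel)"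
  unfolding nn_integral_sum_diff_map[OF assms, symmetric] Teps_def
  by (subst nn_integral_scale_snd[OF _ eps_pos]) simp_all

text \<open>\<open>Teps\<close> rescales Lebesgue measure by a positive constant, so preimages of
  null sets are null.\<close>

lemma AE_Teps:
  assumes "AE P in lborel. X P"
  shows "AE Q in lborel. X (Teps Q)"
proof -
  obtain N where N: "{P \<in> space lborel. \<not> X P} \<subseteq> N" "emeasure lborel N = 0" "N \<in> sets lborel"
    using assms by (rule AE_E)
  then have Nb [measurable]: "N \<in> sets borel" by simp
  have N': "Teps -` N \<in> sets lborel" using measurable_sets[OF Teps_measurable Nb] by simp
  have "0 = (\<integral>\<^sup>+P. indicator N P \<partial>lborel)" using N by simp
  also have "\<dots> = ennreal (eps\<^sup>2) * (\<integral>\<^sup>+Q. indicator N (Teps Q) \<partial>lborel)"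
    by (rule nn_integral_Teps) measurable
  also have "(\<lambda>Q. indicator N (Teps Q)) = (indicator (Teps -` N) :: R2 \<times> R2 \<Rightarrow> ennreal)"
    by (simp add: fun_eq_iff indicator_def)
  also have "(\<integral>\<^sup>+Q. indicator (Teps -` N) Q \<partial>lborel) = emeasure lborel (Teps -` N)"
    by (rule nn_integral_indicator[OF N'])
  finally have "Teps -` N \<in> null_sets lborel"
    using eps_pos N' by (simp add: null_sets_def)
  then show ?thesis using N(1) by (intro AE_I'[of "Teps -` N"]) auto
qed

text \<open>Separates the part removed by the phase compensation from the residual
  \<open>psi\<close>. The factor \<open>eps\<close> cancels against the long propagation
  distance.\<close>

lemma M1_symbol_Teps: "M1_symbol c (w + eps * Om) (w - eps * Om) (Teps Q) = eps * (c / w * (fst Q \<bullet> snd Q) - psi eps Q)"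
proof -
  \<comment> \<open>The squared norms of the two momenta are \<open>X + eps * I\<close> and
    \<open>X - eps * I\<close>.\<close>
  define X where "X = (norm (fst Q))\<^sup>2 + eps\<^sup>2 * (norm (snd Q))\<^sup>2 / 4"
  define I where "I = fst Q \<bullet> snd Q"
  have 1: "(norm ((eps *\<^sub>R snd Q) /\<^sub>R 2 + fst Q))\<^sup>2 = X + eps * I"
    "(norm ((eps *\<^sub>R snd Q) /\<^sub>R 2 - fst Q))\<^sup>2 = X - eps * I"
    unfolding X_def I_def power2_norm_eq_inner
    by (simp_all add: inner_add_left inner_add_right inner_diff_left inner_diff_right inner_commute power2_eq_square field_simps)
  have prod: "(w + eps * Om) * (w - eps * Om) = dd eps" by (simp add: dd_def power2_eq_square algebra_simps)
  then have nz: "w + eps * Om \<noteq> 0" "w - eps * Om \<noteq> 0" using dd_pos by auto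
  have "M1_symbol c (w + eps * Om) (w - eps * Om) (Teps Q) = c / 2 * ((X + eps * I) / (w + eps * Om) - (X - eps * I) / (w - eps * Om))"
    by (simp add: M1_symbol_def Teps_def sum_diff_map_def 1[simplified])
  also have "(X + eps * I) / (w + eps * Om) - (X - eps * I) / (w - eps * Om)
     = (2 * w * eps * I - 2 * eps * Om * X) / ((w + eps * Om) * (w - eps * Om))"
    using nz by (simp add: diff_frac_eq algebra_simps)
  also have "c / 2 * ((2 * w * eps * I - 2 * eps * Om * X) / ((w + eps * Om) * (w - eps * Om))) = eps * (c * w / dd eps * I - c * Om / dd eps * X)"
    unfolding prod using dd_pos by (simp add: field_simps)
  also have "c * w / dd eps * I - c * Om / dd eps * X = c / w * I - psi eps Q"
    unfolding psi_def X_def[symmetric] I_def[symmetric] by (simp add: algebra_simps)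
  finally show ?thesis by (simp add: I_def)
qed

text \<open>The Jacobian \<open>eps\<^sup>2\<close> and the amplitudes combine to
  \<open>(2 * pi) ^ 4\<close> times two normalised Gaussians. This is the origin of the constant in
  \<open>K\<close> and of the parameters \<open>sqrt 2 * rho\<close> and
  \<open>r / sqrt 2\<close>.\<close>

lemma fourier_init_Teps:
  "of_real (eps\<^sup>2) * fourier (\<lambda>X. of_real (M1_init (r / eps) (rho / eps) X)) (Teps Q)
     = of_real (K C c w 0 * bet (fst Q) * gam (snd Q))"
proof -
  have "fourier (\<lambda>X. of_real (M1_init (r / eps) (rho / eps) X)) (Teps Q)
    = of_real (4 * pi * (rho / eps)\<^sup>2 * exp (- ((rho / eps)\<^sup>2 * (norm (fst Q))\<^sup>2)) * (pi * (r / eps)\<^sup>2 * exp (- ((r / eps)\<^sup>2 * (norm (eps *\<^sub>R snd Q))\<^sup>2 / 4))))"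
    unfolding Teps_def by (rule fourier_M1_init) (use eps_pos r_pos rho_pos in auto)
  also have "(r / eps)\<^sup>2 * (norm (eps *\<^sub>R snd Q))\<^sup>2 / 4 = r\<^sup>2 * (norm (snd Q))\<^sup>2 / 4"
    using eps_pos by (simp add: power_mult_distrib power_divide)
  finally have 1: "of_real (eps\<^sup>2) * fourier (\<lambda>X. of_real (M1_init (r / eps) (rho / eps) X)) (Teps Q)
    = of_real (eps\<^sup>2 * (4 * pi * (rho / eps)\<^sup>2 * exp (- ((rho / eps)\<^sup>2 * (norm (fst Q))\<^sup>2)) * (pi * (r / eps)\<^sup>2 * exp (- (r\<^sup>2 * (norm (snd Q))\<^sup>2 / 4)))))"
    by (simp only: of_real_mult)
  have b: "bet (fst Q) = rho\<^sup>2 / (pi * eps\<^sup>2) * exp (- ((rho / eps)\<^sup>2 * (norm (fst Q))\<^sup>2))"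
    by (simp add: bet_def phi_def power_mult_distrib power_divide)
  have g: "gam (snd Q) = r\<^sup>2 / (4 * pi) * exp (- (r\<^sup>2 * (norm (snd Q))\<^sup>2 / 4))"
    by (simp add: gam_def phi_def power_divide)
  have "eps\<^sup>2 * (4 * pi * (rho / eps)\<^sup>2 * x * (pi * (r / eps)\<^sup>2 * y)) = (2 * pi) ^ 4 * (rho\<^sup>2 / (pi * eps\<^sup>2) * x) * (r\<^sup>2 / (4 * pi) * y)" for x y
    using eps_pos by (simp add: field_simps power_divide power_mult_distrib eval_nat_numeral)
  then show ?thesis unfolding 1 b g by (simp add: K_eq)
qed

text \<open>
  Phase-compensated moment at distance \<open>s/eps\<close>; the factor \<open>eps\<^sup>2\<close> is the Jacobian of
  \<open>\<zeta> \<mapsto> eps \<zeta>\<close>.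
\<close>

definition rescaled :: "(real \<Rightarrow> R2 \<times> R2 \<Rightarrow> complex) \<Rightarrow> real \<Rightarrow> R2 \<times> R2 \<Rightarrow> complex" where
  "rescaled m s Q = of_real (eps\<^sup>2) * cis (c * s / w * (fst Q \<bullet> snd Q)) * (indicator {0..} s *\<^sub>R m (s / eps) (Teps Q))"

text \<open>The compensating phases at \<open>Q\<close> and at \<open>Q - (k, 0)\<close> differ by
  exactly the phase carried by \<open>HE\<close>, and the \<open>1 / eps\<close> from the change of
  distance cancels the \<open>eps\<close> in front of the covariance.\<close>

lemma gen_rescaled:
  assumes s: "0 \<le> s"
  shows "VE.gen s (rescaled m s) Q = of_real (eps\<^sup>2) * cis (c * s / w * (fst Q \<bullet> snd Q)) *
     ((1 / eps) *\<^sub>R M1_interaction (\<lambda>x. eps * C x) c (w + eps * Om) (w - eps * Om) (m (s / eps)) (Teps Q))"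
proof -
  obtain p p' where T: "Teps Q = (p, p')" by (cases "Teps Q")
  let ?u = "cis (c * s / w * (fst Q \<bullet> snd Q))"
  define I where "I = (LINT k|lborel. C_hat C k * m (s / eps) (p - k, p' + k))"
  have shift: "Teps (Q - (k, 0)) = (p - k, p' + k)" for k
    using T by (cases Q) (auto simp: Teps_def sum_diff_map_def)
  have h: "HE s Q k * rescaled m s (Q - (k, 0)) = of_real (kape * eps\<^sup>2) * ?u * (C_hat C k * m (s / eps) (p - k, p' + k))" for k
  proof -
    have "cis (c * s / w * (k \<bullet> snd Q)) * cis (c * s / w * ((fst Q - k) \<bullet> snd Q)) = ?u"
      by (simp add: cis_mult inner_diff_left right_diff_distrib del: times_divide_eq_left)
    then have "HE s Q k * rescaled m s (Q - (k, 0)) = of_real (kape * eps\<^sup>2) * (cis (c * s / w * (k \<bullet> snd Q)) * cis (c * s / w * ((fst Q - k) \<bullet> snd Q))) * (C_hat C k * m (s / eps) (p - k, p' + k))"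
      using s by (simp add: HE_def rescaled_def shift mult_ac del: times_divide_eq_left cis_cnj)
    then show ?thesis by (simp only: \<open>_ = ?u\<close>)
  qed
  have "rescaled m s Q = of_real (eps\<^sup>2) * ?u * m (s / eps) (p, p')"
    using s by (simp add: rescaled_def T)
  then have "VE.gen s (rescaled m s) Q = of_real (kape * eps\<^sup>2) * ?u * I - lame *\<^sub>R (of_real (eps\<^sup>2) * ?u * m (s / eps) (p, p'))"
    unfolding VE.gen_def I_def h integral_mult_right_zero by simp
  also have "\<dots> = of_real (eps\<^sup>2) * ?u * (of_real kape * I - of_real lame * m (s / eps) (p, p'))"
    by (simp add: scaleR_conv_of_real algebra_simps)
  also have "of_real kape * I - of_real lame * m (s / eps) (p, p')
     = (1 / eps) *\<^sub>R M1_interaction (\<lambda>x. eps * C x) c (w + eps * Om) (w - eps * Om) (m (s / eps)) (p, p')"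
  proof -
    have k: "kape = 2 * (w + eps * Om) * (w - eps * Om) / (2 * pi)\<^sup>2 / (8 * c\<^sup>2)"
    proof -
      have "kape = dd eps / (4 * (2 * pi)\<^sup>2 * c\<^sup>2)"
        using w_pos c_pos by (simp add: kape_def kap_def de_def dd_def field_simps)
      also have "dd eps = (w + eps * Om) * (w - eps * Om)" by (simp add: dd_def power2_eq_square algebra_simps)
      also have "x * y / (4 * q * k) = 2 * x * y / q / (8 * k)" for x y q k :: real by simp
      finally show ?thesis .
    qed
    have l: "lame = ((w + eps * Om)\<^sup>2 + (w - eps * Om)\<^sup>2) * C 0 / (8 * c\<^sup>2)"
      using w_pos c_pos by (simp add: lame_def lam_def de_def power2_eq_square field_simps)
    have "(LINT k|lborel. C_hat (\<lambda>x. eps * C x) k * m (s / eps) (p - k, p' + k)) = of_real eps * I"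
      unfolding I_def covariance_function_scale(2)[OF cov eps_pos] mult.assoc by (rule integral_mult_right_zero)
    moreover have "(1 / d) *\<^sub>R (x *\<^sub>R (of_real eps * I) - (y * (eps * C 0)) *\<^sub>R M)
        = of_real eps * (of_real (x / d) * I - of_real (y * C 0 / d) * M)" for d x y :: real and M :: complex
      by (simp add: scaleR_conv_of_real divide_inverse algebra_simps)
    ultimately have "M1_interaction (\<lambda>x. eps * C x) c (w + eps * Om) (w - eps * Om) (m (s / eps)) (p, p')
      = of_real eps * (of_real kape * I - of_real lame * m (s / eps) (p, p'))"
      unfolding M1_interaction_def k l by (simp only: prod.case)
    then show ?thesis using eps_pos by (simp add: scaleR_conv_of_real)
  qed
  finally show ?thesis by (simp add: T)
qed

lemma rescaled_measurable:
  assumes m: "L1_path m"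
  shows "(\<lambda>(s, Q). rescaled m s Q) \<in> borel_measurable (borel \<Otimes>\<^sub>M borel)"
proof -
  have "(\<lambda>x::real \<times> R2 \<times> R2. (fst x / eps, Teps (snd x))) \<in> borel \<Otimes>\<^sub>M borel \<rightarrow>\<^sub>M borel \<Otimes>\<^sub>M borel"
    by (intro measurable_Pair measurable_compose[OF measurable_snd Teps_measurable] borel_measurable_divide measurable_fst borel_measurable_const)
  from measurable_compose[OF this L1_path_measurable[OF m]]
  have m1: "(\<lambda>x. indicator {0..} (fst x / eps) *\<^sub>R m (fst x / eps) (Teps (snd x))) \<in> borel_measurable (borel \<Otimes>\<^sub>M borel)"
    by (simp only: split_beta' fst_conv snd_conv)
  have "rescaled m (fst x) (snd x) = of_real (eps\<^sup>2) * cis (c * fst x / w * (fst (snd x) \<bullet> snd (snd x))) * (indicator {0..} (fst x / eps) *\<^sub>R m (fst x / eps) (Teps (snd x)))" for x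
    using eps_pos by (simp add: rescaled_def indicator_def zero_le_divide_iff)
  moreover have "(\<lambda>x::real \<times> R2 \<times> R2. of_real (eps\<^sup>2) * cis (c * fst x / w * (fst (snd x) \<bullet> snd (snd x)))) \<in> borel_measurable (borel \<Otimes>\<^sub>M borel)"
    unfolding borel_prod by (intro borel_measurable_continuous_onI continuous_intros) (use w_pos in auto)
  ultimately show ?thesis unfolding split_beta' by (simp only: borel_measurable_times[OF _ m1])
qed

lemma rescaled_bounded:
  assumes m: "L1_path m"
  shows "\<exists>B. \<forall>s\<in>{0..Z}. (\<integral>\<^sup>+Q. ennreal (norm (rescaled m s Q)) \<partial>lborel) \<le> ennreal B"
proof -
  obtain B where B: "\<forall>s\<in>{0..Z / eps}. (\<integral>\<^sup>+P. ennreal (norm (m s P)) \<partial>lborel) \<le> ennreal B"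
    using L1_path_bounded[OF m] by blast
  show ?thesis
  proof (intro exI[of _ B] ballI)
    fix s assume s: "s \<in> {0..Z}"
    then have s': "s / eps \<in> {0..Z / eps}" using eps_pos by (simp add: divide_right_mono)
    have "integrable lborel (m (s / eps))" using m s' by (simp add: L1_path_def)
    then have mm: "m (s / eps) \<in> borel_measurable borel" by auto
    define h where "h P = ennreal (norm (m (s / eps) P))" for P
    have hm: "h \<in> borel_measurable borel"
      unfolding h_def[abs_def] by (rule measurable_compose[OF mm]) measurable
    then have hT: "(\<lambda>Q. h (Teps Q)) \<in> borel_measurable lborel"
      using measurable_compose[OF Teps_measurable hm] by (simp only: measurable_lborel2)
    have "(\<integral>\<^sup>+Q. ennreal (norm (rescaled m s Q)) \<partial>lborel) = (\<integral>\<^sup>+Q. ennreal (eps\<^sup>2) * h (Teps Q) \<partial>lborel)"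
      using s by (intro nn_integral_cong) (simp add: rescaled_def h_def norm_mult ennreal_mult norm_power)
    also have "\<dots> = ennreal (eps\<^sup>2) * (\<integral>\<^sup>+Q. h (Teps Q) \<partial>lborel)" by (rule nn_integral_cmult[OF hT])
    also have "\<dots> = (\<integral>\<^sup>+P. h P \<partial>lborel)" by (rule nn_integral_Teps[OF hm, symmetric])
    also have "\<dots> = (\<integral>\<^sup>+P. ennreal (norm (m (s / eps) P)) \<partial>lborel)" by (simp only: h_def)
    also have "\<dots> \<le> ennreal B" using B s' by blast
    finally show "(\<integral>\<^sup>+Q. ennreal (norm (rescaled m s Q)) \<partial>lborel) \<le> ennreal B" .
  qed
qed

lemma rescaled_eq:
  assumes m: "M1_mild_fourier (\<lambda>x. eps * C x) c (r / eps) (rho / eps) (w + eps * Om) (w - eps * Om) m" and z: "0 \<le> z"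
  shows "AE Q in lborel. rescaled m z Q = cis (z * psi eps Q) * of_real (K C c w 0 * bet (fst Q) * gam (snd Q))
     + (LINT s:{0..z}|lborel. cis ((z - s) * psi eps Q) * VE.gen s (rescaled m s) Q)"
proof -
  let ?sym = "M1_symbol c (w + eps * Om) (w - eps * Om)"
  let ?int = "M1_interaction (\<lambda>x. eps * C x) c (w + eps * Om) (w - eps * Om)"
  let ?F = "fourier (\<lambda>X. of_real (M1_init (r / eps) (rho / eps) X))"
  have "AE P in lborel. m (z / eps) P = cis (- (z / eps * ?sym P)) * ?F P
      + (LINT s:{0..z / eps}|lborel. cis (- ((z / eps - s) * ?sym P)) * ?int (m s) P)"
    using m divide_nonneg_pos[OF z eps_pos] unfolding M1_mild_fourier_def by blast
  from AE_Teps[OF this] show ?thesis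
  proof eventually_elim
    case (elim Q)
    let ?ph = "\<lambda>s. cis (c * s / w * (fst Q \<bullet> snd Q))"
    \<comment> \<open>Free propagation from \<open>s\<close> to \<open>z\<close> followed by
      compensation at \<open>z\<close> equals compensation at \<open>s\<close> followed by
      propagation with the residual phase \<open>psi\<close> alone.\<close>
    have ph: "?ph z * cis (- ((z / eps - s / eps) * ?sym (Teps Q))) = cis ((z - s) * psi eps Q) * ?ph s" for s
    proof -
      have "- ((z / eps - s / eps) * (eps * X)) = - ((z - s) * X)" for X using eps_pos by (simp add: field_simps)
      then have 1: "- ((z / eps - s / eps) * ?sym (Teps Q)) = - ((z - s) * (c / w * (fst Q \<bullet> snd Q) - psi eps Q))"
        unfolding M1_symbol_Teps .
      have 2: "c * z / w * I + - ((z - s) * (c / w * I - p)) = (z - s) * p + c * s / w * I" for p I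
        using w_pos by (simp add: field_simps)
      show ?thesis unfolding 1 cis_mult 2 ..
    qed
    have "rescaled m z Q = of_real (eps\<^sup>2) * ?ph z * m (z / eps) (Teps Q)"
      using z by (simp add: rescaled_def)
    also have "\<dots> = (?ph z * cis (- ((z / eps - 0 / eps) * ?sym (Teps Q)))) * (of_real (eps\<^sup>2) * ?F (Teps Q))
        + of_real (eps\<^sup>2) * ?ph z * (LINT s:{0..z / eps}|lborel. cis (- ((z / eps - s) * ?sym (Teps Q))) * ?int (m s) (Teps Q))"
      unfolding elim by (simp only: distrib_left div_0 diff_zero mult_ac)
    also have "(?ph z * cis (- ((z / eps - 0 / eps) * ?sym (Teps Q)))) * (of_real (eps\<^sup>2) * ?F (Teps Q))
       = cis (z * psi eps Q) * of_real (K C c w 0 * bet (fst Q) * gam (snd Q))"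
      unfolding ph fourier_init_Teps by simp
    also have "of_real (eps\<^sup>2) * ?ph z * (LINT s:{0..z / eps}|lborel. cis (- ((z / eps - s) * ?sym (Teps Q))) * ?int (m s) (Teps Q))
       = (LINT s:{0..z}|lborel. of_real (eps\<^sup>2) * ?ph z * ((1 / eps) *\<^sub>R (cis (- ((z / eps - s / eps) * ?sym (Teps Q))) * ?int (m (s / eps)) (Teps Q))))"
      unfolding set_lint_scale[OF eps_pos] by (rule set_integral_mult_right[symmetric])
    also have "\<dots> = (LINT s:{0..z}|lborel. cis ((z - s) * psi eps Q) * VE.gen s (rescaled m s) Q)"
    proof (rule set_lebesgue_integral_cong)
      show "\<forall>s. s \<in> {0..z} \<longrightarrow> of_real (eps\<^sup>2) * ?ph z * ((1 / eps) *\<^sub>R (cis (- ((z / eps - s / eps) * ?sym (Teps Q))) * ?int (m (s / eps)) (Teps Q)))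
          = cis ((z - s) * psi eps Q) * VE.gen s (rescaled m s) Q"
      proof (intro allI impI)
        fix s assume "s \<in> {0..z}"
        then have s: "0 \<le> s" by simp
        have "of_real (eps\<^sup>2) * ?ph z * ((1 / eps) *\<^sub>R (cis (- ((z / eps - s / eps) * ?sym (Teps Q))) * ?int (m (s / eps)) (Teps Q)))
          = of_real (eps\<^sup>2) * (?ph z * cis (- ((z / eps - s / eps) * ?sym (Teps Q)))) * ((1 / eps) *\<^sub>R ?int (m (s / eps)) (Teps Q))"
          by (simp only: scaleR_conv_of_real mult_ac)
        also have "\<dots> = cis ((z - s) * psi eps Q) * VE.gen s (rescaled m s) Q"
          unfolding ph gen_rescaled[OF s] by (simp only: mult_ac)
        finally show "of_real (eps\<^sup>2) * ?ph z * ((1 / eps) *\<^sub>R (cis (- ((z / eps - s / eps) * ?sym (Teps Q))) * ?int (m (s / eps)) (Teps Q)))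
          = cis ((z - s) * psi eps Q) * VE.gen s (rescaled m s) Q" .
      qed
    qed simp
    finally show ?case .
  qed
qed

section \<open>The leading-order ansatz and its residual in the rescaled equation\<close>

definition leading :: "real \<Rightarrow> R2 \<times> R2 \<Rightarrow> complex" where
  "leading s P = of_real (gam (snd P)) * (of_real (K C c w s * bet (fst P)) + AA s P)"

lemma leading_measurable: "(\<lambda>(s, P). leading s P) \<in> borel_measurable (borel \<Otimes>\<^sub>M borel)"
proof -
  have [measurable]: "(\<lambda>x. AA (fst x) (snd x)) \<in> borel_measurable (borel \<Otimes>\<^sub>M borel)"
    using AA_measurable by (simp add: split_beta')
  show ?thesis unfolding leading_def split_beta' by measurable
qed

lemma leading_bounded:
  assumes Z: "0 \<le> Z"
  shows "\<exists>B<\<infinity>. \<forall>s\<in>{0..Z}. (\<integral>\<^sup>+P. ennreal (norm (leading s P)) \<partial>lborel) \<le> B"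
proof -
  interpret S: volterra_slice "\<lambda>k::R2. (k, 0::R2)" HA "\<lambda>k. kap * ch k" lam theta0 "\<lambda>\<xi>. (\<xi>, 0)" by (rule slice)
  let ?f = "\<lambda>\<xi>. ennreal (K C c w 0) * ennreal (bet \<xi>) + ennreal (1 + Z) * VA.W sigA Z (\<xi>, 0)"
  have Wm [measurable]: "(\<lambda>\<xi>. VA.W sigA Z (\<xi>, 0)) \<in> borel_measurable borel"
    by (rule measurable_compose[OF Pair_R2_measurable]) measurable
  have "(\<integral>\<^sup>+\<xi>. ?f \<xi> \<partial>lborel) = ennreal (K C c w 0) * (\<integral>\<^sup>+\<xi>. ennreal (bet \<xi>) \<partial>lborel) + ennreal (1 + Z) * (\<integral>\<^sup>+\<xi>. VA.W sigA Z (\<xi>, 0) \<partial>lborel)"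
    by (subst nn_integral_add) (auto simp: nn_integral_cmult simp del: ennreal_plus)
  also have "(\<integral>\<^sup>+\<xi>. ennreal (bet \<xi>) \<partial>lborel) = 1"
    unfolding bet_def using eps_pos rho_pos by (intro phi_nn_integral) auto
  also have "(\<integral>\<^sup>+\<xi>. VA.W sigA Z (\<xi>, 0) \<partial>lborel) = ennreal (exp (S.L * Z)) * (\<integral>\<^sup>+\<xi>. sigA (\<xi>, 0) \<partial>lborel)"
    by (rule S.nn_integral_W[OF sigA_measurable Z])
  also have "ennreal (K C c w 0) * 1 + ennreal (1 + Z) * (ennreal (exp (S.L * Z)) * (\<integral>\<^sup>+\<xi>. sigA (\<xi>, 0) \<partial>lborel)) < \<infinity>"
    using sigA_finite[of 0] by (simp add: ennreal_mult_less_top del: ennreal_plus)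
  finally have f: "(\<integral>\<^sup>+\<xi>. ?f \<xi> \<partial>lborel) < \<infinity>" .
  have g: "(\<integral>\<^sup>+\<zeta>. ennreal (gam \<zeta>) \<partial>lborel) = 1"
    unfolding gam_def using r_pos by (intro phi_nn_integral) auto
  show ?thesis
  proof (intro exI conjI ballI)
    show "(\<integral>\<^sup>+\<xi>. ?f \<xi> \<partial>lborel) < \<infinity>" by (rule f)
    fix s assume s: "s \<in> {0..Z}"
    have "(\<integral>\<^sup>+P. ennreal (norm (leading s P)) \<partial>lborel) \<le> (\<integral>\<^sup>+P. ?f (fst P) * ennreal (gam (snd P)) \<partial>lborel)"
    proof (rule nn_integral_mono)
      fix P :: "R2 \<times> R2"
      have "norm (leading s P) \<le> gam (snd P) * (K C c w 0 * bet (fst P) + norm (AA s P))"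
      proof -
        have "norm (complex_of_real (K C c w s * bet (fst P))) = K C c w s * bet (fst P)"
          by (simp only: norm_of_real abs_of_nonneg mult_nonneg_nonneg K_nonneg bet_nonneg)
        also have "\<dots> \<le> K C c w 0 * bet (fst P)" using s by (intro mult_right_mono K_le bet_nonneg) auto
        finally have "norm (of_real (K C c w s * bet (fst P)) + AA s P) \<le> K C c w 0 * bet (fst P) + norm (AA s P)"
          by (intro order_trans[OF norm_triangle_ineq] add_right_mono)
        then show ?thesis
          unfolding leading_def norm_mult norm_of_real abs_of_nonneg[OF gam_nonneg] by (intro mult_left_mono gam_nonneg)
      qed
      then have "ennreal (norm (leading s P)) \<le> ennreal (gam (snd P) * (K C c w 0 * bet (fst P) + norm (AA s P)))"
        by (rule ennreal_leI)
      also have "\<dots> = (ennreal (K C c w 0) * ennreal (bet (fst P)) + ennreal (norm (AA s P))) * ennreal (gam (snd P))"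
        using K_nonneg bet_nonneg gam_nonneg
        by (simp add: ennreal_mult ennreal_plus mult.commute)
      also have "\<dots> \<le> ?f (fst P) * ennreal (gam (snd P))"
      proof (intro mult_right_mono add_left_mono)
        have "ennreal (norm (AA s P)) \<le> ennreal (1 + Z) * VA.W sigA Z P" using s by (intro norm_AA_le) auto
        then show "ennreal (norm (AA s P)) \<le> ennreal (1 + Z) * VA.W sigA Z (fst P, 0)"
          using W_sigA[of Z "fst P" "snd P"] by simp
      qed simp
      finally show "ennreal (norm (leading s P)) \<le> ?f (fst P) * ennreal (gam (snd P))" .
    qed
    also have "\<dots> = (\<integral>\<^sup>+\<xi>. ?f \<xi> \<partial>lborel) * (\<integral>\<^sup>+\<zeta>. ennreal (gam \<zeta>) \<partial>lborel)"
      by (rule nn_integral_prod_mult) measurable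
    finally show "(\<integral>\<^sup>+P. ennreal (norm (leading s P)) \<partial>lborel) \<le> (\<integral>\<^sup>+\<xi>. ?f \<xi> \<partial>lborel)" unfolding g by simp
  qed
qed

text \<open>With \<open>k = \<xi> - \<eta>\<close> the convolution is an average over the
  probability density \<open>bet\<close>, and its distance to the limit is an average of increments:
  one of \<open>C_hat\<close>, one of the phase.\<close>

lemma bet_conv_le:
  assumes s: "0 \<le> s" "s \<le> Z"
  shows "integrable lborel (\<lambda>k. C_hat C k * (of_real (bet (\<xi> - k)) * cis (c * s / w * (k \<bullet> \<zeta>))))"
    and "ennreal (norm ((LINT k|lborel. C_hat C k * (of_real (bet (\<xi> - k)) * cis (c * s / w * (k \<bullet> \<zeta>)))) - C_hat C \<xi> * cis (c * s / w * (\<xi> \<bullet> \<zeta>)))) \<le> conv_error (sqrt 2 * rho) Z eps (\<xi>, \<zeta>)"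
proof -
  let ?f = "\<lambda>k. C_hat C k * (of_real (bet (\<xi> - k)) * cis (c * s / w * (k \<bullet> \<zeta>)))"
  let ?cs = "C_hat C \<xi> * cis (c * s / w * (\<xi> \<bullet> \<zeta>))"
  let ?g = "\<lambda>\<eta>. C_hat C (\<xi> - \<eta>) * (of_real (bet \<eta>) * cis (c * s / w * ((\<xi> - \<eta>) \<bullet> \<zeta>)))"
  have rho': "0 < sqrt 2 * rho" using rho_pos by simp
  show "integrable lborel ?f"
  proof (rule Bochner_Integration.integrable_bound)
    \<comment> \<open>Bounding the Gaussian by its maximum is not uniform in \<open>eps\<close>, but
      only integrability is at stake. After the reflection the roles are exchanged:
      \<open>C_hat\<close> is bounded and the Gaussian integrated.\<close>
    show "integrable lborel (\<lambda>k. (sqrt 2 * rho)\<^sup>2 / (2 * pi * eps\<^sup>2) * ch k)" using ch_integrable by simp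
    show "AE k in lborel. norm (?f k) \<le> norm ((sqrt 2 * rho)\<^sup>2 / (2 * pi * eps\<^sup>2) * ch k)"
    proof (rule AE_I2)
      fix k
      have "bet (\<xi> - k) \<le> (sqrt 2 * rho)\<^sup>2 / (2 * pi * eps\<^sup>2)" unfolding bet_def by (rule phi_le)
      then have "bet (\<xi> - k) * ch k \<le> (sqrt 2 * rho)\<^sup>2 / (2 * pi * eps\<^sup>2) * ch k"
        by (intro mult_right_mono ch_nonneg)
      moreover have "norm (?f k) = bet (\<xi> - k) * ch k"
        using ch_nonneg bet_nonneg by (simp add: norm_mult C_hat_eq mult.commute)
      ultimately show "norm (?f k) \<le> norm ((sqrt 2 * rho)\<^sup>2 / (2 * pi * eps\<^sup>2) * ch k)"
        unfolding real_norm_def by linarith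
    qed
  qed measurable
  have g: "integrable lborel ?g"
  proof (rule Bochner_Integration.integrable_bound)
    show "integrable lborel (\<lambda>\<eta>. (LINT x|lborel. \<bar>C x\<bar>) * bet \<eta>)"
      unfolding bet_def using phi_integrable(1)[OF eps_pos rho'] by simp
    show "AE \<eta> in lborel. norm (?g \<eta>) \<le> norm ((LINT x|lborel. \<bar>C x\<bar>) * bet \<eta>)"
    proof (rule AE_I2)
      fix \<eta>
      have "ch (\<xi> - \<eta>) * bet \<eta> \<le> (LINT x|lborel. \<bar>C x\<bar>) * bet \<eta>"
        by (intro mult_right_mono norm_C_hat_le bet_nonneg)
      moreover have "norm (?g \<eta>) = ch (\<xi> - \<eta>) * bet \<eta>"
        using ch_nonneg bet_nonneg by (simp add: norm_mult C_hat_eq)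
      ultimately show "norm (?g \<eta>) \<le> norm ((LINT x|lborel. \<bar>C x\<bar>) * bet \<eta>)"
        unfolding real_norm_def by linarith
    qed
  qed measurable
  have i: "integrable lborel (\<lambda>\<eta>. of_real (bet \<eta>) * ?cs)"
    unfolding bet_def using phi_integrable(1)[OF eps_pos rho'] by (intro integrable_mult_left integrable_of_real)
  have fm: "?f \<in> borel_measurable borel" by measurable
  have "(LINT k|lborel. ?f k) = (LINT \<eta>|lborel. ?g \<eta>)"
    using lint_lborel_affine[OF fm, of "- 1" \<xi>] by simp
  moreover have "?cs = (LINT \<eta>|lborel. of_real (bet \<eta>) * ?cs)"
  proof -
    have "(LINT \<eta>|lborel. complex_of_real (bet \<eta>) * ?cs) = of_real (LINT \<eta>|lborel. bet \<eta>) * ?cs"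
      by (simp only: integral_mult_left_zero integral_complex_of_real)
    also have "(LINT \<eta>|lborel. bet \<eta>) = 1" unfolding bet_def by (rule phi_integrable(2)[OF eps_pos rho'])
    finally show ?thesis by simp
  qed
  ultimately have "(LINT k|lborel. ?f k) - ?cs = (LINT \<eta>|lborel. ?g \<eta> - of_real (bet \<eta>) * ?cs)"
    using Bochner_Integration.integral_diff[OF g i] by simp
  then have "ennreal (norm ((LINT k|lborel. ?f k) - ?cs)) \<le> (\<integral>\<^sup>+\<eta>. ennreal (norm (?g \<eta> - of_real (bet \<eta>) * ?cs)) \<partial>lborel)"
    using norm_lint_le[of lborel "\<lambda>\<eta>. ?g \<eta> - of_real (bet \<eta>) * ?cs"] by simp
  also have "\<dots> \<le> conv_error (sqrt 2 * rho) Z eps (\<xi>, \<zeta>)"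
    unfolding conv_error_def fst_conv snd_conv bet_def[symmetric]
  proof (rule nn_integral_mono)
    fix \<eta>
    let ?x = "cis (c * s / w * ((\<xi> - \<eta>) \<bullet> \<zeta>))" and ?y = "cis (c * s / w * (\<xi> \<bullet> \<zeta>))"
    have "?g \<eta> - of_real (bet \<eta>) * ?cs = of_real (bet \<eta>) * (of_real (ch (\<xi> - \<eta>) - ch \<xi>) * ?x + of_real (ch \<xi>) * (?x - ?y))"
      by (simp add: C_hat_eq algebra_simps)
    then have "norm (?g \<eta> - of_real (bet \<eta>) * ?cs) \<le> bet \<eta> * (norm (of_real (ch (\<xi> - \<eta>) - ch \<xi>) * ?x) + norm (of_real (ch \<xi>) * (?x - ?y)))"
      using bet_nonneg by (simp only: norm_mult[of "of_real (bet \<eta>)"] norm_of_real abs_of_nonneg) (intro mult_left_mono norm_triangle_ineq)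
    also have "\<dots> = bet \<eta> * (\<bar>ch \<xi> - ch (\<xi> - \<eta>)\<bar> + ch \<xi> * norm (?x - ?y))"
      using ch_nonneg by (simp only: norm_mult norm_of_real norm_cis mult_1_right abs_of_nonneg abs_minus_commute)
    also have "\<dots> \<le> bet \<eta> * (\<bar>ch \<xi> - ch (\<xi> - \<eta>)\<bar> + ch \<xi> * min 2 (c * Z / w * (norm \<eta> * norm \<zeta>)))"
    proof (intro mult_left_mono add_left_mono bet_nonneg ch_nonneg)
      have "norm (?x - ?y) \<le> min 2 \<bar>c * s / w * ((\<xi> - \<eta>) \<bullet> \<zeta>) - c * s / w * (\<xi> \<bullet> \<zeta>)\<bar>" by (rule norm_cis_diff_le)
      also have "c * s / w * ((\<xi> - \<eta>) \<bullet> \<zeta>) - c * s / w * (\<xi> \<bullet> \<zeta>) = - (c * s / w * (\<eta> \<bullet> \<zeta>))"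
        by (simp add: inner_diff_left right_diff_distrib)
      also have "\<bar>- (c * s / w * (\<eta> \<bullet> \<zeta>))\<bar> = c * s / w * \<bar>\<eta> \<bullet> \<zeta>\<bar>" using c_pos w_pos s by (simp add: abs_mult)
      also have "min 2 (c * s / w * \<bar>\<eta> \<bullet> \<zeta>\<bar>) \<le> min 2 (c * Z / w * (norm \<eta> * norm \<zeta>))"
        using c_pos w_pos s
        by (intro min.mono order_refl mult_mono Cauchy_Schwarz_ineq2 divide_right_mono) auto
      finally show "norm (?x - ?y) \<le> min 2 (c * Z / w * (norm \<eta> * norm \<zeta>))" .
    qed
    finally have "ennreal (norm (?g \<eta> - of_real (bet \<eta>) * ?cs))
      \<le> ennreal (bet \<eta> * (\<bar>ch \<xi> - ch (\<xi> - \<eta>)\<bar> + ch \<xi> * min 2 (c * Z / w * (norm \<eta> * norm \<zeta>))))"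
      by (rule ennreal_leI)
    then show "ennreal (norm (?g \<eta> - of_real (bet \<eta>) * ?cs))
      \<le> ennreal (bet \<eta>) * ennreal (\<bar>ch \<xi> - ch (\<xi> - \<eta>)\<bar> + ch \<xi> * min 2 (c * Z / w * (norm \<eta> * norm \<zeta>)))"
      by (simp only: ennreal_mult'[OF bet_nonneg])
  qed
  finally show "ennreal (norm ((LINT k|lborel. ?f k) - ?cs)) \<le> conv_error (sqrt 2 * rho) Z eps (\<xi>, \<zeta>)" .
qed

text \<open>Consistency of the ansatz. \<open>leading z P\<close> is expanded through its own
  equations, \<open>K\<close> by integrating its decay and \<open>AA\<close> by its Volterra
  equation, so that all but the phase error of the initial term stands under one integral, whose
  integrand falls under \<open>norm_combination_le\<close>.\<close>

lemma leading_error: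
  assumes z: "0 \<le> z" "z \<le> Z" and W: "\<And>y. 0 \<le> y \<Longrightarrow> VA.W sigA y P < \<infinity> \<and> VA.dom (VA.W sigA y) P < \<infinity>"
    and fV: "(\<integral>\<^sup>+s\<in>{0..z}. VE.dom (\<lambda>Q. ennreal (norm (leading s Q))) P \<partial>lborel) < \<infinity>"
  shows "ennreal (norm (cis (z * psi eps P) * of_real (K C c w 0 * bet (fst P) * gam (snd P))
      + (LINT s:{0..z}|lborel. cis ((z - s) * psi eps P) * VE.gen s (leading s) P) - leading z P))
     \<le> error_bound (r / sqrt 2) (sqrt 2 * rho) Z eps P"
proof -
  obtain \<xi> \<zeta> where P: "P = (\<xi>, \<zeta>)" by (cases P)
  have Z: "0 \<le> Z" using z by simp
  define \<beta> \<gamma> K0 where "\<beta> = bet \<xi>" and "\<gamma> = gam \<zeta>" and "K0 = K C c w 0"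
  have nn: "0 \<le> \<beta>" "0 \<le> \<gamma>" "0 \<le> K0" "0 \<le> kap" "0 \<le> lam"
    using kap_pos lam_nonneg by (auto simp: \<beta>_def \<gamma>_def K0_def bet_nonneg gam_nonneg K_nonneg)
  define a where "a s = (LINT k|lborel. C_hat C k * (AA s (\<xi> - k, \<zeta>) * cis (c * s / w * (k \<bullet> \<zeta>))))" for s
  define b where "b s = (LINT k|lborel. C_hat C k * (of_real (bet (\<xi> - k)) * cis (c * s / w * (k \<bullet> \<zeta>))))" for s
  define cs where "cs s = C_hat C \<xi> * cis (c * s / w * (\<xi> \<bullet> \<zeta>))" for s
  define u where "u s = cis ((z - s) * psi eps P)" for s
  define v where "v s = cis ((z - s) * theta0 P)" for s
  have AAm: "AA s \<in> borel_measurable borel" for s by (rule VA.section_measurable[OF AA_measurable])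
  have dA: "VA.dom (\<lambda>Q. ennreal (norm (AA s Q))) (\<xi>, \<zeta>) \<le> ennreal (1 + Z) * VA.dom (VA.W sigA Z) P" if "0 \<le> s" "s \<le> Z" for s
  proof -
    have "VA.dom (\<lambda>Q. ennreal (norm (AA s Q))) (\<xi>, \<zeta>) \<le> VA.dom (\<lambda>Q. ennreal (1 + Z) * VA.W sigA Z Q) (\<xi>, \<zeta>)"
      by (intro VA.dom_mono norm_AA_le that)
    then show ?thesis by (simp add: VA.dom_cmult P)
  qed
  have dAf: "ennreal (1 + Z) * VA.dom (VA.W sigA Z) P < \<infinity>"
    using W[OF Z] by (simp add: ennreal_mult_less_top del: ennreal_plus)
  have dA': "VA.dom (\<lambda>Q. ennreal (norm (AA s Q))) (\<xi>, \<zeta>) < \<infinity>" if "0 \<le> s" "s \<le> Z" for s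
    using dA[OF that] dAf by (rule le_less_trans)
  \<comment> \<open>Gain and loss acting on \<open>A\<close> are bounded by the majorant at the
    endpoint \<open>Z\<close>, hence by a quantity free of \<open>s\<close> and of
    \<open>\<zeta>\<close>; it is the first summand of \<open>Y\<close>.\<close>
  have aA: "kap * norm (a s) + lam * norm (AA s P) \<le> (1 + Z) * enn2real (VA.dom (VA.W sigA Z) (\<xi>, 0))" if s: "0 \<le> s" "s \<le> Z" for s
  proof -
    have "ennreal (kap * norm (a s) + lam * norm (AA s P)) \<le> ennreal (1 + Z) * VA.dom (VA.W sigA Z) P"
      unfolding a_def P using C_hat_mult_integrable(2)[OF AAm dA'[OF s]] dA[OF s] unfolding P by (rule order_trans)
    also have "VA.dom (VA.W sigA Z) P = VA.dom (VA.W sigA Z) (\<xi>, 0)" unfolding P by (rule dom_W_sigA)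
    also have "VA.dom (VA.W sigA Z) (\<xi>, 0) = ennreal (enn2real (VA.dom (VA.W sigA Z) (\<xi>, 0)))"
      using W[OF Z] unfolding P by (simp add: dom_W_sigA[of Z \<xi> \<zeta>])
    also have "ennreal (1 + Z) * \<dots> = ennreal ((1 + Z) * enn2real (VA.dom (VA.W sigA Z) (\<xi>, 0)))"
      using Z by (simp add: ennreal_mult del: ennreal_plus)
    finally show ?thesis using Z by (subst (asm) ennreal_le_iff) auto
  qed
  have genA: "VA.gen s (AA s) P = of_real kap * a s - of_real lam * AA s P" for s
  proof -
    have "(LINT k|lborel. HA s P k * AA s (P - (k, 0))) = (LINT k|lborel. of_real kap * (C_hat C k * (AA s (\<xi> - k, \<zeta>) * cis (c * s / w * (k \<bullet> \<zeta>)))))"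
      by (intro Bochner_Integration.integral_cong refl) (simp add: HA_def P)
    then show ?thesis unfolding VA.gen_def a_def by (simp only: integral_mult_right_zero scaleR_conv_of_real)
  qed
  have genV: "VE.gen s (leading s) P = of_real \<gamma> * (of_real (K C c w s) * (of_real kape * b s - of_real lame * of_real \<beta>)
      + (of_real kape * a s - of_real lame * AA s P))" if s: "0 \<le> s" "s \<le> Z" for s
  proof -
    let ?A = "\<lambda>k. C_hat C k * (AA s (\<xi> - k, \<zeta>) * cis (c * s / w * (k \<bullet> \<zeta>)))"
    let ?B = "\<lambda>k. C_hat C k * (of_real (bet (\<xi> - k)) * cis (c * s / w * (k \<bullet> \<zeta>)))"
    have iA: "integrable lborel ?A" by (rule C_hat_mult_integrable(1)[OF AAm dA'[OF s]])
    have iB: "integrable lborel (\<lambda>k. of_real (K C c w s) * ?B k)"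
      by (rule integrable_mult_right) (rule bet_conv_le(1)[OF s])
    have "(LINT k|lborel. HE s P k * leading s (P - (k, 0))) = (LINT k|lborel. of_real (kape * \<gamma>) * (of_real (K C c w s) * ?B k + ?A k))"
      by (intro Bochner_Integration.integral_cong refl) (simp add: HE_def leading_def P \<gamma>_def algebra_simps)
    also have "\<dots> = of_real (kape * \<gamma>) * (of_real (K C c w s) * b s + a s)"
      unfolding integral_mult_right_zero Bochner_Integration.integral_add[OF iB iA] a_def b_def ..
    finally show ?thesis unfolding VE.gen_def by (simp add: leading_def P \<beta>_def \<gamma>_def scaleR_conv_of_real algebra_simps)
  qed
  \<comment> \<open>Integrand of the residual with the common factor \<open>\<gamma>\<close> taken
    out: exact evolution of the ansatz, decay of \<open>K\<close>, source of \<open>A\<close>,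
    evolution of \<open>A\<close>.\<close>
  define G where "G s = u s * (of_real (K C c w s) * (of_real kape * b s - of_real lame * of_real \<beta>)
        + (of_real kape * a s - of_real lame * AA s P))
      + of_real (lam * K C c w s * \<beta>) - v s * (of_real (kap * K C c w s) * cs s) - v s * (of_real kap * a s - of_real lam * AA s P)" for s
  \<comment> \<open>Bound for the integrand that does not depend on \<open>s\<close>, so that
    integrating it costs only a factor \<open>Z\<close>.\<close>
  define E where "E = ennreal (\<gamma> * (K0 * \<beta> * lam * (de eps + mu1 Z eps P) + (de eps + mu2 Z eps P) * Y Z \<xi>))
      + ennreal (\<gamma> * (K0 * kap)) * conv_error (sqrt 2 * rho) Z eps P"
  have G: "ennreal (norm (of_real \<gamma> * G s)) \<le> E" if s: "0 \<le> s" "s \<le> z" for s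
  proof -
    have sZ: "0 \<le> s" "s \<le> Z" using s z by auto
    have Ks: "0 \<le> K C c w s" "K C c w s \<le> K0" using K_nonneg K_le[OF s(1)] by (auto simp: K0_def)
    have "norm (u s - 1) \<le> min 2 \<bar>(z - s) * psi eps P - 0\<bar>"
      unfolding u_def using norm_cis_diff_le[of "(z - s) * psi eps P" 0] by simp
    also have "\<dots> \<le> mu1 Z eps P"
      unfolding mu1_def using s z by (intro min.mono order_refl) (auto simp: abs_mult intro!: mult_right_mono)
    finally have u1: "norm (u s - 1) \<le> mu1 Z eps P" .
    have "norm (u s - v s) \<le> min 2 \<bar>(z - s) * psi eps P - (z - s) * theta0 P\<bar>"
      unfolding u_def v_def by (rule norm_cis_diff_le)
    also have "(z - s) * psi eps P - (z - s) * theta0 P = (z - s) * (psi eps P - theta0 P)" by (simp add: right_diff_distrib)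
    also have "min 2 \<bar>(z - s) * (psi eps P - theta0 P)\<bar> \<le> mu2 Z eps P"
      unfolding mu2_def using s z by (intro min.mono order_refl) (auto simp: abs_mult intro!: mult_right_mono)
    finally have uv: "norm (u s - v s) \<le> mu2 Z eps P" .
    have csn: "norm (cs s) = ch \<xi>" using ch_nonneg by (simp add: cs_def norm_mult C_hat_eq)
    have m: "0 \<le> de eps + mu1 Z eps P" "0 \<le> de eps + mu2 Z eps P"
      using de_bounds mu_bounds(1,2)[OF Z] by (auto intro: add_nonneg_nonneg)
    have "norm (G s) \<le> K C c w s * \<beta> * lam * (de eps + mu1 Z eps P)
        + (de eps + mu2 Z eps P) * (kap * norm (a s) + lam * norm (AA s P) + K C c w s * kap * norm (cs s)) + K C c w s * kap * norm (b s - cs s)"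
      unfolding G_def kape_def lame_def
      by (rule norm_combination_le) (use nn Ks de_bounds u1 uv in \<open>simp_all add: u_def\<close>)
    also have "\<dots> \<le> K0 * \<beta> * lam * (de eps + mu1 Z eps P) + (de eps + mu2 Z eps P) * Y Z \<xi> + K0 * kap * norm (b s - cs s)"
    proof (intro add_mono mult_right_mono mult_left_mono Ks nn m)
      have "K C c w s * kap * norm (cs s) \<le> K0 * kap * ch \<xi>"
        unfolding csn by (intro mult_right_mono Ks nn ch_nonneg)
      then show "kap * norm (a s) + lam * norm (AA s P) + K C c w s * kap * norm (cs s) \<le> Y Z \<xi>"
        using aA[OF sZ] unfolding Y_def K0_def by linarith
    qed (use nn in auto)
    finally have "norm (of_real \<gamma> * G s) \<le> \<gamma> * (K0 * \<beta> * lam * (de eps + mu1 Z eps P) + (de eps + mu2 Z eps P) * Y Z \<xi> + K0 * kap * norm (b s - cs s))"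
      unfolding norm_mult norm_of_real abs_of_nonneg[OF nn(2)] by (rule mult_left_mono[OF _ nn(2)])
    then have "ennreal (norm (of_real \<gamma> * G s)) \<le> ennreal (\<gamma> * (K0 * \<beta> * lam * (de eps + mu1 Z eps P) + (de eps + mu2 Z eps P) * Y Z \<xi> + K0 * kap * norm (b s - cs s)))"
      by (rule ennreal_leI)
    also have "\<dots> = ennreal (\<gamma> * (K0 * \<beta> * lam * (de eps + mu1 Z eps P) + (de eps + mu2 Z eps P) * Y Z \<xi>)) + ennreal (\<gamma> * (K0 * kap)) * ennreal (norm (b s - cs s))"
    proof -
      have "0 \<le> \<gamma> * (K0 * \<beta> * lam * (de eps + mu1 Z eps P) + (de eps + mu2 Z eps P) * Y Z \<xi>)"
        by (intro mult_nonneg_nonneg add_nonneg_nonneg nn m Y_nonneg[OF Z])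
      then show ?thesis using nn
        by (subst ennreal_mult[symmetric]) (auto simp: ennreal_plus[symmetric] distrib_left mult.assoc simp del: ennreal_plus)
    qed
    also have "\<dots> \<le> E"
      unfolding E_def b_def cs_def P by (intro add_left_mono mult_left_mono bet_conv_le(2)[OF sZ]) simp
    finally show ?thesis .
  qed
  have fA: "(\<integral>\<^sup>+s\<in>{0..z}. VA.dom (\<lambda>Q. ennreal (norm (AA s Q))) P \<partial>lborel) < \<infinity>"
    using W[OF z(1)] by (intro AA_dom_finite) auto
  have i1: "set_integrable lborel {0..z} (\<lambda>s. u s * VE.gen s (leading s) P)"
    unfolding u_def by (rule VE.gen_set_integrable[OF leading_measurable fV])
  have i2: "set_integrable lborel {0..z} (\<lambda>s. of_real (\<gamma> * \<beta>) * complex_of_real (lam * K C c w s))"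
  proof (rule set_integrable_bounded_Icc[where B="ennreal (\<gamma> * \<beta> * (lam * K0))"])
    show "ennreal (norm (of_real (\<gamma> * \<beta>) * complex_of_real (lam * K C c w s))) \<le> ennreal (\<gamma> * \<beta> * (lam * K0))" if "0 \<le> s" for s
    proof (rule ennreal_leI)
      have "norm (of_real (\<gamma> * \<beta>) * complex_of_real (lam * K C c w s)) = \<gamma> * \<beta> * (lam * K C c w s)"
        unfolding norm_mult norm_of_real using nn K_nonneg[of s] by (simp add: abs_mult)
      also have "\<dots> \<le> \<gamma> * \<beta> * (lam * K0)" unfolding K0_def using that nn by (intro mult_left_mono K_le) auto
      finally show "norm (of_real (\<gamma> * \<beta>) * complex_of_real (lam * K C c w s)) \<le> \<gamma> * \<beta> * (lam * K0)" .
    qed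
  qed simp_all
  have i3: "set_integrable lborel {0..z} (\<lambda>s. of_real \<gamma> * (v s * QA s P))"
    unfolding v_def by (rule set_integrable_mult_right) (rule VA.src_set_integrable[OF QA_measurable norm_QA_le])
  have i4: "set_integrable lborel {0..z} (\<lambda>s. of_real \<gamma> * (v s * VA.gen s (AA s) P))"
    unfolding v_def by (rule set_integrable_mult_right) (rule VA.gen_set_integrable[OF AA_measurable fA])
  have "leading z P = of_real \<gamma> * (of_real (K C c w z * \<beta>) + (VA.src QA z P + (LINT s:{0..z}|lborel. v s * VA.gen s (AA s) P)))"
    using AA_eq[OF z(1), of P] W[OF z(1)] by (simp add: leading_def P \<gamma>_def \<beta>_def v_def)
  moreover have "complex_of_real (K C c w z) = of_real K0 - (LINT s:{0..z}|lborel. complex_of_real (lam * K C c w s))"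
    unfolding K_integral[OF z(1)] by (simp add: K0_def)
  ultimately have Vz: "leading z P = of_real (K0 * \<beta> * \<gamma>) - of_real (\<gamma> * \<beta>) * (LINT s:{0..z}|lborel. complex_of_real (lam * K C c w s))
      + of_real \<gamma> * (LINT s:{0..z}|lborel. v s * QA s P) + of_real \<gamma> * (LINT s:{0..z}|lborel. v s * VA.gen s (AA s) P)"
    unfolding VA.src_def v_def[symmetric] by (simp add: algebra_simps)
  have Gs: "u s * VE.gen s (leading s) P + of_real (\<gamma> * \<beta>) * complex_of_real (lam * K C c w s) - of_real \<gamma> * (v s * QA s P) - of_real \<gamma> * (v s * VA.gen s (AA s) P)
     = of_real \<gamma> * G s" if "s \<in> {0..z}" for s
  proof -
    have q: "QA s P = of_real (kap * K C c w s) * cs s" by (simp add: QA_def P cs_def scaleR_conv_of_real)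
    have gV: "VE.gen s (leading s) P = of_real \<gamma> * (of_real (K C c w s) * (of_real kape * b s - of_real lame * of_real \<beta>)
      + (of_real kape * a s - of_real lame * AA s P))" using that z by (intro genV) auto
    show ?thesis unfolding G_def q genA gV by (simp add: algebra_simps)
  qed
  have "(LINT s:{0..z}|lborel. of_real \<gamma> * G s) = (LINT s:{0..z}|lborel. u s * VE.gen s (leading s) P + of_real (\<gamma> * \<beta>) * complex_of_real (lam * K C c w s) - of_real \<gamma> * (v s * QA s P) - of_real \<gamma> * (v s * VA.gen s (AA s) P))"
    by (rule set_lebesgue_integral_cong) (simp, intro allI impI Gs[symmetric])
  also have "\<dots> = (LINT s:{0..z}|lborel. u s * VE.gen s (leading s) P) + (LINT s:{0..z}|lborel. of_real (\<gamma> * \<beta>) * complex_of_real (lam * K C c w s))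
      - (LINT s:{0..z}|lborel. of_real \<gamma> * (v s * QA s P)) - (LINT s:{0..z}|lborel. of_real \<gamma> * (v s * VA.gen s (AA s) P))"
    by (simp only: set_integral_diff(2)[OF set_integral_diff(1)[OF set_integral_add(1)[OF i1 i2] i3] i4]
        set_integral_diff(2)[OF set_integral_add(1)[OF i1 i2] i3] set_integral_add(2)[OF i1 i2])
  finally have IG: "(LINT s:{0..z}|lborel. of_real \<gamma> * G s) = (LINT s:{0..z}|lborel. u s * VE.gen s (leading s) P)
      + of_real (\<gamma> * \<beta>) * (LINT s:{0..z}|lborel. complex_of_real (lam * K C c w s))
      - of_real \<gamma> * (LINT s:{0..z}|lborel. v s * QA s P) - of_real \<gamma> * (LINT s:{0..z}|lborel. v s * VA.gen s (AA s) P)"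
    by (simp only: set_integral_mult_right)
  \<comment> \<open>Outside the integral remains only the phase acquired by the unscattered initial
    beam.\<close>
  have "cis (z * psi eps P) * of_real (K C c w 0 * bet (fst P) * gam (snd P))
      + (LINT s:{0..z}|lborel. cis ((z - s) * psi eps P) * VE.gen s (leading s) P) - leading z P
     = of_real (K0 * \<beta> * \<gamma>) * (cis (z * psi eps P) - 1) + (LINT s:{0..z}|lborel. of_real \<gamma> * G s)"
    unfolding IG Vz u_def by (simp add: P K0_def \<beta>_def \<gamma>_def algebra_simps)
  then have "ennreal (norm (cis (z * psi eps P) * of_real (K C c w 0 * bet (fst P) * gam (snd P))
      + (LINT s:{0..z}|lborel. cis ((z - s) * psi eps P) * VE.gen s (leading s) P) - leading z P))
     \<le> ennreal (norm (of_real (K0 * \<beta> * \<gamma>) * (cis (z * psi eps P) - 1)) + norm (LINT s:{0..z}|lborel. of_real \<gamma> * G s))"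
    by (simp only:) (intro ennreal_leI norm_triangle_ineq)
  also have "\<dots> = ennreal (norm (of_real (K0 * \<beta> * \<gamma>) * (cis (z * psi eps P) - 1))) + ennreal (norm (LINT s:{0..z}|lborel. of_real \<gamma> * G s))"
    by (rule ennreal_plus) auto
  also have "\<dots> \<le> ennreal (K0 * \<beta> * \<gamma> * mu1 Z eps P) + ennreal Z * E"
  proof (rule add_mono)
    have "norm (cis (z * psi eps P) - 1) \<le> min 2 \<bar>z * psi eps P\<bar>" using norm_cis_diff_le[of "z * psi eps P" 0] by simp
    also have "\<dots> \<le> mu1 Z eps P"
      unfolding mu1_def using z by (intro min.mono order_refl) (auto simp: abs_mult intro!: mult_right_mono)
    finally have "K0 * \<beta> * \<gamma> * norm (cis (z * psi eps P) - 1) \<le> K0 * \<beta> * \<gamma> * mu1 Z eps P"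
      using nn by (intro mult_left_mono) auto
    then show "ennreal (norm (of_real (K0 * \<beta> * \<gamma>) * (cis (z * psi eps P) - 1))) \<le> ennreal (K0 * \<beta> * \<gamma> * mu1 Z eps P)"
      unfolding norm_mult norm_of_real using nn by (intro ennreal_leI) (simp add: abs_mult)
    have "ennreal (norm (LINT s:{0..z}|lborel. of_real \<gamma> * G s)) \<le> (\<integral>\<^sup>+s\<in>{0..z}. ennreal (norm (of_real \<gamma> * G s)) \<partial>lborel)"
      by (rule norm_set_lint_le)
    also have "\<dots> \<le> (\<integral>\<^sup>+s. E * indicator {0..z} s \<partial>lborel)"
      by (intro nn_integral_mono) (auto split: split_indicator intro: G)
    also have "\<dots> = ennreal z * E" using z by (simp add: nn_integral_cmult_indicator mult.commute)
    also have "\<dots> \<le> ennreal Z * E" using z by (intro mult_right_mono ennreal_leI) auto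
    finally show "ennreal (norm (LINT s:{0..z}|lborel. of_real \<gamma> * G s)) \<le> ennreal Z * E" .
  qed
  also have "\<dots> \<le> error_bound (r / sqrt 2) (sqrt 2 * rho) Z eps P"
  proof -
    define x y where "x = \<gamma> * (\<beta> * (de eps + mu1 Z eps P))" and "y = \<gamma> * (Y Z \<xi> * (de eps + mu2 Z eps P))"
    have m: "0 \<le> de eps + mu1 Z eps P" "0 \<le> de eps + mu2 Z eps P"
      using de_bounds mu_bounds(1,2)[OF Z] by (auto intro: add_nonneg_nonneg)
    have xy: "0 \<le> x" "0 \<le> y" unfolding x_def y_def by (intro mult_nonneg_nonneg nn m Y_nonneg[OF Z])+
    have "K0 * \<beta> * \<gamma> * mu1 Z eps P \<le> K0 * x"
      unfolding x_def using nn de_bounds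
      by (simp add: mult.assoc mult.left_commute[of \<beta> \<gamma>] mult_left_mono)
    then have 1: "ennreal (K0 * \<beta> * \<gamma> * mu1 Z eps P) \<le> ennreal (K0 * x)" by (rule ennreal_leI)
    have E: "E = ennreal (K0 * lam * x) + ennreal y + ennreal (K0 * kap) * E3 (r / sqrt 2) (sqrt 2 * rho) Z eps P"
    proof -
      have "\<gamma> * (K0 * \<beta> * lam * (de eps + mu1 Z eps P) + (de eps + mu2 Z eps P) * Y Z \<xi>) = K0 * lam * x + y"
        unfolding x_def y_def by (simp add: algebra_simps)
      moreover have "ennreal (\<gamma> * (K0 * kap)) = ennreal (K0 * kap) * ennreal \<gamma>"
        using nn by (simp add: ennreal_mult[symmetric] mult.commute)
      ultimately show ?thesis
        unfolding E_def E3_def gam_def[symmetric] using xy nn by (simp add: P \<gamma>_def mult.assoc)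
    qed
    have "ennreal (K0 * \<beta> * \<gamma> * mu1 Z eps P) + ennreal Z * E
      \<le> ennreal (K0 * x) + ennreal Z * (ennreal (K0 * lam * x) + ennreal y + ennreal (K0 * kap) * E3 (r / sqrt 2) (sqrt 2 * rho) Z eps P)"
      unfolding E by (intro add_right_mono 1)
    also have "\<dots> = (ennreal (K0 * x) + ennreal (Z * (K0 * lam * x))) + ennreal Z * ennreal y
       + ennreal (Z * (K0 * kap)) * E3 (r / sqrt 2) (sqrt 2 * rho) Z eps P"
      using Z nn xy by (simp add: distrib_left ennreal_mult add.assoc mult.assoc)
    also have "ennreal (K0 * x) + ennreal (Z * (K0 * lam * x)) = ennreal (K0 * (1 + Z * lam)) * ennreal x"
      using Z nn xy by (simp add: ennreal_mult[symmetric] ennreal_plus[symmetric] algebra_simps del: ennreal_plus)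
    also have "ennreal x = E1 (r / sqrt 2) (sqrt 2 * rho) Z eps P"
      by (simp add: E1_def x_def P \<gamma>_def \<beta>_def gam_def bet_def)
    also have "ennreal y = E2 (r / sqrt 2) Z eps P"
      by (simp add: E2_def y_def P \<gamma>_def gam_def)
    finally show ?thesis unfolding error_bound_def K0_def by (simp only: mult.assoc)
  qed
  finally show ?thesis .
qed

text \<open>Stability: exact path and ansatz obey the same equation up to
  \<open>error_bound\<close>, so their difference satisfies the Volterra inequality with that
  source.\<close>

lemma rescaled_leading_le:
  assumes m: "M1_mild_fourier (\<lambda>x. eps * C x) c (r / eps) (rho / eps) (w + eps * Om) (w - eps * Om) m"
    and z: "0 \<le> z" "z \<le> Z"
  shows "(\<integral>\<^sup>+P. ennreal (norm (rescaled m z P - leading z P)) \<partial>lborel)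
    \<le> 2 * (\<integral>\<^sup>+P. error_bound (r / sqrt 2) (sqrt 2 * rho) Z eps P \<partial>lborel) * ennreal (exp (2 * (VE.L + 1) * Z))"
proof -
  have path: "L1_path m" using m by (simp add: M1_mild_fourier_def)
  note rm = rescaled_measurable[OF path]
  obtain B1 where B1: "\<forall>s\<in>{0..Z}. (\<integral>\<^sup>+Q. ennreal (norm (rescaled m s Q)) \<partial>lborel) \<le> ennreal B1"
    using rescaled_bounded[OF path] by blast
  obtain B2 where B2: "B2 < \<infinity>" "\<forall>s\<in>{0..Z}. (\<integral>\<^sup>+P. ennreal (norm (leading s P)) \<partial>lborel) \<le> B2"
    using leading_bounded[of Z] z by auto
  let ?D = "\<lambda>s Q. ennreal (norm (rescaled m s Q - leading s Q))"
  have um: "(\<lambda>(s, P). ennreal (norm (f s P))) \<in> borel_measurable (borel \<Otimes>\<^sub>M borel)"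
    if "(\<lambda>(s, P). f s P) \<in> borel_measurable (borel \<Otimes>\<^sub>M borel)" for f :: "real \<Rightarrow> R2 \<times> R2 \<Rightarrow> complex"
    using that by (simp add: split_beta')
  show ?thesis
  proof (rule VE.path_gronwall[where B="ennreal B1 + B2"])
    show "(\<lambda>(s, P). ?D s P) \<in> borel_measurable (borel \<Otimes>\<^sub>M borel)"
      using rm leading_measurable by (simp add: split_beta')
    fix y assume y: "0 \<le> y" "y \<le> Z"
    note meas = VE.section_measurable[OF um[OF rm], of y] VE.section_measurable[OF um[OF leading_measurable], of y]
    have "(\<integral>\<^sup>+P. ?D y P \<partial>lborel) \<le> (\<integral>\<^sup>+P. ennreal (norm (rescaled m y P)) + ennreal (norm (leading y P)) \<partial>lborel)"
      by (intro nn_integral_mono) (simp add: ennreal_plus[symmetric] norm_triangle_ineq4 del: ennreal_plus)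
    also have "\<dots> = (\<integral>\<^sup>+P. ennreal (norm (rescaled m y P)) \<partial>lborel) + (\<integral>\<^sup>+P. ennreal (norm (leading y P)) \<partial>lborel)"
      by (rule nn_integral_add) (simp_all only: measurable_lborel2 meas)
    also have "\<dots> \<le> ennreal B1 + B2" using B1 B2 y by (intro add_mono) auto
    finally show "(\<integral>\<^sup>+P. ?D y P \<partial>lborel) \<le> ennreal B1 + B2" .
    have f1: "AE P in lborel. (\<integral>\<^sup>+s\<in>{0..y}. VE.dom (\<lambda>Q. ennreal (norm (rescaled m s Q))) P \<partial>lborel) < \<infinity>"
      by (rule VE.AE_path_dom_finite[OF um[OF rm], of y "ennreal B1"]) (use B1 y in auto)
    have f2: "AE P in lborel. (\<integral>\<^sup>+s\<in>{0..y}. VE.dom (\<lambda>Q. ennreal (norm (leading s Q))) P \<partial>lborel) < \<infinity>"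
      by (rule VE.AE_path_dom_finite[OF um[OF leading_measurable], of y B2]) (use B2 y in auto)
    \<comment> \<open>The majorants of \<open>A\<close> do not depend on the second component, so
      finiteness on the slice at 0 lifts to almost every point of the product.\<close>
    have f3: "AE P in lborel. \<forall>z\<ge>0. VA.W sigA z P < \<infinity> \<and> VA.dom (VA.W sigA z) P < \<infinity>"
    proof -
      have "AE \<xi> in lborel. \<forall>z\<ge>0. VA.W sigA z (\<xi>, 0) < \<infinity> \<and> VA.dom (VA.W sigA z) (\<xi>, 0) < \<infinity>" by (rule AE_W_sigA_finite)
      then have "AE P in (lborel :: (R2 \<times> R2) measure). \<forall>z\<ge>0. VA.W sigA z (fst P, 0) < \<infinity> \<and> VA.dom (VA.W sigA z) (fst P, 0) < \<infinity>"
        by (rule AE_lborel_fst)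
      then show ?thesis
      proof eventually_elim
        case (elim P)
        obtain \<xi> \<zeta> where P: "P = (\<xi>, \<zeta>)" by (cases P)
        show ?case using elim unfolding P W_sigA[of _ \<xi> \<zeta>] dom_W_sigA[of _ \<xi> \<zeta>] by simp
      qed
    qed
    show "AE P in lborel. ?D y P \<le> error_bound (r / sqrt 2) (sqrt 2 * rho) Z eps P + (\<integral>\<^sup>+s\<in>{0..y}. VE.dom (?D s) P \<partial>lborel)"
      using rescaled_eq[OF m y(1)] f1 f2 f3
    proof eventually_elim
      case (elim P)
      let ?I1 = "LINT s:{0..y}|lborel. cis ((y - s) * psi eps P) * VE.gen s (rescaled m s) P"
      let ?I2 = "LINT s:{0..y}|lborel. cis ((y - s) * psi eps P) * VE.gen s (leading s) P"
      let ?X = "cis (y * psi eps P) * of_real (K C c w 0 * bet (fst P) * gam (snd P))"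
      have "norm (rescaled m y P - leading y P) \<le> norm (?X + ?I2 - leading y P) + norm (?I1 - ?I2)"
        unfolding elim(1) using norm_triangle_ineq[of "?X + ?I2 - leading y P" "?I1 - ?I2"] by (simp add: algebra_simps)
      then have "?D y P \<le> ennreal (norm (?X + ?I2 - leading y P)) + ennreal (norm (?I1 - ?I2))"
        by (simp add: ennreal_plus[symmetric] ennreal_leI del: ennreal_plus)
      also have "\<dots> \<le> error_bound (r / sqrt 2) (sqrt 2 * rho) Z eps P + (\<integral>\<^sup>+s\<in>{0..y}. VE.dom (?D s) P \<partial>lborel)"
      proof (rule add_mono)
        show "ennreal (norm (?X + ?I2 - leading y P)) \<le> error_bound (r / sqrt 2) (sqrt 2 * rho) Z eps P"
          by (rule leading_error[OF y _ elim(3)]) (use elim(4) in blast)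
        show "ennreal (norm (?I1 - ?I2)) \<le> (\<integral>\<^sup>+s\<in>{0..y}. VE.dom (?D s) P \<partial>lborel)"
          by (rule VE.gen_integral_diff_le[OF rm leading_measurable elim(2,3)])
      qed
      finally show ?case .
    qed
  next
    show "ennreal B1 + B2 < \<infinity>" using B2 by simp
  qed (use z in auto)
qed

text \<open>Free of \<open>eps\<close>, so the exponential in Gronwall's inequality stays fixed in
  the limit.\<close>

lemma L_le: "VE.L \<le> kap * chI + 2 * lam"
proof -
  have "VE.L = kape * chI + lame" by (simp add: VE.L_def chI_def)
  then show ?thesis using kape_bounds(2) lame_bounds(2) chI_nonneg by (simp add: add_mono mult_right_mono)
qed

lemma AA_scaled_measurable:
  "(\<lambda>P. AA z (fst P, snd P /\<^sub>R eps)) \<in> borel_measurable borel"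
proof -
  have "(\<lambda>P :: R2 \<times> R2. (fst P, snd P /\<^sub>R eps)) \<in> borel_measurable borel"
    by (intro borel_measurable_continuous_onI continuous_intros)
  from measurable_compose[OF this VA.section_measurable[OF AA_measurable, of z]] show ?thesis .
qed

lemma phi_eps_gam: "eps\<^sup>2 * phi eps (r / sqrt 2) (eps *\<^sub>R \<zeta>) = gam \<zeta>"
  unfolding gam_def by (rule phi_scale[OF eps_pos])

text \<open>Measuring \<open>\<zeta>\<close> in units of \<open>eps\<close> turns the remainder,
  multiplied by the Jacobian, into the difference of \<open>rescaled\<close> and
  \<open>leading\<close>.\<close>

lemma remainder_le:
  assumes z: "0 \<le> z" "z \<le> Z"
  shows "(\<integral>\<^sup>+P. ennreal (norm (remainder r rho eps z (fst P) (snd P))) \<partial>lborel)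
    \<le> 2 * (\<integral>\<^sup>+P. error_bound (r / sqrt 2) (sqrt 2 * rho) Z eps P \<partial>lborel) * ennreal (exp (2 * (kap * chI + 2 * lam + 1) * Z))"
proof -
  obtain m where m: "M1_mild_fourier (\<lambda>x. eps * C x) c (r / eps) (rho / eps) (w + eps * Om) (w - eps * Om) m"
    and hat: "\<And>y. 0 \<le> y \<Longrightarrow> AE Q in lborel. M1_hat C c r rho w Om eps y (fst Q) (snd Q) = m y (sum_diff_map Q)"
    using M1_hat_eq[OF cov eps_pos r_pos rho_pos, of c w Om] by blast
  \<comment> \<open>The remainder with \<open>M1_hat\<close> replaced by the path \<open>m\<close>
    that represents it almost everywhere; the change of variables is carried out for this version,
    at every point.\<close>
  define R where "R P = m (z / eps) (sum_diff_map P) * cis (c * (z / eps) / w * (fst P \<bullet> snd P))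
     - of_real (K C c w z * bet (fst P) * phi eps (r / sqrt 2) (snd P))
     - of_real (phi eps (r / sqrt 2) (snd P)) * AA z (fst P, snd P /\<^sub>R eps)" for P
  have z': "0 \<le> z / eps" using z eps_pos by simp
  have "integrable lborel (m (z / eps))" using m z' by (simp add: M1_mild_fourier_def L1_path_def)
  then have mm: "m (z / eps) \<in> borel_measurable borel" by auto
  have mS [measurable]: "(\<lambda>P. m (z / eps) (sum_diff_map P)) \<in> borel_measurable borel"
    by (rule measurable_compose[OF sum_diff_map_measurable mm])
  have Rm: "R \<in> borel_measurable borel"
    unfolding R_def
  proof (intro borel_measurable_diff borel_measurable_times mS AA_scaled_measurable)
  qed measurable
  have nRm: "(\<lambda>P. ennreal (norm (R P))) \<in> borel_measurable borel"
    by (rule measurable_compose[OF Rm]) measurable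
  have "(\<integral>\<^sup>+P. ennreal (norm (remainder r rho eps z (fst P) (snd P))) \<partial>lborel) = (\<integral>\<^sup>+P. ennreal (norm (R P)) \<partial>lborel)"
  proof (rule nn_integral_cong_AE)
    show "AE P in lborel. ennreal (norm (remainder r rho eps z (fst P) (snd P))) = ennreal (norm (R P))"
      using hat[OF z'] by eventually_elim (simp add: remainder_def R_def M1_tilde_def bet_def)
  qed
  also have "\<dots> = ennreal (eps\<^sup>2) * (\<integral>\<^sup>+P. ennreal (norm (R (fst P, eps *\<^sub>R snd P))) \<partial>lborel)"
    using nn_integral_scale_snd[OF nRm eps_pos] by simp
  also have "\<dots> = (\<integral>\<^sup>+P. ennreal (eps\<^sup>2) * ennreal (norm (R (fst P, eps *\<^sub>R snd P))) \<partial>lborel)"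
  proof (rule nn_integral_cmult[symmetric])
    have "(\<lambda>P :: R2 \<times> R2. (fst P, eps *\<^sub>R snd P)) \<in> borel_measurable borel"
      by (intro borel_measurable_continuous_onI continuous_intros)
    from measurable_compose[OF this nRm]
    show "(\<lambda>P. ennreal (norm (R (fst P, eps *\<^sub>R snd P)))) \<in> borel_measurable lborel" by (simp only: measurable_lborel2)
  qed
  also have "\<dots> = (\<integral>\<^sup>+P. ennreal (norm (rescaled m z P - leading z P)) \<partial>lborel)"
  proof (rule nn_integral_cong)
    fix P :: "R2 \<times> R2"
    obtain \<xi> \<zeta> where P: "P = (\<xi>, \<zeta>)" by (cases P)
    have ph: "c * (z / eps) / w * (\<xi> \<bullet> eps *\<^sub>R \<zeta>) = c * z / w * (\<xi> \<bullet> \<zeta>)" using eps_pos by simp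
    have sc: "eps *\<^sub>R \<zeta> /\<^sub>R eps = \<zeta>" using eps_pos by simp
    have "of_real (eps\<^sup>2) * R (\<xi>, eps *\<^sub>R \<zeta>) = of_real (eps\<^sup>2) * (m (z / eps) (Teps P) * cis (c * z / w * (\<xi> \<bullet> \<zeta>)))
       - of_real (K C c w z * bet \<xi> * (eps\<^sup>2 * phi eps (r / sqrt 2) (eps *\<^sub>R \<zeta>)))
       - of_real (eps\<^sup>2 * phi eps (r / sqrt 2) (eps *\<^sub>R \<zeta>)) * AA z (\<xi>, \<zeta>)"
      unfolding R_def fst_conv snd_conv ph sc by (simp add: Teps_def P algebra_simps)
    also have "\<dots> = rescaled m z P - leading z P"
      unfolding phi_eps_gam using z by (simp add: rescaled_def leading_def P algebra_simps)
    finally have "norm (of_real (eps\<^sup>2) * R (\<xi>, eps *\<^sub>R \<zeta>)) = norm (rescaled m z P - leading z P)" by simp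
    then have "eps\<^sup>2 * norm (R (\<xi>, eps *\<^sub>R \<zeta>)) = norm (rescaled m z P - leading z P)"
      unfolding norm_mult norm_of_real by (simp add: abs_of_nonneg)
    then show "ennreal (eps\<^sup>2) * ennreal (norm (R (fst P, eps *\<^sub>R snd P))) = ennreal (norm (rescaled m z P - leading z P))"
      by (simp add: P ennreal_mult[symmetric])
  qed
  also have "\<dots> \<le> 2 * (\<integral>\<^sup>+P. error_bound (r / sqrt 2) (sqrt 2 * rho) Z eps P \<partial>lborel) * ennreal (exp (2 * (VE.L + 1) * Z))"
    by (rule rescaled_leading_le[OF m z])
  also have "\<dots> \<le> 2 * (\<integral>\<^sup>+P. error_bound (r / sqrt 2) (sqrt 2 * rho) Z eps P \<partial>lborel) * ennreal (exp (2 * (kap * chI + 2 * lam + 1) * Z))"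
    using z L_le by (intro mult_left_mono ennreal_leI) (auto intro!: mult_right_mono)
  finally show ?thesis .
qed

text \<open>A finite nonnegative integral alone does not give measurability, so the three terms are
  shown to be integrable one by one.\<close>

lemma remainder_integrable:
  assumes z: "0 \<le> z"
  shows "integrable lborel (\<lambda>P. remainder r rho eps z (fst P) (snd P))"
proof -
  obtain m where hat: "\<And>y. 0 \<le> y \<Longrightarrow> integrable lborel (\<lambda>Q. M1_hat C c r rho w Om eps y (fst Q) (snd Q))"
    using M1_hat_eq[OF cov eps_pos r_pos rho_pos, of c w Om] by blast
  let ?g = "phi eps (r / sqrt 2)"
  have z': "0 \<le> z / eps" using z eps_pos by simp
  have g: "(\<integral>\<^sup>+\<zeta>. ennreal (?g \<zeta>) \<partial>lborel) = 1" using eps_pos r_pos by (intro phi_nn_integral) auto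
  have 1: "integrable lborel (\<lambda>P. M1_tilde C c r rho w Om eps (z / eps) (fst P) (snd P))"
    unfolding M1_tilde_def by (rule integrable_mult_cis[OF hat[OF z']]) measurable
  have 2: "integrable lborel (\<lambda>P. complex_of_real (K C c w z * bet (fst P) * ?g (snd P)))"
  proof (rule integrableI_bounded)
    have "(\<integral>\<^sup>+P. ennreal (norm (complex_of_real (K C c w z * bet (fst P) * ?g (snd P)))) \<partial>lborel)
       = (\<integral>\<^sup>+P. ennreal (K C c w z) * (ennreal (bet (fst P)) * ennreal (?g (snd P))) \<partial>(lborel :: (R2 \<times> R2) measure))"
      unfolding norm_of_real using K_nonneg[of z] bet_nonneg phi_nonneg
      by (intro nn_integral_cong) (simp add: abs_mult ennreal_mult mult.assoc)
    also have "\<dots> = ennreal (K C c w z) * (\<integral>\<^sup>+P. ennreal (bet (fst P)) * ennreal (?g (snd P)) \<partial>(lborel :: (R2 \<times> R2) measure))"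
      by (rule nn_integral_cmult) measurable
    also have "(\<integral>\<^sup>+P. ennreal (bet (fst P)) * ennreal (?g (snd P)) \<partial>(lborel :: (R2 \<times> R2) measure)) = 1"
    proof -
      have "(\<integral>\<^sup>+\<xi>. ennreal (bet \<xi>) \<partial>lborel) = 1" unfolding bet_def using eps_pos rho_pos by (intro phi_nn_integral) auto
      then show ?thesis using g by (subst nn_integral_prod_mult) auto
    qed
    finally show "(\<integral>\<^sup>+P. ennreal (norm (complex_of_real (K C c w z * bet (fst P) * ?g (snd P)))) \<partial>lborel) < \<infinity>" by (simp add: le_less_trans)
  qed measurable
  have 3: "integrable lborel (\<lambda>P. complex_of_real (?g (snd P)) * AA z (fst P, snd P /\<^sub>R eps))"
  proof (rule integrableI_bounded)
    interpret S: volterra_slice "\<lambda>k::R2. (k, 0::R2)" HA "\<lambda>k. kap * ch k" lam theta0 "\<lambda>\<xi>. (\<xi>, 0)" by (rule slice)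
    let ?f = "\<lambda>\<xi>. ennreal (1 + z) * VA.W sigA z (\<xi>, 0)"
    have Wm [measurable]: "(\<lambda>\<xi>. VA.W sigA z (\<xi>, 0)) \<in> borel_measurable borel"
      by (rule measurable_compose[OF Pair_R2_measurable]) measurable
    show "(\<lambda>P. complex_of_real (?g (snd P)) * AA z (fst P, snd P /\<^sub>R eps)) \<in> borel_measurable lborel"
      unfolding measurable_lborel2 by (intro borel_measurable_times AA_scaled_measurable) measurable
    have "(\<integral>\<^sup>+P. ennreal (norm (complex_of_real (?g (snd P)) * AA z (fst P, snd P /\<^sub>R eps))) \<partial>lborel)
       \<le> (\<integral>\<^sup>+P. ?f (fst P) * ennreal (?g (snd P)) \<partial>(lborel :: (R2 \<times> R2) measure))"
    proof (rule nn_integral_mono)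
      fix P :: "R2 \<times> R2"
      have "ennreal (norm (AA z (fst P, snd P /\<^sub>R eps))) \<le> ?f (fst P)"
        using norm_AA_le[OF z order_refl, of "(fst P, snd P /\<^sub>R eps)"] unfolding W_sigA[of z "fst P" "snd P /\<^sub>R eps"] .
      then have "ennreal (norm (AA z (fst P, snd P /\<^sub>R eps))) * ennreal (?g (snd P)) \<le> ?f (fst P) * ennreal (?g (snd P))"
        by (rule mult_right_mono) simp
      then show "ennreal (norm (complex_of_real (?g (snd P)) * AA z (fst P, snd P /\<^sub>R eps))) \<le> ?f (fst P) * ennreal (?g (snd P))"
        using phi_nonneg by (simp add: norm_mult ennreal_mult mult.commute del: ennreal_plus)
    qed
    also have "\<dots> = (\<integral>\<^sup>+\<xi>. ?f \<xi> \<partial>lborel) * (\<integral>\<^sup>+\<zeta>. ennreal (?g \<zeta>) \<partial>lborel)"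
      by (rule nn_integral_prod_mult) measurable
    also have "(\<integral>\<^sup>+\<xi>. ?f \<xi> \<partial>lborel) = ennreal (1 + z) * (\<integral>\<^sup>+\<xi>. VA.W sigA z (\<xi>, 0) \<partial>lborel)"
      by (rule nn_integral_cmult) measurable
    also have "(\<integral>\<^sup>+\<xi>. VA.W sigA z (\<xi>, 0) \<partial>lborel) = ennreal (exp (S.L * z)) * (\<integral>\<^sup>+\<xi>. sigA (\<xi>, 0) \<partial>lborel)"
      by (rule S.nn_integral_W[OF sigA_measurable z])
    also have "ennreal (1 + z) * (ennreal (exp (S.L * z)) * (\<integral>\<^sup>+\<xi>. sigA (\<xi>, 0) \<partial>lborel)) * (\<integral>\<^sup>+\<zeta>. ennreal (?g \<zeta>) \<partial>lborel) < \<infinity>"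
      unfolding g using sigA_finite[of 0] by (simp add: ennreal_mult_less_top del: ennreal_plus)
    finally show "(\<integral>\<^sup>+P. ennreal (norm (complex_of_real (?g (snd P)) * AA z (fst P, snd P /\<^sub>R eps))) \<partial>lborel) < \<infinity>" .
  qed
  show ?thesis
    unfolding remainder_def using 1 2[unfolded bet_def] 3 by (intro Bochner_Integration.integrable_diff)
qed

end

theorem proposition5p1:
  fixes C :: "R2 \<Rightarrow> real" and c\<^sub>o \<omega>\<^sub>0 r\<^sub>0 \<rho>\<^sub>0 \<Omega> :: real
  assumes "c\<^sub>o > 0" "\<omega>\<^sub>0 > 0" "r\<^sub>0 > 0" "\<rho>\<^sub>0 > 0"
    and "covariance_function C"
  shows "\<exists>(A :: real \<Rightarrow> R2 \<Rightarrow> R2 \<Rightarrow> complex) (R :: real \<Rightarrow> real \<Rightarrow> R2 \<Rightarrow> R2 \<Rightarrow> complex).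
    (\<forall>\<zeta>. A_mild C c\<^sub>o \<omega>\<^sub>0 \<zeta> \<Omega> (\<lambda>z \<xi>. A z \<xi> \<zeta>) \<and>
         (\<forall>a. A_mild C c\<^sub>o \<omega>\<^sub>0 \<zeta> \<Omega> a \<longrightarrow> (\<forall>z\<ge>0. AE \<xi> in lborel. a z \<xi> = A z \<xi> \<zeta>))) \<and>
    (\<forall>\<epsilon>>0. \<forall>z\<ge>0. \<forall>\<xi> \<zeta>.
       M1_tilde C c\<^sub>o r\<^sub>0 \<rho>\<^sub>0 \<omega>\<^sub>0 \<Omega> \<epsilon> (z / \<epsilon>) \<xi> \<zeta> =
         of_real (K C c\<^sub>o \<omega>\<^sub>0 z * phi \<epsilon> (sqrt 2 * \<rho>\<^sub>0) \<xi> * phi \<epsilon> (r\<^sub>0 / sqrt 2) \<zeta>)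
         + of_real (phi \<epsilon> (r\<^sub>0 / sqrt 2) \<zeta>) * A z \<xi> (\<zeta> /\<^sub>R \<epsilon>)
         + R \<epsilon> z \<xi> \<zeta>) \<and>
    (\<forall>\<^sub>F \<epsilon> in at_right 0. \<forall>z\<ge>0. integrable lborel (\<lambda>(\<xi>, \<zeta>). R \<epsilon> z \<xi> \<zeta>)) \<and>
    (\<forall>Z>0. ((\<lambda>\<epsilon>. SUP z\<in>{0..Z}. \<integral>\<^sup>+ (\<xi>, \<zeta>). ennreal (norm (R \<epsilon> z \<xi> \<zeta>)) \<partial>lborel)
             \<longlongrightarrow> 0) (at_right 0))"
proof -
  interpret scint C c\<^sub>o \<omega>\<^sub>0 \<Omega> by unfold_locales (use assms in auto)
  define R where "R = remainder r\<^sub>0 \<rho>\<^sub>0"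
  \<comment> \<open>The limit sees only \<open>\<epsilon> < eps0\<close>, where both frequencies are
    positive and the error estimates apply.\<close>
  have at: "at_right 0 = at 0 within {0<..<eps0}"
    by (rule at_within_nhd[of _ "{..<eps0}"]) (use eps0_pos in auto)
  have ev: "\<forall>\<^sub>F \<epsilon> in at_right 0. \<epsilon> \<in> {0<..<eps0}"
    using eventually_at_right_less[of 0] eventually_at_right_field[of "\<lambda>\<epsilon>. \<epsilon> < eps0" 0] eps0_pos
    by (auto simp: eventually_conj_iff)
  have loc: "scint_eps C c\<^sub>o \<omega>\<^sub>0 \<Omega> \<epsilon> r\<^sub>0 \<rho>\<^sub>0" if "\<epsilon> \<in> {0<..<eps0}" for \<epsilon>
    by unfold_locales (use assms that in auto)
  show ?thesis
  \<comment> \<open>\<open>A\<close> is the solution built on the product space, and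
    \<open>R\<close> is the difference: the decomposition holds for every \<open>\<epsilon>\<close>,
    while integrability and smallness are shown for \<open>\<epsilon> < eps0\<close>.\<close>
  proof (intro exI[of _ "\<lambda>z \<xi> \<zeta>. AA z (\<xi>, \<zeta>)"] exI[of _ R] conjI allI impI)
    show "A_mild C c\<^sub>o \<omega>\<^sub>0 \<zeta> \<Omega> (\<lambda>z \<xi>. AA z (\<xi>, \<zeta>))" for \<zeta> by (rule A_mild_AA)
    show "AE \<xi> in lborel. a z \<xi> = AA z (\<xi>, \<zeta>)" if "A_mild C c\<^sub>o \<omega>\<^sub>0 \<zeta> \<Omega> a" "0 \<le> z" for \<zeta> a z
      by (rule A_mild_unique[OF that])
    show "M1_tilde C c\<^sub>o r\<^sub>0 \<rho>\<^sub>0 \<omega>\<^sub>0 \<Omega> \<epsilon> (z / \<epsilon>) \<xi> \<zeta> =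
         of_real (K C c\<^sub>o \<omega>\<^sub>0 z * phi \<epsilon> (sqrt 2 * \<rho>\<^sub>0) \<xi> * phi \<epsilon> (r\<^sub>0 / sqrt 2) \<zeta>)
         + of_real (phi \<epsilon> (r\<^sub>0 / sqrt 2) \<zeta>) * AA z (\<xi>, \<zeta> /\<^sub>R \<epsilon>) + R \<epsilon> z \<xi> \<zeta>" for \<epsilon> z \<xi> \<zeta>
      by (simp add: R_def remainder_def)
    show "\<forall>\<^sub>F \<epsilon> in at_right 0. \<forall>z\<ge>0. integrable lborel (\<lambda>(\<xi>, \<zeta>). R \<epsilon> z \<xi> \<zeta>)"
      using ev
    proof eventually_elim
      case (elim \<epsilon>)
      show ?case
        unfolding R_def split_beta' using scint_eps.remainder_integrable[OF loc[OF elim]] by blast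
    qed
    fix Z :: real assume Z: "Z > 0"
    let ?B = "\<lambda>\<epsilon>. 2 * (\<integral>\<^sup>+P. error_bound (r\<^sub>0 / sqrt 2) (sqrt 2 * \<rho>\<^sub>0) Z \<epsilon> P \<partial>lborel) * ennreal (exp (2 * (kap * chI + 2 * lam + 1) * Z))"
    have "((\<lambda>\<epsilon>. \<integral>\<^sup>+P. error_bound (r\<^sub>0 / sqrt 2) (sqrt 2 * \<rho>\<^sub>0) Z \<epsilon> P \<partial>lborel) \<longlongrightarrow> 0) (at_right 0)"
      unfolding at by (rule error_bound_tendsto) (use assms Z in auto)
    then have "((\<lambda>\<epsilon>. ennreal (exp (2 * (kap * chI + 2 * lam + 1) * Z)) * (2 * (\<integral>\<^sup>+P. error_bound (r\<^sub>0 / sqrt 2) (sqrt 2 * \<rho>\<^sub>0) Z \<epsilon> P \<partial>lborel)))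
        \<longlongrightarrow> ennreal (exp (2 * (kap * chI + 2 * lam + 1) * Z)) * (2 * 0)) (at_right 0)"
      by (intro ennreal_tendsto_cmult) auto
    then have B: "(?B \<longlongrightarrow> 0) (at_right 0)" by (simp add: mult.commute)
    show "((\<lambda>\<epsilon>. SUP z\<in>{0..Z}. \<integral>\<^sup>+ (\<xi>, \<zeta>). ennreal (norm (R \<epsilon> z \<xi> \<zeta>)) \<partial>lborel) \<longlongrightarrow> 0) (at_right 0)"
    proof (rule tendsto_sandwich[OF _ _ tendsto_const B])
      show "\<forall>\<^sub>F \<epsilon> in at_right 0. (SUP z\<in>{0..Z}. \<integral>\<^sup>+ (\<xi>, \<zeta>). ennreal (norm (R \<epsilon> z \<xi> \<zeta>)) \<partial>lborel) \<le> ?B \<epsilon>"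
        using ev
      proof eventually_elim
        case (elim \<epsilon>)
        show ?case
        proof (rule SUP_least)
          fix z assume "z \<in> {0..Z}"
          then show "(\<integral>\<^sup>+ (\<xi>, \<zeta>). ennreal (norm (R \<epsilon> z \<xi> \<zeta>)) \<partial>lborel) \<le> ?B \<epsilon>"
            unfolding R_def split_beta' by (intro scint_eps.remainder_le[OF loc[OF elim]]) auto
        qed
      qed
    qed simp
  qed
qed

end
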